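(* Let $n\in\{3,4,5\}$ and let $(M^n,g)$ be a closed embedded smooth hypersurface in $\mathbb{R}^{n+1}$ with induced metric $g$. Assume that there is a point $Q\in M$ such that the Green function for the conformal Laplacian $P_2^g$ satisfies $G(P,Q)=c_{n,1}\|P-Q\|^{2-n}$ for any $P\in M$. Then $M$ is a round sphere.
   Context: $\|P-Q\|$ is the Euclidean distance in $\mathbb{R}^{n+1}$; $c_{n,1}=\frac{\Gamma(\frac n2-1)}{4\pi^{n/2}}$. The conformal Laplacian is $P_2^g=-\Delta_g+\frac{n-2}{4(n-1)}R_g$, where $\Delta_g$ is the (nonpositive) Laplace–Beltrami operator and $R_g$ the scalar curvature. The Green function with pole $Q$ satisfies $P_2^gG(\cdot,Q)=\delta_Q$ in the distribution sense on $M$. *)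

theory Defs
  imports "HOL-Analysis.Analysis"
begin

section \<open>Smooth maps\<close>

primrec times_differentiable_on ::
  "nat \<Rightarrow> 'a::real_normed_vector set \<Rightarrow> ('a \<Rightarrow> 'b::real_normed_vector) \<Rightarrow> bool" where
  "times_differentiable_on 0 S f \<longleftrightarrow> continuous_on S f"
| "times_differentiable_on (Suc k) S f \<longleftrightarrow>
     (\<forall>x\<in>S. f differentiable (at x)) \<and>
     (\<forall>v. times_differentiable_on k S (\<lambda>x. frechet_derivative f (at x) v))"

(* Only meant for open S: the derivatives are those at x, not within S.  In finite dimension
   the condition at level k is then f being of class C^k on S. *)
definition smooth_on ::
  "'a::real_normed_vector set \<Rightarrow> ('a \<Rightarrow> 'b::real_normed_vector) \<Rightarrow> bool" where
  "smooth_on S f \<longleftrightarrow> (\<forall>k. times_differentiable_on k S f)"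

definition pderivative :: "'n::finite \<Rightarrow> (real^'n \<Rightarrow> 'b::real_normed_vector) \<Rightarrow> real^'n \<Rightarrow> 'b" where
  "pderivative i f x = frechet_derivative f (at x) (axis i 1)"


section \<open>Riemannian metrics in coordinates\<close>

type_synonym 'n metric = "real^'n \<Rightarrow> real^'n^'n"

definition christoffel :: "'n::finite metric \<Rightarrow> 'n \<Rightarrow> 'n \<Rightarrow> 'n \<Rightarrow> real^'n \<Rightarrow> real" where
  "christoffel g k i j x =
     (\<Sum>l\<in>UNIV. matrix_inv (g x) $ k $ l *
        (pderivative i (\<lambda>y. g y $ j $ l) x + pderivative j (\<lambda>y. g y $ i $ l) x
          - pderivative l (\<lambda>y. g y $ i $ j) x)) / 2"

(* Sign convention: round spheres have positive curvature. *)
definition ricci :: "'n::finite metric \<Rightarrow> 'n \<Rightarrow> 'n \<Rightarrow> real^'n \<Rightarrow> real" where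
  "ricci g j k x =
     (\<Sum>i\<in>UNIV. pderivative i (christoffel g i j k) x - pderivative j (christoffel g i i k) x
        + (\<Sum>l\<in>UNIV. christoffel g i i l x * christoffel g l j k x
                    - christoffel g i j l x * christoffel g l i k x))"

definition scalar_curvature :: "'n::finite metric \<Rightarrow> real^'n \<Rightarrow> real" where
  "scalar_curvature g x = (\<Sum>j\<in>UNIV. \<Sum>k\<in>UNIV. matrix_inv (g x) $ j $ k * ricci g j k x)"

definition laplace_beltrami :: "'n::finite metric \<Rightarrow> (real^'n \<Rightarrow> real) \<Rightarrow> real^'n \<Rightarrow> real" where
  "laplace_beltrami g u x =
     (\<Sum>i\<in>UNIV. pderivative i
        (\<lambda>y. sqrt (det (g y)) * (\<Sum>j\<in>UNIV. matrix_inv (g y) $ i $ j * pderivative j u y)) x)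
     / sqrt (det (g x))"

definition coord_conformal_laplacian ::
  "'n::finite metric \<Rightarrow> (real^'n \<Rightarrow> real) \<Rightarrow> real^'n \<Rightarrow> real" where
  "coord_conformal_laplacian g u x =
     - laplace_beltrami g u x
     + (real CARD('n) - 2) / (4 * (real CARD('n) - 1)) * scalar_curvature g x * u x"


section \<open>Hypersurfaces\<close>

text \<open>
  With n = CARD('n), the ambient space of dimension n + 1 is modelled as real ^ ('n option), so
  that local parametrizations of hypersurfaces have domains in real ^ 'n.
\<close>

definition local_parametrization ::
  "(real^('n::finite option)) set \<Rightarrow> (real^'n) set \<Rightarrow> (real^'n \<Rightarrow> real^('n option)) \<Rightarrow> bool" where
  "local_parametrization M V \<psi> \<longleftrightarrow>
     open V \<and> smooth_on V \<psi> \<and> (\<forall>x\<in>V. inj (frechet_derivative \<psi> (at x))) \<and>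
     (\<exists>\<psi>'. homeomorphism V (\<psi> ` V) \<psi> \<psi>') \<and> openin (top_of_set M) (\<psi> ` V)"

(* Closed means compact without boundary.  Connectedness is not part of the definition. *)
definition closed_embedded_hypersurface :: "(real^('n::finite option)) set \<Rightarrow> bool" where
  "closed_embedded_hypersurface M \<longleftrightarrow>
     compact M \<and> (\<forall>p\<in>M. \<exists>V \<psi>. local_parametrization M V \<psi> \<and> p \<in> \<psi> ` V)"

definition induced_metric :: "(real^'n::finite \<Rightarrow> real^('n option)) \<Rightarrow> 'n metric" where
  "induced_metric \<psi> x = (\<chi> i j. pderivative i \<psi> x \<bullet> pderivative j \<psi> x)"

(* Only the values of u on M matter. *)
definition smooth_on_hypersurface ::
  "(real^('n::finite option)) set \<Rightarrow> (real^('n option) \<Rightarrow> real) \<Rightarrow> bool" where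
  "smooth_on_hypersurface M u \<longleftrightarrow>
     (\<forall>V \<psi>. local_parametrization M V \<psi> \<longrightarrow> smooth_on V (u \<circ> \<psi>))"

(* Some local parametrization around p.  It is used below only in an expression that is
   invariant under changes of coordinates. *)
definition parametrization_at ::
  "(real^('n::finite option)) set \<Rightarrow> real^('n option) \<Rightarrow> (real^'n) set \<times> (real^'n \<Rightarrow> real^('n option))"
  where
  "parametrization_at M p =
     (SOME (V, \<psi>). local_parametrization M V \<psi> \<and> p \<in> \<psi> ` V)"

definition conformal_laplacian ::
  "(real^('n::finite option)) set \<Rightarrow> (real^('n option) \<Rightarrow> real) \<Rightarrow> real^('n option) \<Rightarrow> real" where
  "conformal_laplacian M u p =
     (case parametrization_at M p of (V, \<psi>) \<Rightarrow>
        coord_conformal_laplacian (induced_metric \<psi>) (u \<circ> \<psi>) (inv_into V \<psi> p))"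

(* The requirement determines dV, as countably many images of parametrizations cover M. *)
definition riemannian_volume ::
  "(real^('n::finite option)) set \<Rightarrow> (real^('n option)) measure \<Rightarrow> bool" where
  "riemannian_volume M dV \<longleftrightarrow>
     sets dV = sets (restrict_space borel M) \<and>
     (\<forall>V \<psi> A. local_parametrization M V \<psi> \<and> A \<in> sets borel \<and> A \<subseteq> V \<longrightarrow>
        emeasure dV (\<psi> ` A) =
          (\<integral>\<^sup>+x\<in>A. ennreal (sqrt (det (induced_metric \<psi> x))) \<partial>lborel))"

(* The distributional equation: the conformal Laplacian of G is the Dirac mass at Q.  The
   operator is formally self-adjoint, so it appears unchanged on the test functions, which are
   all smooth functions since M is compact. *)
definition conformal_green_function ::
  "(real^('n::finite option)) set \<Rightarrow> (real^('n option)) measure \<Rightarrow> real^('n option) \<Rightarrow>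
     (real^('n option) \<Rightarrow> real) \<Rightarrow> bool" where
  "conformal_green_function M dV Q G \<longleftrightarrow>
     integrable dV G \<and>
     (\<forall>u. smooth_on_hypersurface M u \<longrightarrow>
        (\<integral>P. G P * conformal_laplacian M u P \<partial>dV) = u Q)"

definition green_constant :: "nat \<Rightarrow> real" where
  "green_constant n = Gamma (real n / 2 - 1) / (4 * pi powr (real n / 2))"

definition round_sphere :: "'a::metric_space set \<Rightarrow> bool" where
  "round_sphere M \<longleftrightarrow> (\<exists>a r. 0 < r \<and> M = sphere a r)"

end

theory Submission
  imports Defs
begin

text \<open>
  Write \<open>X = P - Q\<close>, let \<open>II\<close> be the second fundamental form of \<open>M\<close> and let \<open>B\<close> be \<open>II\<close> relative to
  the sphere through \<open>Q\<close> that is tangent to \<open>M\<close> at \<open>P\<close>. Testing the distributional equation with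
  bump functions, integrating by parts in a chart and using the Gauss equation, one finds that away
  from \<open>Q\<close> it says \<open>(tr B)\<^sup>2 = |B|\<^sup>2\<close>; in other words, the inversion of \<open>M\<close> in \<open>Q\<close> is scalar flat.
  Letting \<open>P\<close> tend to \<open>Q\<close> shows that \<open>Q\<close> is an umbilic, so that \<open>w = (X \<bullet> e) / |X|\<^sup>2\<close>, for \<open>e\<close> the
  unit normal at \<open>Q\<close>, tends to a constant \<open>k\<close> at \<open>Q\<close>. If \<open>w > k\<close> somewhere, then for small
  \<open>\<epsilon> > 0\<close> the function \<open>w + \<epsilon> / |X|\<^sup>2\<close> has a local maximum away from \<open>Q\<close>. There a sphere touches
  \<open>M\<close> in such a way that \<open>B\<close> is definite, which contradicts \<open>(tr B)\<^sup>2 = |B|\<^sup>2\<close>. The same argument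
  for \<open>- e\<close> gives \<open>w = k\<close>, which is the equation of a sphere, or of a hyperplane if \<open>k = 0\<close>.
\<close>

section \<open>Calculus of smooth maps\<close>

text \<open>The conformal Laplacian annihilates c |X|^(2-n) away from \<open>Q\<close> exactly when
  the metric |X|^(-4) g is scalar flat, and this is the metric of the inverted hypersurface Y = X /
  |X|^2. Up to scale, B is the second fundamental form of that hypersurface, so the Gauss equation
  gives (tr B)^2 = |B|^2. The obstacle is that this equation is fully nonlinear and degenerates
  where B vanishes, so that no strong maximum principle is at hand; all that is used of it is that B
  cannot be definite. In inverted terms w = Y . e is a height function and 1 / |X|^2 = |Y|^2, so the
  added term is the usual strictly convex perturbation: where Y . e + \<epsilon> |Y|^2 is maximal,
  the inverted hypersurface lies locally inside a sphere and is strictly convex. The inversion sends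
  \<open>Q\<close> to infinity, and the umbilic supplies the control there: the height tends to a
  constant. The inversion itself is never carried out; all computations are made with X on
  \<open>M\<close>.\<close>

lemma frechet_derivative_eqI:
  "(f has_derivative f') (at x) \<Longrightarrow> frechet_derivative f (at x) = f'"
  using frechet_derivative_at by metis

section \<open>Operations that preserve k-fold differentiability\<close>

lemma times_differentiable_on_cong:
  assumes "open S" "\<And>x. x \<in> S \<Longrightarrow> f x = g x"
  shows "times_differentiable_on k S f \<longleftrightarrow> times_differentiable_on k S g"
  using assms(2)
proof (induction k arbitrary: f g)
  case 0
  then show ?case by (simp cong: continuous_on_cong)
next
  case (Suc k)
  have *: "f differentiable (at x) \<longleftrightarrow> g differentiable (at x)"
    "(\<lambda>v. frechet_derivative f (at x) v) = frechet_derivative g (at x)" if "x \<in> S" for x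
  proof -
    have "(f has_derivative D) (at x) \<longleftrightarrow> (g has_derivative D) (at x)" for D
      using Suc.prems assms(1) that has_derivative_transform_within_open by metis
    then show "f differentiable (at x) \<longleftrightarrow> g differentiable (at x)"
      "(\<lambda>v. frechet_derivative f (at x) v) = frechet_derivative g (at x)"
      by (auto simp: differentiable_def frechet_derivative_def)
  qed
  have "times_differentiable_on k S (\<lambda>x. frechet_derivative f (at x) v) \<longleftrightarrow>
        times_differentiable_on k S (\<lambda>x. frechet_derivative g (at x) v)" for v
    by (rule Suc.IH) (simp add: *)
  then show ?case by (simp add: *)
qed

lemma times_differentiable_on_Suc_imp:
  "times_differentiable_on (Suc k) S f \<Longrightarrow> times_differentiable_on k S f"
proof (induction k arbitrary: f)
  case 0
  then show ?case
    by (auto intro!: continuous_at_imp_continuous_on differentiable_imp_continuous_within)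
next
  case (Suc k)
  show ?case
    using Suc.prems Suc.IH by (metis times_differentiable_on.simps(2))
qed

lemma times_differentiable_on_subset:
  "T \<subseteq> S \<Longrightarrow> times_differentiable_on k S f \<Longrightarrow> times_differentiable_on k T f"
  by (induction k arbitrary: f) (auto intro: continuous_on_subset)

lemma times_differentiable_on_zero: "times_differentiable_on k S (\<lambda>x. 0)"
  by (induction k) auto

lemma times_differentiable_on_const: "times_differentiable_on k S (\<lambda>x. c)"
  by (cases k) (auto simp: times_differentiable_on_zero)

lemma times_differentiable_on_linear:
  assumes "bounded_linear L" "open S" "times_differentiable_on k S f"
  shows "times_differentiable_on k S (\<lambda>x. L (f x))"
  using assms(3)
proof (induction k arbitrary: f)
  case 0
  then show ?case using bounded_linear.continuous_on[OF assms(1)] by auto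
next
  case (Suc k)
  have d: "((\<lambda>x. L (f x)) has_derivative (\<lambda>v. L (frechet_derivative f (at x) v))) (at x)"
    if "x \<in> S" for x
    using Suc.prems that
    by (intro bounded_linear.has_derivative[OF assms(1)]) (auto simp: frechet_derivative_works)
  have "times_differentiable_on k S (\<lambda>x. frechet_derivative (\<lambda>x. L (f x)) (at x) v) \<longleftrightarrow>
    times_differentiable_on k S (\<lambda>x. L (frechet_derivative f (at x) v))" for v
    by (rule times_differentiable_on_cong[OF assms(2)]) (simp add: frechet_derivative_eqI[OF d])
  then show ?case
    using Suc by (auto intro!: differentiableI[OF d])
qed

lemma times_differentiable_on_add:
  assumes "open S" "times_differentiable_on k S f" "times_differentiable_on k S g"
  shows "times_differentiable_on k S (\<lambda>x. f x + g x)"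
  using assms(2,3)
proof (induction k arbitrary: f g)
  case 0
  then show ?case by (auto intro: continuous_on_add)
next
  case (Suc k)
  have d: "((\<lambda>x. f x + g x) has_derivative
     (\<lambda>v. frechet_derivative f (at x) v + frechet_derivative g (at x) v)) (at x)"
    if "x \<in> S" for x
    using Suc.prems that
    by (intro has_derivative_add) (auto simp: frechet_derivative_works)
  have "times_differentiable_on k S (\<lambda>x. frechet_derivative (\<lambda>x. f x + g x) (at x) v) \<longleftrightarrow>
    times_differentiable_on k S (\<lambda>x. frechet_derivative f (at x) v + frechet_derivative g (at x) v)" for v
    by (rule times_differentiable_on_cong[OF assms(1)]) (simp add: frechet_derivative_eqI[OF d])
  then show ?case
    using Suc by (auto intro!: differentiableI[OF d])
qed

lemma times_differentiable_on_sum: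
  assumes "open S" "\<And>i. i \<in> I \<Longrightarrow> times_differentiable_on k S (f i)"
  shows "times_differentiable_on k S (\<lambda>x. \<Sum>i\<in>I. f i x)"
  using assms(2)
  by (induction I rule: infinite_finite_induct)
     (auto intro!: times_differentiable_on_add times_differentiable_on_zero assms(1))

lemma times_differentiable_on_bilinear:
  assumes "bounded_bilinear B" "open S" "times_differentiable_on k S f" "times_differentiable_on k S g"
  shows "times_differentiable_on k S (\<lambda>x. B (f x) (g x))"
  using assms(3,4)
proof (induction k arbitrary: f g)
  case 0
  then show ?case using bounded_bilinear.continuous_on[OF assms(1)] by auto
next
  case (Suc k)
  have d: "((\<lambda>x. B (f x) (g x)) has_derivative
     (\<lambda>v. B (f x) (frechet_derivative g (at x) v) + B (frechet_derivative f (at x) v) (g x))) (at x)"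
    if "x \<in> S" for x
    using Suc.prems that
    by (intro bounded_bilinear.FDERIV[OF assms(1)]) (auto simp: frechet_derivative_works)
  have "times_differentiable_on k S (\<lambda>x. frechet_derivative (\<lambda>x. B (f x) (g x)) (at x) v) \<longleftrightarrow>
    times_differentiable_on k S (\<lambda>x. B (f x) (frechet_derivative g (at x) v)
        + B (frechet_derivative f (at x) v) (g x))" for v
    by (rule times_differentiable_on_cong[OF assms(2)]) (simp add: frechet_derivative_eqI[OF d])
  moreover have "times_differentiable_on k S f" "times_differentiable_on k S g"
    using Suc.prems times_differentiable_on_Suc_imp by blast+
  ultimately have "times_differentiable_on k S (\<lambda>x. frechet_derivative (\<lambda>x. B (f x) (g x)) (at x) v)" for v
    using Suc.prems Suc.IH by (auto intro!: times_differentiable_on_add assms(2))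
  then show ?case
    by (auto intro!: differentiableI[OF d])
qed

lemma times_differentiable_on_compose:
  fixes f :: "'b::euclidean_space \<Rightarrow> 'c::real_normed_vector" and g :: "'a::real_normed_vector \<Rightarrow> 'b"
  assumes "open S" "open T" "times_differentiable_on k T f" "times_differentiable_on k S g" "g ` S \<subseteq> T"
  shows "times_differentiable_on k S (\<lambda>x. f (g x))"
  using assms(3,4)
proof (induction k arbitrary: f)
  case 0
  then show ?case
    using continuous_on_compose2[of T f S g] assms(5) by simp
next
  case (Suc k)
  have g: "times_differentiable_on k S g"
    using Suc.prems times_differentiable_on_Suc_imp by blast
  have d: "((\<lambda>x. f (g x)) has_derivative
     (\<lambda>v. frechet_derivative f (at (g x)) (frechet_derivative g (at x) v))) (at x)"
    if "x \<in> S" for x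
  proof (rule has_derivative_compose[of g _ _ _ f])
    show "(g has_derivative frechet_derivative g (at x)) (at x)"
      using Suc.prems(2) that by (simp add: frechet_derivative_works)
    show "(f has_derivative frechet_derivative f (at (g x))) (at (g x))"
      using Suc.prems(1) that assms(5) by (auto simp: frechet_derivative_works)
  qed
  \<comment> \<open>The direction in which \<open>f\<close> is differentiated moves with
    \<open>x\<close>, while the induction hypothesis speaks of fixed directions. Expanding it in
    \<open>Basis\<close> puts the moving part into scalar coefficients.\<close>
  have e: "frechet_derivative (\<lambda>x. f (g x)) (at x) v =
    (\<Sum>b\<in>Basis. (frechet_derivative g (at x) v \<bullet> b) *\<^sub>R frechet_derivative f (at (g x)) b)"
    if "x \<in> S" for x v
  proof -
    have lin: "linear (frechet_derivative f (at (g x)))"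
      using Suc.prems that assms(5) by (intro linear_frechet_derivative) auto
    have "frechet_derivative f (at (g x)) (\<Sum>b\<in>Basis. (w \<bullet> b) *\<^sub>R b) =
       (\<Sum>b\<in>Basis. (w \<bullet> b) *\<^sub>R frechet_derivative f (at (g x)) b)" for w
      by (simp only: linear_sum[OF lin] linear_scale[OF lin])
    from this[of "frechet_derivative g (at x) v"] show ?thesis
      by (simp only: euclidean_representation frechet_derivative_eqI[OF d[OF that]])
  qed
  have "times_differentiable_on k S (\<lambda>x. frechet_derivative f (at (g x)) b)" for b
    by (rule Suc.IH[of "\<lambda>y. frechet_derivative f (at y) b"]) (use Suc.prems(1) g in simp_all)
  then have "times_differentiable_on k S (\<lambda>x. \<Sum>b\<in>Basis. (frechet_derivative g (at x) v \<bullet> b) *\<^sub>R frechet_derivative f (at (g x)) b)" for v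
    by (intro times_differentiable_on_sum times_differentiable_on_bilinear[OF bounded_bilinear_scaleR]
       times_differentiable_on_linear[OF bounded_linear_inner_left] assms(1)) (use Suc.prems(2) in simp_all)
  then have "times_differentiable_on k S (\<lambda>x. frechet_derivative (\<lambda>x. f (g x)) (at x) v)" for v
    by (subst times_differentiable_on_cong[OF assms(1) e]) simp_all
  then show ?case
    by (auto intro!: differentiableI[OF d])
qed

section \<open>The same operations for smooth maps\<close>

named_theorems smooth_intros

lemma smooth_on_cong:
  assumes "open S" "\<And>x. x \<in> S \<Longrightarrow> f x = g x"
  shows "smooth_on S f \<longleftrightarrow> smooth_on S g"
  unfolding smooth_on_def using times_differentiable_on_cong[OF assms] by simp

lemma smooth_on_subset: "smooth_on S f \<Longrightarrow> T \<subseteq> S \<Longrightarrow> smooth_on T f"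
  unfolding smooth_on_def using times_differentiable_on_subset by blast

lemma smooth_on_differentiable: "smooth_on S f \<Longrightarrow> x \<in> S \<Longrightarrow> f differentiable (at x)"
  unfolding smooth_on_def by (metis times_differentiable_on.simps(2))

lemma smooth_on_continuous: "smooth_on S f \<Longrightarrow> continuous_on S f"
  unfolding smooth_on_def by (metis times_differentiable_on.simps(1))

lemma smooth_on_derivative: "smooth_on S f \<Longrightarrow> smooth_on S (\<lambda>x. frechet_derivative f (at x) v)"
  unfolding smooth_on_def by (metis times_differentiable_on.simps(2))

lemma smooth_on_pderivative [smooth_intros]: "smooth_on S f \<Longrightarrow> smooth_on S (pderivative i f)"
  unfolding pderivative_def[abs_def] by (rule smooth_on_derivative)

lemma smooth_on_const [smooth_intros]: "smooth_on S (\<lambda>x. c)"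
  by (simp add: smooth_on_def times_differentiable_on_const)

lemma smooth_on_linear:
  "bounded_linear L \<Longrightarrow> open S \<Longrightarrow> smooth_on S f \<Longrightarrow> smooth_on S (\<lambda>x. L (f x))"
  by (simp add: smooth_on_def times_differentiable_on_linear)

lemma smooth_on_ident [smooth_intros]: "smooth_on S (\<lambda>x. x)"
  unfolding smooth_on_def
proof
  show "times_differentiable_on k S (\<lambda>x. x)" for k
    by (cases k) (auto simp: times_differentiable_on_const)
qed

lemma smooth_on_add [smooth_intros]:
  "open S \<Longrightarrow> smooth_on S f \<Longrightarrow> smooth_on S g \<Longrightarrow> smooth_on S (\<lambda>x. f x + g x)"
  by (simp add: smooth_on_def times_differentiable_on_add)

lemma smooth_on_sum [smooth_intros]:
  "open S \<Longrightarrow> (\<And>i. i \<in> I \<Longrightarrow> smooth_on S (f i)) \<Longrightarrow> smooth_on S (\<lambda>x. \<Sum>i\<in>I. f i x)"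
  by (simp add: smooth_on_def times_differentiable_on_sum)

lemma smooth_on_scaleR [smooth_intros]:
  "open S \<Longrightarrow> smooth_on S f \<Longrightarrow> smooth_on S g \<Longrightarrow> smooth_on S (\<lambda>x. f x *\<^sub>R g x)"
  by (simp add: smooth_on_def times_differentiable_on_bilinear[OF bounded_bilinear_scaleR])

lemma smooth_on_inner [smooth_intros]:
  "open S \<Longrightarrow> smooth_on S f \<Longrightarrow> smooth_on S g \<Longrightarrow> smooth_on S (\<lambda>x. f x \<bullet> g x)"
  by (simp add: smooth_on_def times_differentiable_on_bilinear[OF bounded_bilinear_inner])

lemma smooth_on_mult [smooth_intros]:
  fixes f g :: "_ \<Rightarrow> 'b::real_normed_algebra"
  shows "open S \<Longrightarrow> smooth_on S f \<Longrightarrow> smooth_on S g \<Longrightarrow> smooth_on S (\<lambda>x. f x * g x)"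
  by (simp add: smooth_on_def times_differentiable_on_bilinear[OF bounded_bilinear_mult])

lemma smooth_on_minus [smooth_intros]:
  "open S \<Longrightarrow> smooth_on S f \<Longrightarrow> smooth_on S (\<lambda>x. - f x)"
  using smooth_on_linear[OF bounded_linear_minus[OF bounded_linear_ident], of S f] by simp

lemma smooth_on_diff [smooth_intros]:
  "open S \<Longrightarrow> smooth_on S f \<Longrightarrow> smooth_on S g \<Longrightarrow> smooth_on S (\<lambda>x. f x - g x)"
  using smooth_on_add[of S f "\<lambda>x. - g x"] smooth_on_minus[of S g] by simp

lemma smooth_on_prod [smooth_intros]:
  fixes f :: "'i \<Rightarrow> _ \<Rightarrow> real"
  assumes "open S" "\<And>i. i \<in> I \<Longrightarrow> smooth_on S (f i)"
  shows "smooth_on S (\<lambda>x. \<Prod>i\<in>I. f i x)"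
  using assms(2)
  by (induction I rule: infinite_finite_induct) (simp_all add: smooth_on_const smooth_on_mult assms(1))

lemma smooth_on_compose:
  fixes f :: "'b::euclidean_space \<Rightarrow> 'c::real_normed_vector" and g :: "'a::real_normed_vector \<Rightarrow> 'b"
  assumes "open S" "open T" "smooth_on T f" "smooth_on S g" "g ` S \<subseteq> T"
  shows "smooth_on S (\<lambda>x. f (g x))"
  unfolding smooth_on_def
proof
  show "times_differentiable_on k S (\<lambda>x. f (g x))" for k
    by (rule times_differentiable_on_compose[OF assms(1,2) _ _ assms(5)])
       (use assms(3,4) in \<open>simp_all add: smooth_on_def\<close>)
qed

lemma smooth_on_powr_const: "smooth_on {0<..} (\<lambda>x::real. x powr a)"
proof -
  \<comment> \<open>The factor \<open>c\<close> makes the family closed under differentiation up to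
    linear maps, as the induction requires.\<close>
  have "times_differentiable_on k {0<..} (\<lambda>x::real. c * x powr a)" for k c
  proof (induction k arbitrary: a c)
    case 0
    then show ?case by (auto intro!: continuous_intros)
  next
    case (Suc k)
    have d: "((\<lambda>x. c * x powr a) has_derivative (\<lambda>v. v * ((c * a) * x powr (a - 1)))) (at x)" if "x > 0" for x
      using DERIV_cmult[OF has_real_derivative_powr[OF that, of a], of c]
      by (rule has_derivative_eq_rhs[OF has_field_derivative_imp_has_derivative]) (simp add: fun_eq_iff)
    have "times_differentiable_on k {0<..} (\<lambda>x. v *\<^sub>R ((c * a) * x powr (a - 1)))" for v
      by (rule times_differentiable_on_linear[OF bounded_linear_scaleR_right]) (auto intro: Suc.IH)
    then have "times_differentiable_on k {0<..} (\<lambda>x. frechet_derivative (\<lambda>x. c * x powr a) (at x) v)" for v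
      using times_differentiable_on_cong[of "{0<..}" "\<lambda>x. frechet_derivative (\<lambda>x. c * x powr a) (at x) v"
          "\<lambda>x. v *\<^sub>R ((c * a) * x powr (a - 1))" k]
      by (simp add: frechet_derivative_eqI[OF d])
    then show ?case
      using d by (metis differentiableI greaterThan_iff times_differentiable_on.simps(2))
  qed
  from this[of _ 1] show ?thesis by (simp add: smooth_on_def)
qed

lemma smooth_on_powr [smooth_intros]:
  fixes f :: "_ \<Rightarrow> real"
  assumes "open S" "smooth_on S f" "\<And>x. x \<in> S \<Longrightarrow> f x > 0"
  shows "smooth_on S (\<lambda>x. f x powr a)"
  by (rule smooth_on_compose[OF assms(1) open_greaterThan smooth_on_powr_const assms(2)]) (use assms(3) in auto)

lemma smooth_on_sqrt [smooth_intros]: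
  fixes f :: "_ \<Rightarrow> real"
  assumes "open S" "smooth_on S f" "\<And>x. x \<in> S \<Longrightarrow> f x > 0"
  shows "smooth_on S (\<lambda>x. sqrt (f x))"
proof (subst smooth_on_cong[OF assms(1)])
  show "sqrt (f x) = f x powr (1/2)" if "x \<in> S" for x
    using assms(3)[OF that] by (simp add: powr_half_sqrt)
  show "smooth_on S (\<lambda>x. f x powr (1/2))"
    by (intro smooth_intros assms)
qed

lemma smooth_on_divide [smooth_intros]:
  fixes f :: "_ \<Rightarrow> real"
  assumes "open S" "smooth_on S f" "smooth_on S g" "\<And>x. x \<in> S \<Longrightarrow> g x > 0"
  shows "smooth_on S (\<lambda>x. f x / g x)"
proof (subst smooth_on_cong[OF assms(1)])
  show "f x / g x = f x * g x powr (-1)" if "x \<in> S" for x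
    using assms(4)[OF that] by (simp add: powr_minus_divide)
  show "smooth_on S (\<lambda>x. f x * g x powr (-1))"
    by (intro smooth_intros assms)
qed

lemma smooth_on_component [smooth_intros]:
  "open S \<Longrightarrow> smooth_on S f \<Longrightarrow> smooth_on S (\<lambda>x. f x $ i)"
  by (rule smooth_on_linear[OF bounded_linear_vec_nth])

lemma smooth_on_det [smooth_intros]:
  fixes A :: "_ \<Rightarrow> real^'n^'n"
  assumes "open S" "\<And>i j. smooth_on S (\<lambda>x. A x $ i $ j)"
  shows "smooth_on S (\<lambda>x. det (A x))"
  unfolding det_def by (intro smooth_intros assms)

subsection \<open>A smooth bump function\<close>

lemma smooth_on_bump_profile:
  "smooth_on UNIV (\<lambda>t::real. if t > 0 then exp (- 1 / t) else 0)"
proof -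
  \<comment> \<open>A family that contains the profile as \<open>b 0\<close> and is closed under
    differentiation: the derivative of \<open>b m\<close> is a combination of
    \<open>b (m + 2)\<close> and \<open>b (Suc m)\<close>.\<close>
  define b where "b m t = (if t > 0 then exp (- inverse t) * inverse t ^ m else 0)" for m and t :: real
  have lim: "(b m \<longlongrightarrow> 0) (at 0)" for m
  proof -
    have *: "((\<lambda>x::real. inverse x ^ m / exp (inverse x)) \<longlongrightarrow> 0) (at_right 0)"
      by (rule filterlim_compose[OF tendsto_power_div_exp_0 filterlim_inverse_at_top_right])
    have "(b m \<longlongrightarrow> 0) (at_right 0)"
      by (rule Lim_transform_eventually[OF *], rule eventually_mono[OF eventually_at_right_less[of 0]])
         (simp add: b_def exp_minus field_simps)
    moreover have "(b m \<longlongrightarrow> 0) (at_left 0)"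
      by (rule tendsto_eventually, rule eventually_mono[OF eventually_at_left_real[of "-1" 0]]) (auto simp: b_def)
    ultimately show ?thesis by (simp add: filterlim_split_at)
  qed
  have d: "(b m has_real_derivative (b (m + 2) t - real m * b (Suc m) t)) (at t)" for m t
  proof (cases t "0::real" rule: linorder_cases)
    case less
    have "((\<lambda>t. 0) has_real_derivative (b (m + 2) t - real m * b (Suc m) t)) (at t)"
      using less by (simp add: b_def)
    then show ?thesis
      by (rule has_field_derivative_transform_within_open[of _ _ _ "{..<0}"]) (use less in \<open>auto simp: b_def\<close>)
  next
    case greater
    have "((\<lambda>t. exp (- inverse t) * inverse t ^ m) has_real_derivative
      (inverse t ^ 2 * exp (- inverse t) * inverse t ^ m
        + exp (- inverse t) * (real m * (- (inverse t ^ 2) * inverse t ^ (m - 1))))) (at t)"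
      using greater by (auto intro!: derivative_eq_intros simp: power2_eq_square)
    also have "inverse t ^ 2 * exp (- inverse t) * inverse t ^ m
        + exp (- inverse t) * (real m * (- (inverse t ^ 2) * inverse t ^ (m - 1)))
      = b (m + 2) t - real m * b (Suc m) t"
      using greater by (cases m) (simp_all add: b_def algebra_simps power2_eq_square)
    finally show ?thesis
      by (rule has_field_derivative_transform_within_open[of _ _ _ "{0<..}"]) (use greater in \<open>auto simp: b_def\<close>)
  next
    case equal
    \<comment> \<open>At the origin the difference quotient of \<open>b m\<close> is
      \<open>b (Suc m)\<close>, which tends to zero by \<open>lim\<close>.\<close>
    have "((\<lambda>h. (b m (0 + h) - b m 0) / h) \<longlongrightarrow> 0) (at 0)"
      by (rule Lim_transform_eventually[OF lim[of "Suc m"]])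
         (auto simp: b_def eventually_at_filter divide_inverse)
    then show ?thesis using equal by (simp add: DERIV_def b_def)
  qed
  have "times_differentiable_on k UNIV (b m)" for k m
  proof (induction k arbitrary: m)
    case 0
    then show ?case using d by (auto intro!: DERIV_continuous_on[where D="\<lambda>t. b (m + 2) t - real m * b (Suc m) t"] simp: has_field_derivative_at_within)
  next
    case (Suc k)
    have e: "frechet_derivative (b m) (at t) v = v *\<^sub>R (b (m + 2) t + (- real m) *\<^sub>R b (Suc m) t)" for t v
      using frechet_derivative_eqI[OF d[of m t, unfolded has_field_derivative_def]] by (simp add: algebra_simps)
    have "b m differentiable (at t)" for t
      using d[of m t] by (auto simp: has_field_derivative_def differentiable_def)
    moreover have "times_differentiable_on k UNIV (\<lambda>t. v *\<^sub>R (b (m + 2) t + (- real m) *\<^sub>R b (Suc m) t))" for v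
      by (intro times_differentiable_on_add times_differentiable_on_linear[OF bounded_linear_scaleR_right]
          Suc open_UNIV)
    ultimately show ?case by (simp add: e)
  qed
  then have "smooth_on UNIV (b 0)" by (simp add: smooth_on_def)
  moreover have "b 0 = (\<lambda>t::real. if t > 0 then exp (- 1 / t) else 0)"
    by (rule ext) (simp add: b_def inverse_eq_divide)
  ultimately show ?thesis by (simp only:)
qed

lemma smooth_bump_exists:
  fixes p :: "'a::euclidean_space"
  assumes "r > 0"
  obtains u :: "'a \<Rightarrow> real" where "smooth_on UNIV u" "\<And>x. u x \<ge> 0" "u p > 0" "\<And>x. dist x p \<ge> r \<Longrightarrow> u x = 0"
proof -
  define f :: "real \<Rightarrow> real" where "f t = (if t > 0 then exp (- 1 / t) else 0)" for t
  define u where "u x = f (r\<^sup>2 - (x - p) \<bullet> (x - p))" for x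
  have "smooth_on UNIV u"
    unfolding u_def
  proof (rule smooth_on_compose[where T=UNIV and f=f])
    show "smooth_on UNIV f" unfolding f_def[abs_def] by (rule smooth_on_bump_profile)
    show "smooth_on UNIV (\<lambda>x. r\<^sup>2 - (x - p) \<bullet> (x - p))" by (intro smooth_intros open_UNIV)
  qed auto
  moreover have "u x \<ge> 0" for x by (simp add: u_def f_def)
  moreover have "u p > 0" using assms by (simp add: u_def f_def)
  moreover have "u x = 0" if "dist x p \<ge> r" for x
  proof -
    have "r\<^sup>2 \<le> (norm (x - p))\<^sup>2" using that assms by (intro power_mono) (auto simp: dist_norm)
    then show ?thesis by (simp add: u_def f_def power2_norm_eq_inner)
  qed
  ultimately show ?thesis using that by blast
qed

subsection \<open>Partial derivatives\<close>

lemma pderivative_eqI: "(f has_derivative f') (at x) \<Longrightarrow> pderivative i f x = f' (axis i 1)"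
  by (simp add: pderivative_def frechet_derivative_eqI)

lemma frechet_derivative_eq_sum_pderivative:
  fixes f :: "real^'n \<Rightarrow> 'b::real_normed_vector"
  assumes "f differentiable (at x)"
  shows "frechet_derivative f (at x) v = (\<Sum>i\<in>UNIV. v $ i *\<^sub>R pderivative i f x)"
proof -
  have lin: "linear (frechet_derivative f (at x))"
    using assms by (rule linear_frechet_derivative)
  have "frechet_derivative f (at x) (\<Sum>i\<in>UNIV. v $ i *\<^sub>R axis i 1) = (\<Sum>i\<in>UNIV. v $ i *\<^sub>R pderivative i f x)"
    by (simp only: linear_sum[OF lin] linear_scale[OF lin] pderivative_def)
  moreover have "(\<Sum>i\<in>UNIV. v $ i *\<^sub>R axis i 1) = v"
    using basis_expansion[of v] by (simp add: scalar_mult_eq_scaleR)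
  ultimately show ?thesis by simp
qed

lemma has_derivative_pderivative:
  fixes f :: "real^'n \<Rightarrow> 'b::real_normed_vector"
  assumes "f differentiable (at x)"
  shows "(f has_derivative (\<lambda>v. \<Sum>i\<in>UNIV. v $ i *\<^sub>R pderivative i f x)) (at x)"
proof -
  have "frechet_derivative f (at x) = (\<lambda>v. \<Sum>i\<in>UNIV. v $ i *\<^sub>R pderivative i f x)"
    by (rule ext) (rule frechet_derivative_eq_sum_pderivative[OF assms])
  then show ?thesis using assms by (simp add: frechet_derivative_works)
qed

lemma pderivative_cong:
  assumes "open S" "x \<in> S" "\<And>y. y \<in> S \<Longrightarrow> f y = g y"
  shows "pderivative i f x = pderivative i g x"
proof -
  have "(f has_derivative D) (at x) \<longleftrightarrow> (g has_derivative D) (at x)" for D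
    using assms has_derivative_transform_within_open by metis
  then show ?thesis by (auto simp: pderivative_def frechet_derivative_def)
qed

lemma pderivative_const: "pderivative i (\<lambda>x. c) x = 0"
  by (simp add: pderivative_def)

lemma pderivative_add:
  "f differentiable (at x) \<Longrightarrow> g differentiable (at x) \<Longrightarrow>
    pderivative i (\<lambda>y. f y + g y) x = pderivative i f x + pderivative i g x"
  unfolding frechet_derivative_works
  by (subst pderivative_eqI[OF has_derivative_add]) (assumption | simp add: pderivative_def)+

lemma pderivative_diff:
  "f differentiable (at x) \<Longrightarrow> g differentiable (at x) \<Longrightarrow>
    pderivative i (\<lambda>y. f y - g y) x = pderivative i f x - pderivative i g x"
  unfolding frechet_derivative_works
  by (subst pderivative_eqI[OF has_derivative_diff]) (assumption | simp add: pderivative_def)+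

lemma pderivative_sum:
  "(\<And>k. k \<in> I \<Longrightarrow> f k differentiable (at x)) \<Longrightarrow>
    pderivative i (\<lambda>y. \<Sum>k\<in>I. f k y) x = (\<Sum>k\<in>I. pderivative i (f k) x)"
  unfolding frechet_derivative_works
  by (subst pderivative_eqI[OF has_derivative_sum]) (assumption | simp add: pderivative_def)+

lemma pderivative_bilinear:
  assumes "bounded_bilinear B" "f differentiable (at x)" "g differentiable (at x)"
  shows "pderivative i (\<lambda>y. B (f y) (g y)) x = B (pderivative i f x) (g x) + B (f x) (pderivative i g x)"
  using assms(2,3) unfolding frechet_derivative_works
  by (subst pderivative_eqI[OF bounded_bilinear.FDERIV[OF assms(1)]]) (assumption | simp add: pderivative_def)+

lemmas pderivative_inner = pderivative_bilinear[OF bounded_bilinear_inner]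
lemmas pderivative_scaleR = pderivative_bilinear[OF bounded_bilinear_scaleR]
lemmas pderivative_mult = pderivative_bilinear[OF bounded_bilinear_mult]

lemma pderivative_linear:
  assumes "bounded_linear L" "f differentiable (at x)"
  shows "pderivative i (\<lambda>y. L (f y)) x = L (pderivative i f x)"
  using assms(2) unfolding frechet_derivative_works
  by (subst pderivative_eqI[OF bounded_linear.has_derivative[OF assms(1)]]) (assumption | simp add: pderivative_def)+

lemma pderivative_compose:
  assumes "f differentiable (at (g x))" "g differentiable (at x)"
  shows "pderivative i (\<lambda>y. f (g y)) x = frechet_derivative f (at (g x)) (pderivative i g x)"
  using assms unfolding frechet_derivative_works
  by (subst pderivative_eqI[OF has_derivative_compose[of g _ x UNIV f]]) (assumption | simp add: pderivative_def)+

lemma pderivative_real_compose: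
  assumes "(h has_real_derivative d) (at (f x))" "f differentiable (at x)"
  shows "pderivative i (\<lambda>y. h (f y)) x = d * pderivative i f x"
proof -
  have "(h has_derivative (\<lambda>v. d * v)) (at (f x))"
    using assms(1) by (simp add: has_field_derivative_def)
  from has_derivative_compose[OF assms(2)[unfolded frechet_derivative_works] this]
  show ?thesis by (subst pderivative_eqI, assumption) (simp add: pderivative_def)
qed

section \<open>Mean values along lines and the symmetry of second derivatives\<close>

lemma DERIV_along_line:
  assumes "f differentiable (at (x + t *\<^sub>R v))"
  shows "((\<lambda>s. f (x + s *\<^sub>R v)) has_vector_derivative frechet_derivative f (at (x + t *\<^sub>R v)) v) (at t)"
proof -
  have 1: "((\<lambda>s. x + s *\<^sub>R v) has_derivative (\<lambda>s. s *\<^sub>R v)) (at t)"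
    by (auto intro!: derivative_eq_intros)
  have lin: "linear (frechet_derivative f (at (x + t *\<^sub>R v)))"
    using assms by (rule linear_frechet_derivative)
  show ?thesis
    using has_derivative_compose[OF 1 assms[unfolded frechet_derivative_works]]
    by (simp add: has_vector_derivative_def linear_scale[OF lin])
qed

text \<open>Two applications of the mean value theorem, first in direction \<open>i\<close> to the
  difference of two parallel lines, then in direction \<open>j\<close>. The second difference on the
  left is symmetric in \<open>i\<close> and \<open>j\<close>, which is the source of the symmetry of
  second derivatives.\<close>

lemma second_difference_mean_value:
  fixes f :: "real^'n \<Rightarrow> real"
  assumes "h > 0" and d1: "\<And>s t. 0 \<le> s \<Longrightarrow> s \<le> h \<Longrightarrow> 0 \<le> t \<Longrightarrow> t \<le> h \<Longrightarrow> f differentiable (at (x + s *\<^sub>R axis i 1 + t *\<^sub>R axis j 1))"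
    and d2: "\<And>s t. 0 \<le> s \<Longrightarrow> s \<le> h \<Longrightarrow> 0 \<le> t \<Longrightarrow> t \<le> h \<Longrightarrow> pderivative i f differentiable (at (x + s *\<^sub>R axis i 1 + t *\<^sub>R axis j 1))"
  obtains s t where "0 < s" "s < h" "0 < t" "t < h"
    "f (x + h *\<^sub>R axis i 1 + h *\<^sub>R axis j 1) - f (x + h *\<^sub>R axis i 1) - f (x + h *\<^sub>R axis j 1) + f x
      = h\<^sup>2 * pderivative j (pderivative i f) (x + s *\<^sub>R axis i 1 + t *\<^sub>R axis j 1)"
proof -
  let ?a = "axis i 1 :: real^'n" and ?b = "axis j 1 :: real^'n"
  define p where "p s = f (x + h *\<^sub>R ?b + s *\<^sub>R ?a) - f (x + s *\<^sub>R ?a)" for s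
  have dp: "(p has_real_derivative (pderivative i f (x + s *\<^sub>R ?a + h *\<^sub>R ?b) - pderivative i f (x + s *\<^sub>R ?a))) (at s)"
    if "0 \<le> s" "s \<le> h" for s
  proof -
    have "((\<lambda>s. f (x + h *\<^sub>R ?b + s *\<^sub>R ?a)) has_vector_derivative pderivative i f (x + s *\<^sub>R ?a + h *\<^sub>R ?b)) (at s)"
      using DERIV_along_line[of f "x + h *\<^sub>R ?b" s ?a] d1[of s h] that assms(1)
      by (simp add: pderivative_def add_ac)
    moreover have "((\<lambda>s. f (x + s *\<^sub>R ?a)) has_vector_derivative pderivative i f (x + s *\<^sub>R ?a)) (at s)"
      using DERIV_along_line[of f x s ?a] d1[of s 0] that assms(1)
      by (simp add: pderivative_def)
    ultimately show ?thesis unfolding p_def has_real_derivative_iff_has_vector_derivative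
      by (rule has_vector_derivative_diff)
  qed
  obtain s where s: "0 < s" "s < h" "p h - p 0 = (h - 0) * (pderivative i f (x + s *\<^sub>R ?a + h *\<^sub>R ?b) - pderivative i f (x + s *\<^sub>R ?a))"
    using MVT2[OF assms(1) dp] by metis
  define q where "q t = pderivative i f (x + s *\<^sub>R ?a + t *\<^sub>R ?b)" for t
  have dq: "(q has_real_derivative (pderivative j (pderivative i f) (x + s *\<^sub>R ?a + t *\<^sub>R ?b))) (at t)"
    if "0 \<le> t" "t \<le> h" for t
    unfolding q_def has_real_derivative_iff_has_vector_derivative
    using DERIV_along_line[of "pderivative i f" "x + s *\<^sub>R ?a" t ?b] d2[of s t] that s
    by (simp add: pderivative_def)
  obtain t where t: "0 < t" "t < h" "q h - q 0 = (h - 0) * (pderivative j (pderivative i f) (x + s *\<^sub>R ?a + t *\<^sub>R ?b))"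
    using MVT2[OF assms(1) dq] by metis
  show ?thesis
    by (rule that[OF s(1,2) t(1,2)]) (use s(3) t(3) in \<open>simp add: p_def q_def power2_eq_square algebra_simps\<close>)
qed

lemma pderivative_commute_real:
  fixes f :: "real^'n \<Rightarrow> real"
  assumes V: "open V" "x \<in> V" and f: "smooth_on V f"
  shows "pderivative j (pderivative i f) x = pderivative i (pderivative j f) x"
proof (rule ccontr)
  define F where "F = pderivative j (pderivative i f)"
  define H where "H = pderivative i (pderivative j f)"
  assume "\<not> ?thesis"
  then have e: "\<bar>F x - H x\<bar> / 2 > 0" by (simp add: F_def H_def)
  have "continuous_on V F" "continuous_on V H"
    unfolding F_def H_def by (intro smooth_on_continuous smooth_intros f)+
  then have "isCont F x" "isCont H x" using V continuous_on_eq_continuous_at by blast+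
  then obtain d1 d2 where d: "d1 > 0" "\<And>y. dist y x < d1 \<Longrightarrow> dist (F y) (F x) < \<bar>F x - H x\<bar> / 2"
     "d2 > 0" "\<And>y. dist y x < d2 \<Longrightarrow> dist (H y) (H x) < \<bar>F x - H x\<bar> / 2"
    using e unfolding continuous_at_eps_delta by metis
  obtain r where r: "r > 0" "ball x r \<subseteq> V" using V open_contains_ball by blast
  \<comment> \<open>The points produced by the mean value theorem lie within \<open>2 * h\<close> of
    \<open>x\<close>, hence strictly within \<open>3 * h\<close>.\<close>
  define h where "h = Min {r, d1, d2} / 3"
  have h: "h > 0" "3 * h \<le> r" "3 * h \<le> d1" "3 * h \<le> d2"
    using r(1) d(1,3) by (auto simp: h_def)
  have near: "dist (x + s *\<^sub>R axis k 1 + t *\<^sub>R axis l 1) x < 3 * h"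
    if "0 \<le> s" "s \<le> h" "0 \<le> t" "t \<le> h" for s t and k l :: 'n
  proof -
    have "norm (s *\<^sub>R axis k 1 + t *\<^sub>R axis l 1 :: real^'n) \<le> s + t"
      using that norm_triangle_ineq[of "s *\<^sub>R axis k 1 :: real^'n" "t *\<^sub>R axis l 1"] by (simp add: norm_axis_1)
    then show ?thesis using that h(1) by (simp add: dist_norm add.assoc)
  qed
  have inV: "x + s *\<^sub>R axis k 1 + t *\<^sub>R axis l 1 \<in> V"
    if "0 \<le> s" "s \<le> h" "0 \<le> t" "t \<le> h" for s t and k l :: 'n
    using near[OF that, of k l] h(2) r(2) by (force simp: dist_commute)
  have D: "f differentiable (at y)" "pderivative k f differentiable (at y)" if "y \<in> V" for y k
    using f that by (auto intro: smooth_on_differentiable smooth_on_pderivative)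
  obtain s t where st: "0 < s" "s < h" "0 < t" "t < h"
    "f (x + h *\<^sub>R axis i 1 + h *\<^sub>R axis j 1) - f (x + h *\<^sub>R axis i 1) - f (x + h *\<^sub>R axis j 1) + f x
      = h\<^sup>2 * F (x + s *\<^sub>R axis i 1 + t *\<^sub>R axis j 1)"
    unfolding F_def by (rule second_difference_mean_value[OF h(1), of f x i j]) (auto intro: D inV)
  obtain s' t' where st': "0 < s'" "s' < h" "0 < t'" "t' < h"
    "f (x + h *\<^sub>R axis j 1 + h *\<^sub>R axis i 1) - f (x + h *\<^sub>R axis j 1) - f (x + h *\<^sub>R axis i 1) + f x
      = h\<^sup>2 * H (x + s' *\<^sub>R axis j 1 + t' *\<^sub>R axis i 1)"
    unfolding H_def by (rule second_difference_mean_value[OF h(1), of f x j i]) (auto intro: D inV)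
  have "h\<^sup>2 * F (x + s *\<^sub>R axis i 1 + t *\<^sub>R axis j 1) = h\<^sup>2 * H (x + s' *\<^sub>R axis j 1 + t' *\<^sub>R axis i 1)"
    unfolding st(5)[symmetric] st'(5)[symmetric] by (simp add: add_ac)
  then have "F (x + s *\<^sub>R axis i 1 + t *\<^sub>R axis j 1) = H (x + s' *\<^sub>R axis j 1 + t' *\<^sub>R axis i 1)"
    using h(1) by simp
  moreover have "dist (F (x + s *\<^sub>R axis i 1 + t *\<^sub>R axis j 1)) (F x) < \<bar>F x - H x\<bar> / 2"
    using st near[of s t i j] h by (intro d(2)) linarith
  moreover have "dist (H (x + s' *\<^sub>R axis j 1 + t' *\<^sub>R axis i 1)) (H x) < \<bar>F x - H x\<bar> / 2"
    using st' near[of s' t' j i] h by (intro d(4)) linarith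
  ultimately show False by (simp add: dist_real_def abs_if split: if_splits)
qed

lemma pderivative_commute:
  fixes f :: "real^'n \<Rightarrow> 'b::euclidean_space"
  assumes V: "open V" "x \<in> V" and f: "smooth_on V f"
  shows "pderivative j (pderivative i f) x = pderivative i (pderivative j f) x"
proof (rule euclidean_eqI)
  fix b :: 'b
  have D: "f differentiable (at y)" "pderivative k f differentiable (at y)" if "y \<in> V" for y k
    using f that by (auto intro: smooth_on_differentiable smooth_on_pderivative)
  have 1: "pderivative k (\<lambda>y. f y \<bullet> b) y = pderivative k f y \<bullet> b" if "y \<in> V" for y k
    by (rule pderivative_linear[OF bounded_linear_inner_left D(1)[OF that]])
  have "pderivative k (pderivative l f) x \<bullet> b = pderivative k (pderivative l (\<lambda>y. f y \<bullet> b)) x" for k l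
    using pderivative_cong[OF V, of "pderivative l (\<lambda>y. f y \<bullet> b)" "\<lambda>y. pderivative l f y \<bullet> b" k, OF 1]
      pderivative_linear[OF bounded_linear_inner_left[of b] D(2)[OF V(2), of l], of k]
    by simp
  then show "pderivative j (pderivative i f) x \<bullet> b = pderivative i (pderivative j f) x \<bullet> b"
    using pderivative_commute_real[OF V, of "\<lambda>y. f y \<bullet> b"] smooth_on_linear[OF bounded_linear_inner_left V(1) f]
    by simp
qed

text \<open>A transition map between two parametrizations is a priori only continuous. A left
  inverse \<open>L\<close> of the derivative of \<open>\<phi>\<close> turns the expansion of
  \<open>\<phi> (\<tau> y) = \<psi> y\<close> into an expansion of \<open>\<tau> y\<close>, whose
  derivative is therefore \<open>L\<close> composed with the derivative of
  \<open>\<psi>\<close>.\<close>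

lemma differentiable_lift_through_immersion:
  fixes \<phi> :: "real^'n \<Rightarrow> 'b::euclidean_space" and \<tau> :: "'c::euclidean_space \<Rightarrow> real^'n"
  assumes d\<phi>: "\<phi> differentiable (at (\<tau> y0))" and inj: "inj (frechet_derivative \<phi> (at (\<tau> y0)))"
    and cont: "isCont \<tau> y0" and d\<psi>: "\<psi> differentiable (at y0)"
    and W: "open W" "y0 \<in> W" and eq: "\<And>y. y \<in> W \<Longrightarrow> \<phi> (\<tau> y) = \<psi> y"
  shows "\<tau> differentiable (at y0)"
proof -
  define D where "D = frechet_derivative \<phi> (at (\<tau> y0))"
  define E where "E = frechet_derivative \<psi> (at y0)"
  have D: "(\<phi> has_derivative D) (at (\<tau> y0))" and E: "(\<psi> has_derivative E) (at y0)"
    using d\<phi> d\<psi> by (simp_all add: D_def E_def frechet_derivative_works)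
  have "linear D" "inj D" using D inj by (auto simp: D_def has_derivative_linear)
  then obtain L where L: "linear L" "L \<circ> D = id"
    using linear_injective_left_inverse by blast
  have LD: "L (D v) = v" for v using L(2) by (metis comp_apply id_apply)
  obtain B where B: "B > 0" "\<And>w. norm (L w) \<le> B * norm w"
    using linear_bounded_pos[OF L(1)] by blast
  obtain C where C: "C > 0" "\<And>w. norm (E w) \<le> C * norm w"
    using linear_bounded_pos[OF has_derivative_linear[OF E]] by blast
  define K where "K = 2 * B * (C + 1)"
  have K: "K > 0" using B C by (simp add: K_def)
  obtain w where w: "w > 0" "ball y0 w \<subseteq> W" using W open_contains_ball by blast
  have Drem: "\<exists>d>0. \<forall>y. norm (y - y0) < d \<longrightarrow> norm (\<psi> y - \<psi> y0 - D (\<tau> y - \<tau> y0)) \<le> e * norm (\<tau> y - \<tau> y0)"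
    if "e > 0" for e
  proof -
    obtain d where d: "d > 0" "\<And>x. norm (x - \<tau> y0) < d \<Longrightarrow> norm (\<phi> x - \<phi> (\<tau> y0) - D (x - \<tau> y0)) \<le> e * norm (x - \<tau> y0)"
      using D \<open>e > 0\<close> unfolding has_derivative_at_alt by blast
    obtain d' where d': "d' > 0" "\<And>y. dist y y0 < d' \<Longrightarrow> dist (\<tau> y) (\<tau> y0) < d"
      using cont d(1) unfolding continuous_at_eps_delta by metis
    have "norm (\<psi> y - \<psi> y0 - D (\<tau> y - \<tau> y0)) \<le> e * norm (\<tau> y - \<tau> y0)" if y: "norm (y - y0) < min d' w" for y
    proof -
      have "y \<in> W" using y w(2) by (auto simp: dist_norm norm_minus_commute subset_iff)
      then show ?thesis using d(2)[of "\<tau> y"] d'(2)[of y] y eq[of y] eq[OF W(2)] by (simp add: dist_norm)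
    qed
    then show ?thesis using d'(1) w(1) by (intro exI[of _ "min d' w"]) auto
  qed
  have Erem: "\<exists>d>0. \<forall>y. norm (y - y0) < d \<longrightarrow> norm (\<psi> y - \<psi> y0 - E (y - y0)) \<le> e * norm (y - y0)" if "e > 0" for e
    using E that unfolding has_derivative_at_alt by blast
  \<comment> \<open>The remainder for \<open>\<phi>\<close> is measured by the unknown increment of
    \<open>\<tau>\<close>. With the factor \<open>1 / (2 * B)\<close> half of this increment can be
    absorbed on the left, which gives a Lipschitz bound at \<open>y0\<close> and explains the
    constant \<open>K\<close>.\<close>
  have bound: "\<exists>d>0. \<forall>y. norm (y - y0) < d \<longrightarrow> norm (\<tau> y - \<tau> y0) \<le> K * norm (y - y0)"
  proof -
    obtain d1 where d1: "d1 > 0" "\<And>y. norm (y - y0) < d1 \<Longrightarrow> norm (\<psi> y - \<psi> y0 - D (\<tau> y - \<tau> y0)) \<le> 1 / (2 * B) * norm (\<tau> y - \<tau> y0)"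
      using Drem[of "1 / (2 * B)"] B by auto
    obtain d2 where d2: "d2 > 0" "\<And>y. norm (y - y0) < d2 \<Longrightarrow> norm (\<psi> y - \<psi> y0 - E (y - y0)) \<le> 1 * norm (y - y0)"
      using Erem[of 1] by auto
    have "norm (\<tau> y - \<tau> y0) \<le> K * norm (y - y0)" if y: "norm (y - y0) < min d1 d2" for y
    proof -
      have "norm (\<psi> y - \<psi> y0) \<le> (C + 1) * norm (y - y0)"
        using d2(2)[of y] y C(2)[of "y - y0"] norm_triangle_sub[of "\<psi> y - \<psi> y0" "E (y - y0)"]
        by (simp add: algebra_simps)
      then have 1: "norm (L (\<psi> y - \<psi> y0)) \<le> B * ((C + 1) * norm (y - y0))"
        using B by (meson mult_left_mono less_imp_le order_trans)
      have "norm (L (\<psi> y - \<psi> y0 - D (\<tau> y - \<tau> y0))) \<le> B * (1 / (2 * B) * norm (\<tau> y - \<tau> y0))"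
        using d1(2)[of y] y B by (meson min_less_iff_conj mult_left_mono less_imp_le order_trans)
      then have 2: "norm (L (\<psi> y - \<psi> y0 - D (\<tau> y - \<tau> y0))) \<le> norm (\<tau> y - \<tau> y0) / 2"
        using B by simp
      have "\<tau> y - \<tau> y0 = L (\<psi> y - \<psi> y0) - L (\<psi> y - \<psi> y0 - D (\<tau> y - \<tau> y0))"
        by (simp add: linear_diff[OF L(1)] LD)
      then have "norm (\<tau> y - \<tau> y0) \<le> norm (L (\<psi> y - \<psi> y0)) + norm (L (\<psi> y - \<psi> y0 - D (\<tau> y - \<tau> y0)))"
        by (metis norm_triangle_ineq4)
      then show ?thesis using 1 2 by (simp add: K_def)
    qed
    then show ?thesis using d1(1) d2(1) by (intro exI[of _ "min d1 d2"]) auto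
  qed
  have "(\<tau> has_derivative (\<lambda>v. L (E v))) (at y0)"
    unfolding has_derivative_at_alt
  proof (intro conjI allI impI)
    show "bounded_linear (\<lambda>v. L (E v))"
      using L(1) has_derivative_bounded_linear[OF E] bounded_linear_compose linear_conv_bounded_linear by blast
    fix e :: real assume e: "e > 0"
    \<comment> \<open>The two remainders contribute \<open>\<eta> * K\<close> and
      \<open>\<eta>\<close>, and \<open>L\<close> enlarges their sum at most by the factor
      \<open>B\<close>.\<close>
    define \<eta> where "\<eta> = e / (B * (1 + K))"
    have \<eta>: "\<eta> > 0" using e B K by (simp add: \<eta>_def)
    obtain d1 where d1: "d1 > 0" "\<And>y. norm (y - y0) < d1 \<Longrightarrow> norm (\<psi> y - \<psi> y0 - D (\<tau> y - \<tau> y0)) \<le> \<eta> * norm (\<tau> y - \<tau> y0)"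
      using Drem[OF \<eta>] by auto
    obtain d2 where d2: "d2 > 0" "\<And>y. norm (y - y0) < d2 \<Longrightarrow> norm (\<psi> y - \<psi> y0 - E (y - y0)) \<le> \<eta> * norm (y - y0)"
      using Erem[OF \<eta>] by auto
    obtain d3 where d3: "d3 > 0" "\<And>y. norm (y - y0) < d3 \<Longrightarrow> norm (\<tau> y - \<tau> y0) \<le> K * norm (y - y0)"
      using bound by auto
    have "norm (\<tau> y - \<tau> y0 - L (E (y - y0))) \<le> e * norm (y - y0)" if y: "norm (y - y0) < min d1 (min d2 d3)" for y
    proof -
      have "norm (\<psi> y - \<psi> y0 - D (\<tau> y - \<tau> y0)) \<le> \<eta> * (K * norm (y - y0))"
        using d1(2)[of y] d3(2)[of y] y \<eta>
        by (meson min_less_iff_conj mult_left_mono less_imp_le order_trans)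
      moreover have "norm (\<psi> y - \<psi> y0 - E (y - y0)) \<le> \<eta> * norm (y - y0)"
        using d2(2)[of y] y by simp
      moreover have "norm ((\<psi> y - \<psi> y0 - E (y - y0)) - (\<psi> y - \<psi> y0 - D (\<tau> y - \<tau> y0)))
         \<le> norm (\<psi> y - \<psi> y0 - E (y - y0)) + norm (\<psi> y - \<psi> y0 - D (\<tau> y - \<tau> y0))"
        by (rule norm_triangle_ineq4)
      ultimately have "norm ((\<psi> y - \<psi> y0 - E (y - y0)) - (\<psi> y - \<psi> y0 - D (\<tau> y - \<tau> y0))) \<le> \<eta> * (1 + K) * norm (y - y0)"
        by (simp add: algebra_simps)
      then have "norm (L ((\<psi> y - \<psi> y0 - E (y - y0)) - (\<psi> y - \<psi> y0 - D (\<tau> y - \<tau> y0)))) \<le> B * (\<eta> * (1 + K) * norm (y - y0))"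
        using B by (meson mult_left_mono less_imp_le order_trans)
      moreover have "L ((\<psi> y - \<psi> y0 - E (y - y0)) - (\<psi> y - \<psi> y0 - D (\<tau> y - \<tau> y0))) = \<tau> y - \<tau> y0 - L (E (y - y0))"
        by (simp add: linear_diff[OF L(1)] LD)
      moreover have "B * (\<eta> * (1 + K) * norm (y - y0)) = e * norm (y - y0)"
      proof -
        have "B * (1 + K) \<noteq> 0" using B K by simp
        then have "B * (\<eta> * (1 + K)) = e" by (simp add: \<eta>_def)
        then show ?thesis by (metis mult.assoc)
      qed
      ultimately show ?thesis by simp
    qed
    then show "\<exists>d>0. \<forall>y. norm (y - y0) < d \<longrightarrow> norm (\<tau> y - \<tau> y0 - L (E (y - y0))) \<le> e * norm (y - y0)"
      using d1(1) d2(1) d3(1) by (intro exI[of _ "min d1 (min d2 d3)"]) auto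
  qed
  then show ?thesis by (rule differentiableI)
qed

section \<open>Integration\<close>

text \<open>Difference quotients integrate to zero by translation invariance. They converge to the
  partial derivative and, by the mean value theorem, are dominated by a constant on a fixed
  ball.\<close>

lemma integral_pderivative_eq_0:
  fixes f :: "real^'n \<Rightarrow> real"
  assumes diff: "\<And>x. f differentiable (at x)" and cont: "continuous_on UNIV (pderivative i f)"
    and supp: "\<And>x. norm x > R \<Longrightarrow> f x = 0"
  shows "(\<integral>x. pderivative i f x \<partial>lborel) = 0"
proof -
  let ?e = "axis i 1 :: real^'n"
  define s where "s k x = real (Suc k) * (f (x + (1 / real (Suc k)) *\<^sub>R ?e) - f x)" for k x
  have contf: "continuous_on UNIV f"
    using diff by (auto intro!: continuous_at_imp_continuous_on differentiable_imp_continuous_within)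
  have fm[measurable]: "f \<in> borel_measurable borel"
    by (rule borel_measurable_continuous_onI[OF contf])
  have pm[measurable]: "pderivative i f \<in> borel_measurable borel"
    by (rule borel_measurable_continuous_onI[OF cont])
  have "(\<lambda>x. indicator (cball 0 R) x *\<^sub>R f x) = f"
    using supp by (auto simp: fun_eq_iff indicator_def)
  then have intf: "integrable lborel f"
    using borel_integrable_compact[OF compact_cball[of "0::real^'n" R] continuous_on_subset[OF contf subset_UNIV]]
    by simp
  have shift: "integrable lborel (\<lambda>x. f (x + c))" "(\<integral>x. f (x + c) \<partial>lborel) = (\<integral>x. f x \<partial>lborel)" for c
  proof -
    have 1: "integrable (distr lborel borel ((+) c)) f" using intf by (simp add: lborel_distr_plus)
    then show "integrable lborel (\<lambda>x. f (x + c))"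
      by (subst (asm) integrable_distr_eq) (simp_all add: add.commute)
    have "(\<integral>x. f x \<partial>distr lborel borel ((+) c)) = (\<integral>x. f (c + x) \<partial>lborel)"
      by (rule integral_distr) simp_all
    then show "(\<integral>x. f (x + c) \<partial>lborel) = (\<integral>x. f x \<partial>lborel)"
      by (simp add: lborel_distr_plus add.commute)
  qed
  have "(\<integral>x. s k x \<partial>lborel) = 0" for k
    unfolding s_def using shift intf by simp
  moreover have "(\<lambda>k. \<integral>x. s k x \<partial>lborel) \<longlonglongrightarrow> (\<integral>x. pderivative i f x \<partial>lborel)"
  proof -
    \<comment> \<open>The difference quotients are supported in the ball of radius
      \<open>R + 1\<close>, and a step of length at most 1 from there stays in the ball of radius
      \<open>R + 2\<close>.\<close>
    have "compact (pderivative i f ` cball 0 (R + 2))"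
      by (intro compact_continuous_image continuous_on_subset[OF cont]) auto
    then obtain C where C: "\<And>x. norm x \<le> R + 2 \<Longrightarrow> norm (pderivative i f x) \<le> C"
      by (meson bounded_iff compact_imp_bounded image_eqI mem_cball_0)
    show ?thesis
    proof (rule integral_dominated_convergence[where w="\<lambda>x. \<bar>C\<bar> * indicator (cball 0 (R + 1)) x"])
      show "pderivative i f \<in> borel_measurable lborel" by simp
      show "s k \<in> borel_measurable lborel" for k unfolding s_def by measurable
      show "integrable lborel (\<lambda>x. \<bar>C\<bar> * indicator (cball 0 (R + 1)) x :: real)"
        by (intro integrable_mult_right) (simp add: emeasure_bounded_finite[OF bounded_cball, unfolded infinity_ennreal_def] integrable_indicator_iff)
      have "(\<lambda>k. s k x) \<longlonglongrightarrow> pderivative i f x" for x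
      proof -
        have "((\<lambda>t. f (x + t *\<^sub>R ?e)) has_real_derivative pderivative i f x) (at 0)"
          using DERIV_along_line[of f x 0 ?e] diff
          by (simp add: has_real_derivative_iff_has_vector_derivative pderivative_def)
        then have "((\<lambda>h. (f (x + h *\<^sub>R ?e) - f x) / h) \<longlongrightarrow> pderivative i f x) (at 0)"
          by (simp add: DERIV_def)
        moreover have "filterlim (\<lambda>k. 1 / real (Suc k)) (at 0) sequentially"
          using LIMSEQ_inverse_real_of_nat by (auto simp: filterlim_at inverse_eq_divide)
        ultimately have "(\<lambda>k. (f (x + (1 / real (Suc k)) *\<^sub>R ?e) - f x) / (1 / real (Suc k))) \<longlonglongrightarrow> pderivative i f x"
          by (rule filterlim_compose)
        then show ?thesis by (simp add: s_def mult.commute)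
      qed
      then show "AE x in lborel. (\<lambda>k. s k x) \<longlonglongrightarrow> pderivative i f x" by simp
      have "norm (s k x) \<le> \<bar>C\<bar> * indicator (cball 0 (R + 1)) x" for k x
      proof -
        let ?h = "1 / real (Suc k)"
        have h: "0 < ?h" "?h \<le> 1" by simp_all
        have nrm: "norm (x + t *\<^sub>R ?e) \<le> norm x + 1" "norm x \<le> norm (x + t *\<^sub>R ?e) + 1" if "0 \<le> t" "t \<le> ?h" for t
        proof -
          have "norm (t *\<^sub>R ?e) \<le> 1" using that(1) order_trans[OF that(2) h(2)] by (simp add: norm_axis_1)
          then show "norm (x + t *\<^sub>R ?e) \<le> norm x + 1" "norm x \<le> norm (x + t *\<^sub>R ?e) + 1"
            using norm_triangle_ineq[of x "t *\<^sub>R ?e"] norm_triangle_ineq4[of "x + t *\<^sub>R ?e" "t *\<^sub>R ?e"] by auto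
        qed
        show ?thesis
        proof (cases "norm x \<le> R + 1")
          case False
          then have "f x = 0" "f (x + ?h *\<^sub>R ?e) = 0"
            using nrm(2)[of ?h] h by (auto intro!: supp)
          then show ?thesis by (simp add: s_def)
        next
          case True
          have d: "((\<lambda>t. f (x + t *\<^sub>R ?e)) has_real_derivative pderivative i f (x + t *\<^sub>R ?e)) (at t)"
            if "0 \<le> t" "t \<le> ?h" for t
            using DERIV_along_line[of f x t ?e] diff
            by (simp add: has_real_derivative_iff_has_vector_derivative pderivative_def)
          obtain t where t: "0 < t" "t < ?h" "f (x + ?h *\<^sub>R ?e) - f (x + 0 *\<^sub>R ?e) = (?h - 0) * pderivative i f (x + t *\<^sub>R ?e)"
            using MVT2[OF h(1) d] by metis
          have "s k x = pderivative i f (x + t *\<^sub>R ?e)"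
            using t(3) by (simp add: s_def)
          moreover have "norm (pderivative i f (x + t *\<^sub>R ?e)) \<le> C"
            using C nrm(1)[of t] t True by simp
          ultimately show ?thesis using True by simp
        qed
      qed
      then show "AE x in lborel. norm (s k x) \<le> \<bar>C\<bar> * indicator (cball 0 (R + 1)) x" for k by simp
    qed
  qed
  ultimately show ?thesis by (simp add: LIMSEQ_const_iff)
qed

lemma integrable_compact_support:
  fixes f :: "'a::euclidean_space \<Rightarrow> real"
  assumes V: "open V" and K: "compact K" "K \<subseteq> V" and f: "continuous_on V f"
    and supp: "\<And>x. x \<in> V - K \<Longrightarrow> f x = 0"
  shows "integrable lborel (\<lambda>x. indicator V x * f x)"
proof -
  have "(\<lambda>x. indicator V x * f x) = (\<lambda>x. indicator K x *\<^sub>R f x)"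
    using supp K by (auto simp: fun_eq_iff indicator_def)
  then show ?thesis
    using borel_integrable_compact[OF K(1) continuous_on_subset[OF f K(2)]] by simp
qed

text \<open>The extension of \<open>f\<close> by zero is differentiable everywhere, because the open
  sets \<open>V\<close> and \<open>- K\<close> cover the space and the extension vanishes on the
  second.\<close>

lemma integral_pderivative_compact_support:
  fixes f :: "real^'n \<Rightarrow> real"
  assumes V: "open V" and K: "compact K" "K \<subseteq> V" and f: "smooth_on V f"
    and supp: "\<And>x. x \<in> V - K \<Longrightarrow> f x = 0"
  shows "(\<integral>x. indicator V x * pderivative i f x \<partial>lborel) = 0"
proof -
  define g where "g x = (if x \<in> V then f x else 0)" for x
  have oK: "open (- K)" using K(1) by (simp add: compact_imp_closed open_Compl)
  have g0: "g x = 0" if "x \<in> - K" for x using that supp by (auto simp: g_def)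
  have dg: "g differentiable (at x)" "pderivative i g x = (if x \<in> V then pderivative i f x else 0)" for x
  proof -
    have "g differentiable (at x) \<and> pderivative i g x = (if x \<in> V then pderivative i f x else 0)"
    proof (cases "x \<in> V")
      case True
      have "(f has_derivative frechet_derivative f (at x)) (at x)"
        using smooth_on_differentiable[OF f True] by (simp add: frechet_derivative_works)
      then have "(g has_derivative frechet_derivative f (at x)) (at x)"
        by (rule has_derivative_transform_within_open[OF _ V True]) (simp add: g_def)
      then have "g differentiable (at x)" by (rule differentiableI)
      moreover have "pderivative i g x = pderivative i f x"
        by (rule pderivative_cong[OF V True]) (simp add: g_def)
      ultimately show ?thesis using True by simp
    next
      case False
      then have x: "x \<in> - K" using K by auto
      have "((\<lambda>x. 0) has_derivative (\<lambda>v. 0)) (at x)" by simp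
      then have "(g has_derivative (\<lambda>v. 0)) (at x)"
        by (rule has_derivative_transform_within_open[OF _ oK x]) (simp add: g0)
      then have "g differentiable (at x)" by (rule differentiableI)
      moreover have "pderivative i g x = pderivative i (\<lambda>x. 0) x"
        by (rule pderivative_cong[OF oK x]) (simp add: g0)
      ultimately show ?thesis using False by (simp add: pderivative_const)
    qed
    then show "g differentiable (at x)" "pderivative i g x = (if x \<in> V then pderivative i f x else 0)"
      by blast+
  qed
  have "continuous_on V (pderivative i g)"
    using smooth_on_continuous[OF smooth_on_pderivative[OF f, of i]] by (subst continuous_on_cong[OF refl dg(2)]) simp_all
  moreover have "continuous_on (- K) (pderivative i g)"
  proof -
    have "pderivative i g x = 0" if "x \<in> - K" for x
      using pderivative_cong[OF oK that, of g "\<lambda>x. 0" i] g0 by (simp add: pderivative_const)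
    then show ?thesis by (subst continuous_on_cong[OF refl]) auto
  qed
  moreover have "V \<union> - K = UNIV" using K by auto
  ultimately have cont: "continuous_on UNIV (pderivative i g)"
    using continuous_on_open_Un[OF V oK] by metis
  obtain R where R: "\<And>x. x \<in> K \<Longrightarrow> norm x \<le> R"
    using compact_imp_bounded[OF K(1)] bounded_iff by blast
  have "(\<integral>x. pderivative i g x \<partial>lborel) = 0"
    by (rule integral_pderivative_eq_0[OF dg(1) cont, of R]) (use R g0 in force)
  moreover have "pderivative i g = (\<lambda>x. indicator V x * pderivative i f x)"
    using dg(2) by (auto simp: fun_eq_iff indicator_def)
  ultimately show ?thesis by simp
qed

text \<open>\<open>riemannian_volume\<close> prescribes only the measures of images of Borel sets.
  This identifies \<open>dV\<close> on the chart with the image under \<open>\<psi>\<close> of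
  Lebesgue measure with density \<open>sqrt (det (induced_metric \<psi> x))\<close>, after which the
  change of variables is formal.\<close>

lemma integral_riemannian_volume:
  fixes \<psi> :: "real^'n \<Rightarrow> real^('n::finite option)" and F :: "real^('n option) \<Rightarrow> real"
  assumes vol: "riemannian_volume M dV" and lp: "local_parametrization M V \<psi>"
    and q: "continuous_on V (\<lambda>x. sqrt (det (induced_metric \<psi> x)))"
    and qpos: "\<And>x. x \<in> V \<Longrightarrow> det (induced_metric \<psi> x) \<ge> 0"
    and F: "continuous_on V (\<lambda>x. F (\<psi> x))"
  shows "(\<integral>P. indicator (\<psi> ` V) P * F P \<partial>dV) =
    (\<integral>x. indicator V x * (sqrt (det (induced_metric \<psi> x)) * F (\<psi> x)) \<partial>lborel)"
proof -
  define q where "q x = sqrt (det (induced_metric \<psi> x))" for x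
  have V: "open V" using lp by (simp add: local_parametrization_def)
  obtain \<psi>' where hom: "homeomorphism V (\<psi> ` V) \<psi> \<psi>'"
    using lp unfolding local_parametrization_def by blast
  have cont\<psi>: "continuous_on V \<psi>" and cont\<psi>': "continuous_on (\<psi> ` V) \<psi>'"
    using hom by (simp_all add: homeomorphism_def)
  have sdV: "sets dV = sets (restrict_space borel M)" using vol by (simp add: riemannian_volume_def)
  have spdV: "space dV = M" using sets_eq_imp_space_eq[OF sdV] by (simp add: space_restrict_space)
  have "openin (top_of_set M) (\<psi> ` V)" using lp by (simp add: local_parametrization_def)
  then obtain T where O: "open T" "\<psi> ` V = M \<inter> T"
    unfolding openin_open by blast
  have im: "\<psi> ` V \<in> sets dV" "\<psi> ` V \<inter> space dV \<in> sets dV"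
    unfolding sdV spdV O sets_restrict_space using O(1) by auto
  define N where "N = restrict_space dV (\<psi> ` V)"
  have setsN: "sets N = sets (restrict_space borel (\<psi> ` V))"
  proof -
    have "sets N = sets (restrict_space (restrict_space borel M) (\<psi> ` V))"
      unfolding N_def by (rule sets_restrict_space_cong[OF sdV])
    also have "\<dots> = sets (restrict_space borel (\<psi> ` V))"
      using O(2) by (simp add: sets_restrict_restrict_space Int_absorb1)
    finally show ?thesis .
  qed
  have spN: "space N = \<psi> ` V" using sets_eq_imp_space_eq[OF setsN] by (simp add: space_restrict_space)
  define L where "L = restrict_space lborel V"
  have spL: "space L = V" by (simp add: L_def space_restrict_space)
  have Lm: "f \<in> borel_measurable L" if "continuous_on V f" for f :: "_ \<Rightarrow> real"
  proof -
    have "f \<in> borel_measurable (restrict_space borel V)"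
      using that by (rule borel_measurable_continuous_on_restrict)
    moreover have "sets L = sets (restrict_space borel V)"
      unfolding L_def by (rule sets_restrict_space_cong) simp
    ultimately show ?thesis using measurable_cong_sets[OF _ refl, of L] by blast
  qed
  have \<psi>m: "\<psi> \<in> measurable L N"
  proof -
    have "\<psi> \<in> borel_measurable (restrict_space borel V)"
      using cont\<psi> by (rule borel_measurable_continuous_on_restrict)
    then have "\<psi> \<in> measurable (restrict_space borel V) (restrict_space borel (\<psi> ` V))"
      by (intro measurable_restrict_space2) (auto simp: space_restrict_space)
    moreover have "sets L = sets (restrict_space borel V)"
      unfolding L_def by (rule sets_restrict_space_cong) simp
    ultimately show ?thesis using measurable_cong_sets[OF _ setsN, of L] by blast
  qed
  define \<mu> where "\<mu> = density L (\<lambda>x. ennreal (q x))"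
  have qm: "q \<in> borel_measurable L" using q by (intro Lm) (simp add: q_def[abs_def])
  have \<psi>m': "\<psi> \<in> measurable \<mu> N" using \<psi>m by (simp add: \<mu>_def)
  have N: "N = distr \<mu> N \<psi>"
  proof (rule measure_eqI)
    fix B assume B: "B \<in> sets N"
    define A where "A = \<psi> -` B \<inter> V"
    have Bsub: "B \<subseteq> \<psi> ` V" using sets.sets_into_space[OF B] spN by simp
    have "A \<in> sets L" using measurable_sets[OF \<psi>m B] by (simp add: A_def spL)
    then have Ab: "A \<in> sets borel" "A \<subseteq> V"
      using V by (auto simp: A_def L_def sets_restrict_space)
    have BA: "\<psi> ` A = B" using Bsub by (auto simp: A_def)
    have "emeasure N B = emeasure dV B"
      unfolding N_def by (rule emeasure_restrict_space[OF im(2) Bsub])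
    also have "\<dots> = (\<integral>\<^sup>+x\<in>A. ennreal (q x) \<partial>lborel)"
      using vol lp Ab BA unfolding riemannian_volume_def q_def by blast
    also have "\<dots> = (\<integral>\<^sup>+x. (ennreal (q x) * indicator A x) * indicator V x \<partial>lborel)"
      using Ab(2) by (intro nn_integral_cong) (auto simp: indicator_def)
    also have "\<dots> = (\<integral>\<^sup>+x. ennreal (q x) * indicator A x \<partial>L)"
      unfolding L_def using V by (subst nn_integral_restrict_space) auto
    also have "\<dots> = emeasure \<mu> A"
      unfolding \<mu>_def using \<open>A \<in> sets L\<close> qm by (subst emeasure_density) auto
    also have "\<dots> = emeasure (distr \<mu> N \<psi>) B"
      using B \<psi>m' by (subst emeasure_distr) (simp_all add: A_def spL \<mu>_def)
    finally show "emeasure N B = emeasure (distr \<mu> N \<psi>) B" .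
  qed simp
  have "continuous_on (\<psi> ` V) (\<lambda>P. F (\<psi> (\<psi>' P)))"
    by (rule continuous_on_compose2[OF F cont\<psi>']) (use hom in \<open>simp add: homeomorphism_def\<close>)
  then have "continuous_on (\<psi> ` V) F"
    by (rule continuous_on_eq) (use homeomorphism_apply2[OF hom] in simp)
  then have Fm: "F \<in> borel_measurable N"
    unfolding measurable_cong_sets[OF setsN refl] by (rule borel_measurable_continuous_on_restrict)
  have "(\<integral>P. indicator (\<psi> ` V) P * F P \<partial>dV) = (\<integral>P. F P \<partial>N)"
    unfolding N_def by (subst integral_restrict_space[OF im(2)]) simp
  also have "\<dots> = (\<integral>x. F (\<psi> x) \<partial>\<mu>)"
    by (subst N, rule integral_distr[OF \<psi>m' Fm])
  also have "\<dots> = (\<integral>x. q x *\<^sub>R F (\<psi> x) \<partial>L)"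
    unfolding \<mu>_def
  proof (rule integral_density[OF Lm[OF F] qm])
    show "AE x in L. 0 \<le> q x" using qpos by (intro AE_I2) (simp add: spL q_def)
  qed
  also have "\<dots> = (\<integral>x. indicator V x * (q x * F (\<psi> x)) \<partial>lborel)"
    unfolding L_def using V by (subst integral_restrict_space) auto
  finally show ?thesis by (simp add: q_def)
qed

section \<open>Determinants and inverses of matrix-valued maps\<close>

lemma pderivative_prod:
  fixes f :: "'i \<Rightarrow> real^'n \<Rightarrow> real"
  assumes "finite I" "\<And>k. k \<in> I \<Longrightarrow> f k differentiable (at x)"
  shows "(\<lambda>y. \<Prod>k\<in>I. f k y) differentiable (at x)"
    "pderivative i (\<lambda>y. \<Prod>k\<in>I. f k y) x = (\<Sum>k\<in>I. pderivative i (f k) x * (\<Prod>l\<in>I - {k}. f l x))"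
proof -
  have "((\<lambda>y. \<Prod>k\<in>I. f k y) has_derivative
    (\<lambda>v. \<Sum>k\<in>I. frechet_derivative (f k) (at x) v * (\<Prod>l\<in>I - {k}. f l x))) (at x)"
    using assms(2) by (intro has_derivative_prod) (simp add: frechet_derivative_works)
  then show "(\<lambda>y. \<Prod>k\<in>I. f k y) differentiable (at x)"
    "pderivative i (\<lambda>y. \<Prod>k\<in>I. f k y) x = (\<Sum>k\<in>I. pderivative i (f k) x * (\<Prod>l\<in>I - {k}. f l x))"
    by (auto intro: differentiableI simp: pderivative_eqI) (simp add: pderivative_def)
qed

text \<open>Differentiating each product in the Leibniz sum factor by factor replaces one row at a
  time.\<close>

lemma pderivative_det_rows:
  fixes A :: "real^'n \<Rightarrow> real^'m^'m"
  assumes d: "\<And>k l. (\<lambda>y. A y $ k $ l) differentiable (at x)"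
  shows "pderivative i (\<lambda>y. det (A y)) x =
    (\<Sum>k\<in>UNIV. det (\<chi> a. if a = k then (\<chi> b. pderivative i (\<lambda>y. A y $ a $ b) x) else A x $ a))"
proof -
  let ?P = "{p. p permutes (UNIV::'m set)}"
  let ?dA = "\<lambda>a b. pderivative i (\<lambda>y. A y $ a $ b) x"
  have d1: "(\<lambda>y. of_int (sign p) * (\<Prod>k\<in>UNIV. A y $ k $ p k)) differentiable (at x)" for p
    by (intro differentiable_mult pderivative_prod d) simp_all
  have "pderivative i (\<lambda>y. det (A y)) x =
    (\<Sum>p\<in>?P. pderivative i (\<lambda>y. of_int (sign p) * (\<Prod>k\<in>UNIV. A y $ k $ p k)) x)"
    unfolding det_def by (rule pderivative_sum) (rule d1)
  also have "\<dots> = (\<Sum>p\<in>?P. \<Sum>k\<in>UNIV. of_int (sign p) * (?dA k (p k) * (\<Prod>l\<in>UNIV - {k}. A x $ l $ p l)))"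
  proof (rule sum.cong[OF refl])
    fix p assume "p \<in> ?P"
    have "pderivative i (\<lambda>y. of_int (sign p) * (\<Prod>k\<in>UNIV. A y $ k $ p k)) x
      = of_int (sign p) * pderivative i (\<lambda>y. \<Prod>k\<in>UNIV. A y $ k $ p k) x"
      by (rule pderivative_linear[OF bounded_linear_mult_right]) (intro pderivative_prod d finite)
    also have "\<dots> = of_int (sign p) * (\<Sum>k\<in>UNIV. ?dA k (p k) * (\<Prod>l\<in>UNIV - {k}. A x $ l $ p l))"
      by (subst pderivative_prod(2)) (auto intro: d)
    finally show "pderivative i (\<lambda>y. of_int (sign p) * (\<Prod>k\<in>UNIV. A y $ k $ p k)) x =
        (\<Sum>k\<in>UNIV. of_int (sign p) * (?dA k (p k) * (\<Prod>l\<in>UNIV - {k}. A x $ l $ p l)))"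
      by (simp add: sum_distrib_left)
  qed
  also have "\<dots> = (\<Sum>k\<in>UNIV. \<Sum>p\<in>?P. of_int (sign p) * (?dA k (p k) * (\<Prod>l\<in>UNIV - {k}. A x $ l $ p l)))"
    by (rule sum.swap)
  also have "\<dots> = (\<Sum>k\<in>UNIV. det (\<chi> a. if a = k then (\<chi> b. ?dA a b) else A x $ a))"
  proof (rule sum.cong[OF refl])
    fix k :: 'm
    have "(\<Prod>l\<in>UNIV. (\<chi> a. if a = k then (\<chi> b. ?dA a b) else A x $ a) $ l $ p l)
      = ?dA k (p k) * (\<Prod>l\<in>UNIV - {k}. A x $ l $ p l)" for p
    proof -
      have "(\<Prod>l\<in>UNIV. (\<chi> a. if a = k then (\<chi> b. ?dA a b) else A x $ a) $ l $ p l)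
        = (\<chi> a. if a = k then (\<chi> b. ?dA a b) else A x $ a) $ k $ p k *
          (\<Prod>l\<in>UNIV - {k}. (\<chi> a. if a = k then (\<chi> b. ?dA a b) else A x $ a) $ l $ p l)"
        by (rule prod.remove) auto
      also have "(\<Prod>l\<in>UNIV - {k}. (\<chi> a. if a = k then (\<chi> b. ?dA a b) else A x $ a) $ l $ p l)
        = (\<Prod>l\<in>UNIV - {k}. A x $ l $ p l)"
        by (rule prod.cong) auto
      finally show ?thesis by simp
    qed
    then show "(\<Sum>p\<in>?P. of_int (sign p) * (?dA k (p k) * (\<Prod>l\<in>UNIV - {k}. A x $ l $ p l))) =
      det (\<chi> a. if a = k then (\<chi> b. ?dA a b) else A x $ a)"
      unfolding det_def by (intro sum.cong) simp_all
  qed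
  finally show ?thesis .
qed

lemma matrix_inv_mult:
  fixes A :: "real^'m^'m"
  assumes "det A \<noteq> 0"
  shows "(\<Sum>k\<in>UNIV. matrix_inv A $ i $ k * A $ k $ j) = (if i = j then 1 else 0)"
    "(\<Sum>k\<in>UNIV. A $ i $ k * matrix_inv A $ k $ j) = (if i = j then 1 else 0)"
proof -
  have inv: "invertible A" using assms by (simp add: invertible_det_nz)
  have "(matrix_inv A ** A) $ i $ j = mat 1 $ i $ j" "(A ** matrix_inv A) $ i $ j = mat 1 $ i $ j"
    using someI_ex[of "\<lambda>B. A ** B = mat 1 \<and> B ** A = mat 1"] inv
    by (simp_all add: matrix_inv_def invertible_def)
  then show "(\<Sum>k\<in>UNIV. matrix_inv A $ i $ k * A $ k $ j) = (if i = j then 1 else 0)"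
    "(\<Sum>k\<in>UNIV. A $ i $ k * matrix_inv A $ k $ j) = (if i = j then 1 else 0)"
    by (simp_all add: matrix_matrix_mult_def mat_def)
qed

text \<open>The rows of the derivative are combinations of the rows of \<open>A\<close>, which makes Cramer's rule
  applicable.\<close>

lemma pderivative_det:
  fixes A :: "real^'n \<Rightarrow> real^'m^'m"
  assumes d: "\<And>k l. (\<lambda>y. A y $ k $ l) differentiable (at x)" and nz: "det (A x) \<noteq> 0"
  shows "pderivative i (\<lambda>y. det (A y)) x =
    det (A x) * (\<Sum>k\<in>UNIV. \<Sum>l\<in>UNIV. matrix_inv (A x) $ l $ k * pderivative i (\<lambda>y. A y $ k $ l) x)"
proof -
  let ?dA = "\<lambda>a b. pderivative i (\<lambda>y. A y $ a $ b) x"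
  define X :: "'m \<Rightarrow> real^'m" where "X k = (\<chi> b. \<Sum>l\<in>UNIV. ?dA k l * matrix_inv (A x) $ l $ b)" for k
  have X: "(\<Sum>b\<in>UNIV. X k $ b *s row b (A x)) = (\<chi> b. ?dA k b)" for k
  proof (rule vec_eq_iff[THEN iffD2], rule allI)
    fix c
    have "(\<Sum>b\<in>UNIV. X k $ b *s row b (A x)) $ c
      = (\<Sum>b\<in>UNIV. \<Sum>l\<in>UNIV. ?dA k l * (matrix_inv (A x) $ l $ b * A x $ b $ c))"
      by (simp add: X_def row_def sum_distrib_right mult.assoc)
    also have "\<dots> = (\<Sum>l\<in>UNIV. ?dA k l * (\<Sum>b\<in>UNIV. matrix_inv (A x) $ l $ b * A x $ b $ c))"
      by (subst sum.swap) (simp add: sum_distrib_left)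
    also have "\<dots> = ?dA k c" by (simp add: matrix_inv_mult[OF nz] if_distrib[of "\<lambda>t. _ * t"] cong: if_cong)
    finally show "(\<Sum>b\<in>UNIV. X k $ b *s row b (A x)) $ c = (\<chi> b. ?dA k b) $ c" by simp
  qed
  have "det (\<chi> a. if a = k then (\<chi> b. ?dA a b) else A x $ a) = X k $ k * det (A x)" for k
  proof -
    have "(\<chi> a. if a = k then (\<chi> b. ?dA a b) else A x $ a) =
      (\<chi> a. if a = k then (\<Sum>b\<in>UNIV. X k $ b *s row b (A x)) else row a (A x))"
      unfolding X by (simp add: vec_eq_iff row_def)
    then show ?thesis by (simp add: cramer_lemma_transpose)
  qed
  then show ?thesis
    unfolding pderivative_det_rows[OF d]
    by (simp add: X_def sum_distrib_left sum_distrib_right mult_ac)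
qed

text \<open>By Cramer's rule the entries of the inverse are quotients of determinants. The
  determinant is assumed positive because \<open>smooth_on_divide\<close> asks for a positive
  denominator.\<close>

lemma smooth_on_matrix_inv:
  fixes A :: "'a::real_normed_vector \<Rightarrow> real^'m^'m"
  assumes "open S" "\<And>i j. smooth_on S (\<lambda>x. A x $ i $ j)" "\<And>x. x \<in> S \<Longrightarrow> det (A x) > 0"
  shows "smooth_on S (\<lambda>x. matrix_inv (A x) $ k $ l)"
proof (subst smooth_on_cong[OF assms(1)])
  fix x assume "x \<in> S"
  then have nz: "det (A x) \<noteq> 0" using assms(3) by fastforce
  have "A x *v column l (matrix_inv (A x)) = axis l 1"
    by (simp add: vec_eq_iff matrix_vector_mult_def column_def matrix_inv_mult[OF nz] axis_def)
  then have "column l (matrix_inv (A x)) = (\<chi> k. det (\<chi> i j. if j = k then axis l 1 $ i else A x $ i $ j) / det (A x))"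
    using cramer[OF nz] by blast
  then have "column l (matrix_inv (A x)) $ k = (\<chi> k. det (\<chi> i j. if j = k then axis l 1 $ i else A x $ i $ j) / det (A x)) $ k"
    by simp
  then show "matrix_inv (A x) $ k $ l = det (\<chi> i j. if j = k then axis l 1 $ i else A x $ i $ j) / det (A x)"
    by (simp add: column_def)
next
  have "smooth_on S (\<lambda>x. (\<chi> i j. if j = k then axis l 1 $ i else A x $ i $ j) $ i $ j)" for i j
    by (cases "j = k") (simp_all add: assms(2) smooth_on_const)
  then show "smooth_on S (\<lambda>x. det (\<chi> i j. if j = k then axis l 1 $ i else A x $ i $ j) / det (A x))"
    by (intro smooth_on_divide smooth_on_det assms)
qed

text \<open>On the segment from the identity to \<open>A\<close> all matrices are positive definite,
  hence invertible, so the determinant keeps the sign that it has at the identity.\<close>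

lemma det_pos_of_positive_definite:
  fixes A :: "real^'m^'m"
  assumes "\<And>v. v \<noteq> 0 \<Longrightarrow> v \<bullet> (A *v v) > 0"
  shows "det A > 0"
proof (rule ccontr)
  assume neg: "\<not> ?thesis"
  define B where "B t = (1 - t) *\<^sub>R mat 1 + t *\<^sub>R A" for t :: real
  have "continuous_on {0..1} (\<lambda>t. det (B t))"
    unfolding B_def det_def by (intro continuous_intros)
  moreover have "det (B 0) = 1" "det (B 1) = det A" by (simp_all add: B_def)
  ultimately obtain t where t: "0 \<le> t" "t \<le> 1" "det (B t) = 0"
    using IVT2'[of "\<lambda>t. det (B t)" 1 0 0] neg by force
  then have "\<not> inj ((*v) (B t))"
    using invertible_det_nz invertible_left_inverse matrix_left_invertible_injective by metis
  then obtain v where v: "v \<noteq> 0" "B t *v v = 0"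
    by (auto simp: linear_injective_0[OF matrix_vector_mul_linear])
  have "v \<bullet> (B t *v v) = (1 - t) * (v \<bullet> v) + t * (v \<bullet> (A *v v))"
    by (simp add: B_def matrix_vector_mult_add_rdistrib scaleR_matrix_vector_assoc[symmetric] inner_add_right)
  moreover have "v \<bullet> v > 0" "v \<bullet> (A *v v) > 0" using v assms by auto
  then have "(1 - t) * (v \<bullet> v) + t * (v \<bullet> (A *v v)) > 0"
    using t(1,2) by (cases "t = 0") (auto intro!: add_nonneg_pos)
  ultimately show False using v(2) by simp
qed

section \<open>Immersed hypersurfaces in coordinates\<close>

lemma sum_delta_scaleR:
  fixes f :: "'i::finite \<Rightarrow> 'b::real_vector"
  shows "(\<Sum>k\<in>UNIV. (if k = l then 1 else 0) *\<^sub>R f k) = f l"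
    "(\<Sum>k\<in>UNIV. (if l = k then 1 else 0) *\<^sub>R f k) = f l"
  by (simp_all add: if_distrib[of "\<lambda>t. t *\<^sub>R _"] cong: if_cong)

lemma sum_delta_mult:
  fixes f :: "'i::finite \<Rightarrow> real"
  shows "(\<Sum>k\<in>UNIV. (if k = l then 1 else 0) * f k) = f l" "(\<Sum>k\<in>UNIV. (if l = k then 1 else 0) * f k) = f l"
    "(\<Sum>k\<in>UNIV. f k * (if k = l then 1 else 0)) = f l" "(\<Sum>k\<in>UNIV. f k * (if l = k then 1 else 0)) = f l"
  by (simp_all add: if_distrib[of "\<lambda>t. t * _"] if_distrib[of "\<lambda>t. _ * t"] cong: if_cong)

locale immersion =
  fixes V :: "(real^'n::finite) set" and \<psi> :: "real^'n \<Rightarrow> real^('n option)"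
  assumes open_V: "open V" and smooth: "smooth_on V \<psi>"
    and inj: "\<And>x. x \<in> V \<Longrightarrow> inj (frechet_derivative \<psi> (at x))"
begin

definition tangent :: "'n \<Rightarrow> real^'n \<Rightarrow> real^('n option)" where
  "tangent i = pderivative i \<psi>"

definition second :: "'n \<Rightarrow> 'n \<Rightarrow> real^'n \<Rightarrow> real^('n option)" where
  "second i j = pderivative j (tangent i)"

definition ginv :: "real^'n \<Rightarrow> real^'n^'n" where
  "ginv x = matrix_inv (induced_metric \<psi> x)"

definition dual :: "'n \<Rightarrow> real^'n \<Rightarrow> real^('n option)" where
  "dual k x = (\<Sum>l\<in>UNIV. ginv x $ k $ l *\<^sub>R tangent l x)"

text \<open>The Christoffel symbols (\<open>christoffel_eq\<close>), obtained as tangential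
  components of second derivatives: the Levi-Civita connection of an induced metric is the
  tangential part of the ambient derivative.\<close>

definition chr :: "'n \<Rightarrow> 'n \<Rightarrow> 'n \<Rightarrow> real^'n \<Rightarrow> real" where
  "chr k i j x = dual k x \<bullet> second i j x"

text \<open>The second fundamental form, as the vector-valued normal part of the second derivatives.\<close>

definition sff :: "'n \<Rightarrow> 'n \<Rightarrow> real^'n \<Rightarrow> real^('n option)" where
  "sff i j x = second i j x - (\<Sum>k\<in>UNIV. chr k i j x *\<^sub>R tangent k x)"

lemma smooth_tangent [smooth_intros]: "smooth_on V (tangent i)"
  unfolding tangent_def by (intro smooth_intros smooth)

lemma smooth_second [smooth_intros]: "smooth_on V (second i j)"
  unfolding second_def by (intro smooth_intros)

lemma metric_entry: "induced_metric \<psi> x $ i $ j = tangent i x \<bullet> tangent j x"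
  by (simp add: induced_metric_def tangent_def)

lemma tangent_combination:
  assumes "x \<in> V"
  shows "frechet_derivative \<psi> (at x) v = (\<Sum>i\<in>UNIV. v $ i *\<^sub>R tangent i x)"
  using frechet_derivative_eq_sum_pderivative[OF smooth_on_differentiable[OF smooth assms]]
  by (simp add: tangent_def)

lemma tangent_independent:
  assumes "x \<in> V" "(\<Sum>i\<in>UNIV. v $ i *\<^sub>R tangent i x) = 0"
  shows "v = 0"
proof -
  have lin: "linear (frechet_derivative \<psi> (at x))"
    by (rule linear_frechet_derivative[OF smooth_on_differentiable[OF smooth assms(1)]])
  have "frechet_derivative \<psi> (at x) v = 0" using tangent_combination[OF assms(1)] assms(2) by simp
  then show ?thesis using linear_injective_0[OF lin] inj[OF assms(1)] by blast
qed

lemma metric_quadratic: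
  "v \<bullet> (induced_metric \<psi> x *v w) = (\<Sum>i\<in>UNIV. v $ i *\<^sub>R tangent i x) \<bullet> (\<Sum>i\<in>UNIV. w $ i *\<^sub>R tangent i x)"
proof -
  have "v \<bullet> u = (\<Sum>i\<in>UNIV. v $ i * u $ i)" for u :: "real^'n" by (simp add: inner_vec_def)
  then show ?thesis
    by (simp add: matrix_vector_mult_def metric_entry inner_sum_left inner_sum_right sum_distrib_left mult_ac)
       (subst sum.swap, simp)
qed

lemma det_metric_pos:
  assumes "x \<in> V"
  shows "det (induced_metric \<psi> x) > 0"
proof (rule det_pos_of_positive_definite)
  fix v :: "real^'n" assume "v \<noteq> 0"
  then show "v \<bullet> (induced_metric \<psi> x *v v) > 0"
    unfolding metric_quadratic using tangent_independent[OF assms] by auto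
qed

lemma smooth_metric [smooth_intros]: "smooth_on V (\<lambda>x. induced_metric \<psi> x $ i $ j)"
  unfolding metric_entry by (intro smooth_intros open_V)

lemma smooth_ginv [smooth_intros]: "smooth_on V (\<lambda>x. ginv x $ i $ j)"
  unfolding ginv_def by (intro smooth_on_matrix_inv open_V smooth_metric det_metric_pos)

lemma smooth_sqrt_det [smooth_intros]: "smooth_on V (\<lambda>x. sqrt (det (induced_metric \<psi> x)))"
  by (intro smooth_on_sqrt smooth_on_det open_V smooth_metric det_metric_pos)

lemma smooth_dual [smooth_intros]: "smooth_on V (dual k)"
  unfolding dual_def[abs_def] by (intro smooth_intros open_V)

lemma smooth_chr [smooth_intros]: "smooth_on V (chr k i j)"
  unfolding chr_def[abs_def] by (intro smooth_intros open_V)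

lemma smooth_sff [smooth_intros]: "smooth_on V (sff i j)"
  unfolding sff_def[abs_def] by (intro smooth_intros open_V)

lemmas differentiable = smooth_on_differentiable[of V]

lemma dual_tangent:
  assumes "x \<in> V"
  shows "dual k x \<bullet> tangent j x = (if k = j then 1 else 0)"
  using matrix_inv_mult(1)[of "induced_metric \<psi> x" k j] det_metric_pos[OF assms]
  by (simp add: dual_def inner_sum_left metric_entry ginv_def)

lemma dual_dual:
  assumes "x \<in> V"
  shows "dual k x \<bullet> dual l x = ginv x $ k $ l"
proof -
  have *: "dual i x \<bullet> dual j x = ginv x $ j $ i" for i j
    unfolding dual_def[of j] by (simp add: inner_sum_right dual_tangent[OF assms] sum_delta_mult)
  show ?thesis using *[of l k] by (simp add: inner_commute)
qed

lemma ginv_sym: "x \<in> V \<Longrightarrow> ginv x $ k $ l = ginv x $ l $ k"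
  using dual_dual inner_commute by metis

lemma tangent_dual:
  assumes "x \<in> V"
  shows "(\<Sum>k\<in>UNIV. (tangent l x \<bullet> tangent k x) *\<^sub>R dual k x) = tangent l x"
proof -
  have "(\<Sum>k\<in>UNIV. (tangent l x \<bullet> tangent k x) *\<^sub>R dual k x)
    = (\<Sum>k\<in>UNIV. \<Sum>m\<in>UNIV. (induced_metric \<psi> x $ l $ k * ginv x $ k $ m) *\<^sub>R tangent m x)"
    by (simp add: dual_def metric_entry scaleR_sum_right)
  also have "\<dots> = (\<Sum>m\<in>UNIV. (\<Sum>k\<in>UNIV. induced_metric \<psi> x $ l $ k * ginv x $ k $ m) *\<^sub>R tangent m x)"
    by (subst sum.swap) (simp add: scaleR_sum_left)
  also have "\<dots> = tangent l x"
    unfolding ginv_def using det_metric_pos[OF assms] by (simp add: matrix_inv_mult sum_delta_scaleR)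
  finally show ?thesis .
qed

lemma sff_tangent:
  assumes "x \<in> V"
  shows "sff i j x \<bullet> tangent l x = 0"
proof -
  have "tangent l x \<bullet> second i j x = (\<Sum>k\<in>UNIV. (tangent l x \<bullet> tangent k x) *\<^sub>R dual k x) \<bullet> second i j x"
    by (simp add: tangent_dual[OF assms])
  also have "\<dots> = (\<Sum>k\<in>UNIV. chr k i j x * (tangent k x \<bullet> tangent l x))"
    by (simp only: inner_sum_left inner_scaleR_left chr_def mult.commute inner_commute[of "tangent l x"])
  finally show ?thesis
    by (simp add: sff_def inner_diff_left inner_sum_left inner_commute[of "second i j x"])
qed

section \<open>Christoffel symbols, Ricci curvature and the Gauss equation\<close>

lemma second_sym: "x \<in> V \<Longrightarrow> second i j x = second j i x"
  unfolding second_def tangent_def by (rule pderivative_commute[OF open_V _ smooth])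

lemma chr_sym: "x \<in> V \<Longrightarrow> chr k i j x = chr k j i x"
  unfolding chr_def by (simp add: second_sym)

lemma pderivative_metric:
  assumes "x \<in> V"
  shows "pderivative i (\<lambda>y. induced_metric \<psi> y $ j $ l) x
    = second j i x \<bullet> tangent l x + tangent j x \<bullet> second l i x"
  unfolding metric_entry second_def
  by (rule pderivative_inner) (intro differentiable[OF _ assms] smooth_intros)+

text \<open>Each derivative of the metric is a sum of two products of a tangent with a second
  derivative. By the symmetry of second derivatives four of the six products in the Christoffel
  formula cancel, and the other two agree.\<close>

lemma christoffel_eq:
  assumes "x \<in> V"
  shows "christoffel (induced_metric \<psi>) k i j x = chr k i j x"
proof -
  have "second j i x \<bullet> tangent l x + tangent j x \<bullet> second l i x
     + (second i j x \<bullet> tangent l x + tangent i x \<bullet> second l j x)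
     - (second i l x \<bullet> tangent j x + tangent i x \<bullet> second j l x) = 2 * (tangent l x \<bullet> second i j x)" for l
    using second_sym[OF assms, of j i] second_sym[OF assms, of l i] second_sym[OF assms, of l j]
    by (simp add: inner_commute)
  then show ?thesis
    unfolding christoffel_def pderivative_metric[OF assms] chr_def dual_def ginv_def[symmetric]
    by (simp add: inner_sum_left sum_divide_distrib)
qed

text \<open>The derivative of a Christoffel symbol is split into a third derivative of
  \<open>\<psi>\<close>, products of Christoffel symbols and products of second fundamental forms.
  In the Ricci curvature the first two kinds cancel. The last kind arises from differentiating the
  orthogonality of \<open>sff\<close> and \<open>tangent\<close>.\<close>

lemma pderivative_chr:
  assumes x: "x \<in> V"
  shows "pderivative c (chr m a b) x = dual m x \<bullet> pderivative c (second a b) x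
    - (\<Sum>k\<in>UNIV. chr k a b x * chr m k c x) + (\<Sum>l\<in>UNIV. ginv x $ m $ l * (sff l c x \<bullet> sff a b x))"
proof -
  have D: "tangent k differentiable (at x)" "chr k i j differentiable (at x)" "sff i j differentiable (at x)" for k i j
    by (intro differentiable[OF _ x] smooth_intros)+
  have Ds: "(\<lambda>y. chr k a b y *\<^sub>R tangent k y) differentiable (at x)" for k
    by (intro differentiable[OF _ x] smooth_intros open_V)
  have Dss: "(\<lambda>y. \<Sum>k\<in>UNIV. chr k a b y *\<^sub>R tangent k y) differentiable (at x)"
    by (intro differentiable[OF _ x] smooth_intros open_V)
  have "second a b = (\<lambda>y. sff a b y + (\<Sum>k\<in>UNIV. chr k a b y *\<^sub>R tangent k y))"
    by (simp add: sff_def fun_eq_iff)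
  then have "pderivative c (second a b) x = pderivative c (\<lambda>y. sff a b y + (\<Sum>k\<in>UNIV. chr k a b y *\<^sub>R tangent k y)) x"
    by simp
  also have "\<dots> = pderivative c (sff a b) x + (\<Sum>k\<in>UNIV. pderivative c (\<lambda>y. chr k a b y *\<^sub>R tangent k y) x)"
    by (subst pderivative_add[OF D(3) Dss], subst pderivative_sum[OF Ds]) simp
  also have "(\<Sum>k\<in>UNIV. pderivative c (\<lambda>y. chr k a b y *\<^sub>R tangent k y) x)
    = (\<Sum>k\<in>UNIV. pderivative c (chr k a b) x *\<^sub>R tangent k x + chr k a b x *\<^sub>R second k c x)"
    by (subst pderivative_scaleR[OF D(2) D(1)]) (simp add: second_def)
  finally have "dual m x \<bullet> pderivative c (second a b) x = dual m x \<bullet> pderivative c (sff a b) x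
     + (\<Sum>k\<in>UNIV. pderivative c (chr k a b) x * (dual m x \<bullet> tangent k x) + chr k a b x * chr m k c x)"
    by (simp add: inner_add_right inner_sum_right chr_def)
  also have "\<dots> = dual m x \<bullet> pderivative c (sff a b) x + pderivative c (chr m a b) x
     + (\<Sum>k\<in>UNIV. chr k a b x * chr m k c x)"
    by (simp add: sum.distrib dual_tangent[OF x] sum_delta_mult)
  finally have 1: "dual m x \<bullet> pderivative c (second a b) x = dual m x \<bullet> pderivative c (sff a b) x + pderivative c (chr m a b) x
     + (\<Sum>k\<in>UNIV. chr k a b x * chr m k c x)" .
  have 2: "tangent l x \<bullet> pderivative c (sff a b) x = - (sff l c x \<bullet> sff a b x)" for l
  proof -
    have "pderivative c (\<lambda>y. sff a b y \<bullet> tangent l y) x = pderivative c (\<lambda>y. 0) x"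
      by (rule pderivative_cong[OF open_V x]) (simp add: sff_tangent)
    then have "pderivative c (sff a b) x \<bullet> tangent l x + sff a b x \<bullet> second l c x = 0"
      by (simp add: pderivative_inner[OF D(3) D(1)] pderivative_const second_def)
    moreover have "sff a b x \<bullet> second l c x = sff a b x \<bullet> sff l c x"
    proof -
      have "second l c x = sff l c x + (\<Sum>k\<in>UNIV. chr k l c x *\<^sub>R tangent k x)" by (simp add: sff_def)
      then show ?thesis by (simp add: inner_add_right inner_sum_right sff_tangent[OF x])
    qed
    ultimately show ?thesis by (simp add: inner_commute)
  qed
  have "dual m x \<bullet> pderivative c (sff a b) x = - (\<Sum>l\<in>UNIV. ginv x $ m $ l * (sff l c x \<bullet> sff a b x))"
    unfolding dual_def by (simp add: inner_sum_left 2 sum_negf)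
  with 1 show ?thesis by simp
qed

lemma third_sym:
  assumes "x \<in> V"
  shows "pderivative c (second a b) x = pderivative b (second a c) x"
  unfolding second_def by (rule pderivative_commute[OF open_V assms smooth_tangent])

lemma ricci_eq:
  assumes x: "x \<in> V"
  shows "ricci (induced_metric \<psi>) j k x =
    (\<Sum>i\<in>UNIV. \<Sum>l\<in>UNIV. ginv x $ i $ l * (sff l i x \<bullet> sff j k x - sff l j x \<bullet> sff i k x))"
proof -
  have c: "pderivative c (christoffel (induced_metric \<psi>) m a b) x = pderivative c (chr m a b) x" for c m a b
    by (rule pderivative_cong[OF open_V x]) (simp add: christoffel_eq)
  \<comment> \<open>This removes the third derivatives of \<open>\<psi>\<close> from the Ricci
    curvature, where they occur with opposite signs.\<close>
  have t: "pderivative i (second j k) x = pderivative j (second i k) x" for i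
  proof -
    have "pderivative i (second j k) x = pderivative i (second k j) x"
      by (rule pderivative_cong[OF open_V x]) (simp add: second_sym)
    also have "\<dots> = pderivative j (second k i) x" by (rule third_sym[OF x])
    also have "\<dots> = pderivative j (second i k) x"
      by (rule pderivative_cong[OF open_V x]) (simp add: second_sym)
    finally show ?thesis .
  qed
  have "pderivative i (chr i j k) x - pderivative j (chr i i k) x
      + (\<Sum>l\<in>UNIV. chr i i l x * chr l j k x - chr i j l x * chr l i k x)
     = (\<Sum>l\<in>UNIV. ginv x $ i $ l * (sff l i x \<bullet> sff j k x - sff l j x \<bullet> sff i k x))" for i
  proof -
    have "(\<Sum>l\<in>UNIV. chr i i l x * chr l j k x) = (\<Sum>l\<in>UNIV. chr l j k x * chr i l i x)"
      by (rule sum.cong) (simp_all add: chr_sym[OF x, of i i])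
    moreover have "(\<Sum>l\<in>UNIV. chr i j l x * chr l i k x) = (\<Sum>l\<in>UNIV. chr l i k x * chr i l j x)"
      by (rule sum.cong) (simp_all add: chr_sym[OF x, of i j])
    ultimately show ?thesis
      unfolding pderivative_chr[OF x] t
      by (simp add: sum_subtractf right_diff_distrib)
  qed
  then show ?thesis
    unfolding ricci_def c christoffel_eq[OF x] by simp
qed

lemma gauss_equation:
  assumes x: "x \<in> V"
  shows "scalar_curvature (induced_metric \<psi>) x =
    (\<Sum>j\<in>UNIV. \<Sum>k\<in>UNIV. ginv x $ j $ k * (\<Sum>i\<in>UNIV. \<Sum>l\<in>UNIV. ginv x $ i $ l *
      (sff l i x \<bullet> sff j k x - sff l j x \<bullet> sff i k x)))"
  unfolding scalar_curvature_def ricci_eq[OF x] ginv_def[symmetric] ..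

section \<open>The Laplace-Beltrami operator as the trace of the Hessian\<close>

lemma dual_eq':
  "x \<in> V \<Longrightarrow> dual k x = (\<Sum>l\<in>UNIV. ginv x $ l $ k *\<^sub>R tangent l x)"
  unfolding dual_def by (intro sum.cong refl) (simp add: ginv_sym)

text \<open>The product of \<open>ginv\<close> with the metric is constant; differentiating it and
  multiplying by \<open>ginv\<close> isolates the derivative of \<open>ginv\<close>. The result says
  that the inverse metric is parallel.\<close>

lemma pderivative_ginv:
  assumes x: "x \<in> V"
  shows "pderivative c (\<lambda>y. ginv y $ i $ m) x =
    - (\<Sum>k\<in>UNIV. ginv x $ i $ k * chr m k c x) - (\<Sum>k\<in>UNIV. chr i k c x * ginv x $ k $ m)"
proof -
  let ?d = "\<lambda>k. pderivative c (\<lambda>y. ginv y $ i $ k) x"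
  let ?g = "\<lambda>k j y. induced_metric \<psi> y $ k $ j"
  have D: "(\<lambda>y. ginv y $ i $ k) differentiable (at x)" "?g k j differentiable (at x)"
    "(\<lambda>y. ginv y $ i $ k * ?g k j y) differentiable (at x)" for k j
    by (intro differentiable[OF _ x] smooth_intros open_V)+
  have 1: "(\<Sum>k\<in>UNIV. ?d k * ?g k j x) = - (\<Sum>k\<in>UNIV. ginv x $ i $ k * pderivative c (?g k j) x)" for j
  proof -
    have "(\<Sum>k\<in>UNIV. ginv y $ i $ k * ?g k j y) = (if i = j then 1 else 0)" if "y \<in> V" for y
      using matrix_inv_mult(1)[of "induced_metric \<psi> y" i j] det_metric_pos[OF that] by (simp add: ginv_def)
    then have "pderivative c (\<lambda>y. \<Sum>k\<in>UNIV. ginv y $ i $ k * ?g k j y) x = pderivative c (\<lambda>y. if i = j then 1 else 0) x"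
      by (intro pderivative_cong[OF open_V x])
    then have "(\<Sum>k\<in>UNIV. ?d k * ?g k j x + ginv x $ i $ k * pderivative c (?g k j) x) = 0"
      unfolding pderivative_sum[OF D(3)] pderivative_mult[OF D(1,2)] pderivative_const .
    then show ?thesis by (simp add: sum.distrib)
  qed
  have "?d m = (\<Sum>k\<in>UNIV. ?d k * (\<Sum>j\<in>UNIV. ?g k j x * ginv x $ j $ m))"
    using matrix_inv_mult(2)[of "induced_metric \<psi> x"] det_metric_pos[OF x]
    by (simp add: ginv_def sum_delta_mult)
  also have "\<dots> = (\<Sum>j\<in>UNIV. (\<Sum>k\<in>UNIV. ?d k * ?g k j x) * ginv x $ j $ m)"
    by (simp only: sum_distrib_left sum_distrib_right mult.assoc) (rule sum.swap)
  also have "\<dots> = - (\<Sum>j\<in>UNIV. \<Sum>k\<in>UNIV. ginv x $ i $ k * pderivative c (?g k j) x * ginv x $ j $ m)"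
    by (simp add: 1 sum_distrib_right sum_negf)
  also have "\<dots> = - (\<Sum>j\<in>UNIV. \<Sum>k\<in>UNIV. ginv x $ i $ k * (ginv x $ j $ m * (second k c x \<bullet> tangent j x)))
     - (\<Sum>j\<in>UNIV. \<Sum>k\<in>UNIV. ginv x $ i $ k * (tangent k x \<bullet> second j c x) * ginv x $ j $ m)"
    by (simp add: pderivative_metric[OF x] algebra_simps sum.distrib)
  also have "(\<Sum>j\<in>UNIV. \<Sum>k\<in>UNIV. ginv x $ i $ k * (ginv x $ j $ m * (second k c x \<bullet> tangent j x)))
    = (\<Sum>k\<in>UNIV. ginv x $ i $ k * chr m k c x)"
    by (subst sum.swap) (simp add: chr_def dual_eq'[OF x] inner_sum_left sum_distrib_left inner_commute[of "second k c x" for k])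
  also have "(\<Sum>j\<in>UNIV. \<Sum>k\<in>UNIV. ginv x $ i $ k * (tangent k x \<bullet> second j c x) * ginv x $ j $ m)
    = (\<Sum>j\<in>UNIV. chr i j c x * ginv x $ j $ m)"
    by (simp add: chr_def dual_def inner_sum_left sum_distrib_right)
  finally show ?thesis .
qed

text \<open>Jacobi's formula gives a trace whose two halves are the same contracted Christoffel
  symbol; the resulting factor 2 is cancelled by the square root.\<close>

lemma pderivative_sqrt_det:
  assumes x: "x \<in> V"
  shows "pderivative c (\<lambda>y. sqrt (det (induced_metric \<psi> y))) x =
    sqrt (det (induced_metric \<psi> x)) * (\<Sum>k\<in>UNIV. chr k k c x)"
proof -
  let ?g = "induced_metric \<psi>"
  have D: "(\<lambda>y. ?g y $ k $ l) differentiable (at x)" for k l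
    by (intro differentiable[OF _ x] smooth_intros)
  have pos: "det (?g x) > 0" by (rule det_metric_pos[OF x])
  have "pderivative c (\<lambda>y. det (?g y)) x = det (?g x) * (\<Sum>k\<in>UNIV. \<Sum>l\<in>UNIV. ginv x $ l $ k *
     (second k c x \<bullet> tangent l x + tangent k x \<bullet> second l c x))"
    using pos by (subst pderivative_det[OF D]) (simp_all add: pderivative_metric[OF x] ginv_def)
  also have "(\<Sum>k\<in>UNIV. \<Sum>l\<in>UNIV. ginv x $ l $ k * (second k c x \<bullet> tangent l x + tangent k x \<bullet> second l c x))
    = (\<Sum>k\<in>UNIV. \<Sum>l\<in>UNIV. ginv x $ l $ k * (second k c x \<bullet> tangent l x))
     + (\<Sum>k\<in>UNIV. \<Sum>l\<in>UNIV. ginv x $ l $ k * (tangent k x \<bullet> second l c x))"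
    by (simp add: algebra_simps sum.distrib)
  also have "(\<Sum>k\<in>UNIV. \<Sum>l\<in>UNIV. ginv x $ l $ k * (second k c x \<bullet> tangent l x)) = (\<Sum>k\<in>UNIV. chr k k c x)"
    by (simp add: chr_def dual_eq'[OF x] inner_sum_left inner_commute[of "second k c x" for k])
  also have "(\<Sum>k\<in>UNIV. \<Sum>l\<in>UNIV. ginv x $ l $ k * (tangent k x \<bullet> second l c x)) = (\<Sum>k\<in>UNIV. chr k k c x)"
    by (subst sum.swap) (simp add: chr_def dual_def inner_sum_left)
  finally have 1: "pderivative c (\<lambda>y. det (?g y)) x = det (?g x) * (2 * (\<Sum>k\<in>UNIV. chr k k c x))" by simp
  have "pderivative c (\<lambda>y. sqrt (det (?g y))) x = inverse (sqrt (det (?g x))) / 2 * pderivative c (\<lambda>y. det (?g y)) x"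
    using pos by (intro pderivative_real_compose DERIV_real_sqrt differentiable[OF _ x] smooth_on_det smooth_intros open_V)
  also have "\<dots> = sqrt (det (?g x)) * (\<Sum>k\<in>UNIV. chr k k c x)"
    unfolding 1 using pos by (simp add: field_simps)
  finally show ?thesis .
qed

text \<open>After summation over \<open>i\<close>, the derivative of the volume density cancels one
  of the two terms of \<open>pderivative_ginv\<close>, and the other one becomes the Christoffel
  term of the Hessian.\<close>

lemma laplace_beltrami_eq:
  assumes x: "x \<in> V" and u: "smooth_on V u"
  shows "laplace_beltrami (induced_metric \<psi>) u x =
    (\<Sum>i\<in>UNIV. \<Sum>j\<in>UNIV. ginv x $ i $ j *
      (pderivative i (pderivative j u) x - (\<Sum>k\<in>UNIV. chr k i j x * pderivative k u x)))"
proof -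
  let ?q = "\<lambda>y. sqrt (det (induced_metric \<psi> y))"
  let ?u = "\<lambda>j. pderivative j u"
  have qpos: "?q x > 0" using det_metric_pos[OF x] by simp
  have D: "?q differentiable (at x)" "(\<lambda>y. ginv y $ i $ j) differentiable (at x)" "?u j differentiable (at x)"
    "(\<lambda>y. ginv y $ i $ j * ?u j y) differentiable (at x)"
    "(\<lambda>y. \<Sum>j\<in>UNIV. ginv y $ i $ j * ?u j y) differentiable (at x)" for i j
    by (intro differentiable[OF _ x] smooth_intros open_V u)+
  have 1: "pderivative i (\<lambda>y. ?q y * (\<Sum>j\<in>UNIV. ginv y $ i $ j * ?u j y)) x
    = ?q x * ((\<Sum>j\<in>UNIV. \<Sum>k\<in>UNIV. chr k i k x * ginv x $ i $ j * ?u j x)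
       - (\<Sum>j\<in>UNIV. \<Sum>k\<in>UNIV. ginv x $ i $ k * chr j k i x * ?u j x)
       - (\<Sum>j\<in>UNIV. \<Sum>k\<in>UNIV. chr i k i x * ginv x $ k $ j * ?u j x)
       + (\<Sum>j\<in>UNIV. ginv x $ i $ j * pderivative i (?u j) x))" for i
    unfolding pderivative_mult[OF D(1) D(5)] pderivative_sum[OF D(4)] pderivative_mult[OF D(2,3)]
      pderivative_sqrt_det[OF x] pderivative_ginv[OF x]
    by (simp add: sum_distrib_left sum_distrib_right algebra_simps sum.distrib sum_subtractf chr_sym[OF x, of _ i])
       (subst sum.swap, simp)
  have 2: "(\<Sum>i\<in>UNIV. \<Sum>j\<in>UNIV. \<Sum>k\<in>UNIV. chr k i k x * ginv x $ i $ j * ?u j x)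
    = (\<Sum>i\<in>UNIV. \<Sum>j\<in>UNIV. \<Sum>k\<in>UNIV. chr i k i x * ginv x $ k $ j * ?u j x)"
    by (subst sum.swap, subst (2) sum.swap, subst sum.swap) (rule refl)
  have 3: "(\<Sum>j\<in>UNIV. \<Sum>k\<in>UNIV. ginv x $ i $ k * chr j k i x * ?u j x)
     = (\<Sum>j\<in>UNIV. ginv x $ i $ j * (\<Sum>k\<in>UNIV. chr k i j x * ?u k x))" for i
    by (subst sum.swap) (simp add: sum_distrib_left mult.assoc chr_sym[OF x, of _ i])
  have "laplace_beltrami (induced_metric \<psi>) u x =
    (\<Sum>i\<in>UNIV. pderivative i (\<lambda>y. ?q y * (\<Sum>j\<in>UNIV. ginv y $ i $ j * ?u j y)) x) / ?q x"
    unfolding laplace_beltrami_def ginv_def ..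
  also have "\<dots> = (\<Sum>i\<in>UNIV. \<Sum>j\<in>UNIV. ginv x $ i $ j * pderivative i (?u j) x)
    - (\<Sum>i\<in>UNIV. \<Sum>j\<in>UNIV. ginv x $ i $ j * (\<Sum>k\<in>UNIV. chr k i j x * ?u k x))"
    unfolding 1 sum_distrib_left[symmetric] using qpos by (simp add: sum.distrib sum_subtractf 2 3)
  finally show ?thesis by (simp add: right_diff_distrib sum_subtractf)
qed

end

text \<open>The second derivative of \<open>U\<close> at \<open>p\<close>. The first direction is
  expanded in \<open>Basis\<close> so that only derivatives in fixed directions have to be
  differentiated again.\<close>

definition ambient_hessian :: "('a::euclidean_space \<Rightarrow> real) \<Rightarrow> 'a \<Rightarrow> 'a \<Rightarrow> 'a \<Rightarrow> real" where
  "ambient_hessian U p v w =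
    (\<Sum>b\<in>Basis. (v \<bullet> b) * frechet_derivative (\<lambda>q. frechet_derivative U (at q) b) (at p) w)"

lemma ambient_hessian_sum:
  assumes "open T" "p \<in> T" "smooth_on T U"
  shows "ambient_hessian U p (\<Sum>a\<in>I. s a *\<^sub>R v a) (\<Sum>b\<in>J. t b *\<^sub>R w b)
    = (\<Sum>a\<in>I. \<Sum>b\<in>J. s a * t b * ambient_hessian U p (v a) (w b))"
proof -
  have lin: "linear (frechet_derivative (\<lambda>q. frechet_derivative U (at q) b) (at p))" for b
    by (intro linear_frechet_derivative smooth_on_differentiable[OF smooth_on_derivative[OF assms(3)] assms(2)])
  let ?L = "\<lambda>b. frechet_derivative (\<lambda>q. frechet_derivative U (at q) b) (at p)"
  have "ambient_hessian U p (\<Sum>a\<in>I. s a *\<^sub>R v a) (\<Sum>b\<in>J. t b *\<^sub>R w b)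
    = (\<Sum>b\<in>Basis. (\<Sum>a\<in>I. s a * (v a \<bullet> b)) * (\<Sum>c\<in>J. t c * ?L b (w c)))"
    unfolding ambient_hessian_def linear_sum[OF lin] linear_scale[OF lin] by (simp add: inner_sum_left)
  also have "\<dots> = (\<Sum>b\<in>Basis. \<Sum>a\<in>I. \<Sum>c\<in>J. s a * t c * ((v a \<bullet> b) * ?L b (w c)))"
    by (simp add: sum_product mult_ac)
  also have "\<dots> = (\<Sum>a\<in>I. \<Sum>b\<in>Basis. \<Sum>c\<in>J. s a * t c * ((v a \<bullet> b) * ?L b (w c)))"
    by (rule sum.swap)
  also have "\<dots> = (\<Sum>a\<in>I. \<Sum>c\<in>J. \<Sum>b\<in>Basis. s a * t c * ((v a \<bullet> b) * ?L b (w c)))"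
    by (intro sum.cong refl sum.swap)
  finally show ?thesis by (simp add: ambient_hessian_def sum_distrib_left)
qed

context immersion
begin

lemma pderivative_ambient:
  assumes x: "x \<in> V" and T: "open T" "\<psi> ` V \<subseteq> T" and U: "smooth_on T U"
  shows "pderivative i (\<lambda>y. U (\<psi> y)) x = frechet_derivative U (at (\<psi> x)) (tangent i x)"
  unfolding tangent_def
  by (rule pderivative_compose) (use T x in \<open>auto intro: smooth_on_differentiable[OF U] smooth_on_differentiable[OF smooth]\<close>)

lemma smooth_ambient:
  assumes "open T" "\<psi> ` V \<subseteq> T" "smooth_on T U"
  shows "smooth_on V (\<lambda>y. U (\<psi> y))"
  by (rule smooth_on_compose[OF open_V assms(1,3) smooth assms(2)])

lemma pderivative2_ambient:
  assumes x: "x \<in> V" and T: "open T" "\<psi> ` V \<subseteq> T" and U: "smooth_on T U"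
  shows "pderivative j (pderivative i (\<lambda>y. U (\<psi> y))) x =
    ambient_hessian U (\<psi> x) (tangent i x) (tangent j x) + frechet_derivative U (at (\<psi> x)) (second i j x)"
proof -
  have lin: "linear (frechet_derivative U (at (\<psi> y)))" if "y \<in> V" for y
    by (rule linear_frechet_derivative[OF smooth_on_differentiable[OF U]]) (use T that in auto)
  have exp: "frechet_derivative U (at (\<psi> y)) w = (\<Sum>b\<in>Basis. (w \<bullet> b) * frechet_derivative U (at (\<psi> y)) b)"
    if "y \<in> V" for y w
  proof -
    have "frechet_derivative U (at (\<psi> y)) (\<Sum>b\<in>Basis. (w \<bullet> b) *\<^sub>R b) = (\<Sum>b\<in>Basis. (w \<bullet> b) * frechet_derivative U (at (\<psi> y)) b)"
      unfolding linear_sum[OF lin[OF that]] linear_scale[OF lin[OF that]] by simp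
    then show ?thesis by (simp only: euclidean_representation)
  qed
  have sU: "smooth_on V (\<lambda>y. frechet_derivative U (at (\<psi> y)) b)" for b
    by (rule smooth_ambient[OF T smooth_on_derivative[OF U]])
  have D: "(\<lambda>y. tangent i y \<bullet> b) differentiable (at x)" "(\<lambda>y. frechet_derivative U (at (\<psi> y)) b) differentiable (at x)"
    "(\<lambda>y. (tangent i y \<bullet> b) * frechet_derivative U (at (\<psi> y)) b) differentiable (at x)"
    "tangent i differentiable (at x)" for b
    by (intro differentiable[OF _ x] smooth_intros open_V sU)+
  have "pderivative j (pderivative i (\<lambda>y. U (\<psi> y))) x
    = pderivative j (\<lambda>y. \<Sum>b\<in>Basis. (tangent i y \<bullet> b) * frechet_derivative U (at (\<psi> y)) b) x"
    by (rule pderivative_cong[OF open_V x]) (simp only: pderivative_ambient[OF _ T U] exp[symmetric])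
  also have "\<dots> = (\<Sum>b\<in>Basis. (second i j x \<bullet> b) * frechet_derivative U (at (\<psi> x)) b
     + (tangent i x \<bullet> b) * frechet_derivative (\<lambda>q. frechet_derivative U (at q) b) (at (\<psi> x)) (tangent j x))"
    unfolding pderivative_sum[OF D(3)] pderivative_mult[OF D(1,2)]
      pderivative_linear[OF bounded_linear_inner_left D(4)] pderivative_ambient[OF x T smooth_on_derivative[OF U]]
      second_def ..
  finally show ?thesis
    by (simp add: exp[OF x, of "second i j x"] ambient_hessian_def sum.distrib add.commute)
qed

text \<open>The Christoffel symbols remove the tangential part of \<open>second i j x\<close> and
  leave \<open>sff i j x\<close>. In this form the operator is built from contractions of tensors,
  which serves both the change of chart and the computation with an explicit kernel.\<close>

lemma coord_conformal_laplacian_ambient: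
  assumes x: "x \<in> V" and T: "open T" "\<psi> ` V \<subseteq> T" and U: "smooth_on T U"
  shows "coord_conformal_laplacian (induced_metric \<psi>) (\<lambda>y. U (\<psi> y)) x =
    - (\<Sum>i\<in>UNIV. \<Sum>j\<in>UNIV. ginv x $ i $ j *
        (ambient_hessian U (\<psi> x) (tangent i x) (tangent j x) + frechet_derivative U (at (\<psi> x)) (sff i j x)))
    + (real CARD('n) - 2) / (4 * (real CARD('n) - 1)) *
      (\<Sum>j\<in>UNIV. \<Sum>k\<in>UNIV. ginv x $ j $ k * (\<Sum>i\<in>UNIV. \<Sum>l\<in>UNIV. ginv x $ i $ l *
      (sff l i x \<bullet> sff j k x - sff l j x \<bullet> sff i k x))) * U (\<psi> x)"
proof -
  have lin: "linear (frechet_derivative U (at (\<psi> x)))"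
    by (rule linear_frechet_derivative[OF smooth_on_differentiable[OF U]]) (use T x in auto)
  have "pderivative i (pderivative j (\<lambda>y. U (\<psi> y))) x - (\<Sum>k\<in>UNIV. chr k i j x * pderivative k (\<lambda>y. U (\<psi> y)) x)
    = ambient_hessian U (\<psi> x) (tangent i x) (tangent j x) + frechet_derivative U (at (\<psi> x)) (sff i j x)" for i j
  proof -
    have "pderivative i (pderivative j (\<lambda>y. U (\<psi> y))) x = pderivative j (pderivative i (\<lambda>y. U (\<psi> y))) x"
      by (rule pderivative_commute[OF open_V x smooth_ambient[OF T U]])
    then show ?thesis
      unfolding pderivative2_ambient[OF x T U] pderivative_ambient[OF x T U] sff_def
        linear_diff[OF lin] linear_sum[OF lin] linear_scale[OF lin] by simp
  qed
  then show ?thesis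
    unfolding coord_conformal_laplacian_def laplace_beltrami_eq[OF x smooth_ambient[OF T U]] gauss_equation[OF x]
    by simp
qed

end

section \<open>Independence of the parametrization\<close>

lemma sum_sum_pairs:
  fixes h :: "'i::finite \<Rightarrow> 'j::finite \<Rightarrow> 'a::comm_monoid_add"
  shows "(\<Sum>i\<in>UNIV. \<Sum>j\<in>UNIV. h i j) = (\<Sum>p\<in>UNIV. h (fst p) (snd p))"
  by (simp add: sum.cartesian_product case_prod_beta)

lemma sum_sum_swap:
  fixes f :: "'i::finite \<Rightarrow> 'j::finite \<Rightarrow> 'k::finite \<Rightarrow> 'l::finite \<Rightarrow> 'a::comm_monoid_add"
  shows "(\<Sum>i\<in>UNIV. \<Sum>j\<in>UNIV. \<Sum>a\<in>UNIV. \<Sum>b\<in>UNIV. f i j a b) = (\<Sum>a\<in>UNIV. \<Sum>b\<in>UNIV. \<Sum>i\<in>UNIV. \<Sum>j\<in>UNIV. f i j a b)"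
  unfolding sum_sum_pairs[of "\<lambda>a b. f _ _ a b"] sum_sum_pairs[of "\<lambda>i j. f i j _ _"]
    sum_sum_pairs[of "\<lambda>i j. \<Sum>q\<in>UNIV. f i j (fst q) (snd q)"] sum_sum_pairs[of "\<lambda>a b. \<Sum>p\<in>UNIV. f (fst p) (snd p) a b"]
  by (rule sum.swap)

text \<open>\<open>T\<close> stands for the Jacobian of a change of chart, \<open>G'\<close> and
  \<open>G\<close> for the inverse metrics, and the inner sum on the left is a pulled-back bilinear
  form: its trace does not depend on the chart. Inverse metrics push forward, so \<open>T\<close>
  does not have to be inverted.\<close>

lemma contraction:
  fixes G G' :: "'n::finite \<Rightarrow> 'n \<Rightarrow> real"
  assumes "\<And>a b. (\<Sum>i\<in>UNIV. \<Sum>j\<in>UNIV. T a i * T b j * G' i j) = G a b"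
  shows "(\<Sum>i\<in>UNIV. \<Sum>j\<in>UNIV. G' i j * (\<Sum>a\<in>UNIV. \<Sum>b\<in>UNIV. T a i * T b j * \<beta> a b)) = (\<Sum>a\<in>UNIV. \<Sum>b\<in>UNIV. G a b * \<beta> a b)"
proof -
  have "(\<Sum>i\<in>UNIV. \<Sum>j\<in>UNIV. G' i j * (\<Sum>a\<in>UNIV. \<Sum>b\<in>UNIV. T a i * T b j * \<beta> a b))
    = (\<Sum>i\<in>UNIV. \<Sum>j\<in>UNIV. \<Sum>a\<in>UNIV. \<Sum>b\<in>UNIV. T a i * T b j * G' i j * \<beta> a b)"
    by (simp add: sum_distrib_left mult_ac)
  also have "\<dots> = (\<Sum>a\<in>UNIV. \<Sum>b\<in>UNIV. \<Sum>i\<in>UNIV. \<Sum>j\<in>UNIV. T a i * T b j * G' i j * \<beta> a b)"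
    by (rule sum_sum_swap)
  also have "\<dots> = (\<Sum>a\<in>UNIV. \<Sum>b\<in>UNIV. (\<Sum>i\<in>UNIV. \<Sum>j\<in>UNIV. T a i * T b j * G' i j) * \<beta> a b)"
    by (simp add: sum_distrib_right)
  finally show ?thesis by (simp add: assms)
qed

text \<open>The curvature term is a double trace of a tensor with four indices, so
  \<open>contraction\<close> is applied to one pair of indices and then to the other.\<close>

lemma gauss_contraction:
  fixes G G' :: "'n::finite \<Rightarrow> 'n \<Rightarrow> real" and B B' :: "'n \<Rightarrow> 'n \<Rightarrow> 'b::real_inner"
  assumes G: "\<And>a b. (\<Sum>i\<in>UNIV. \<Sum>j\<in>UNIV. T a i * T b j * G' i j) = G a b"
    and B': "\<And>i j. B' i j = (\<Sum>a\<in>UNIV. \<Sum>b\<in>UNIV. (T a i * T b j) *\<^sub>R B a b)"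
  shows "(\<Sum>j\<in>UNIV. \<Sum>k\<in>UNIV. G' j k * (\<Sum>i\<in>UNIV. \<Sum>l\<in>UNIV. G' i l * (B' l i \<bullet> B' j k - B' l j \<bullet> B' i k)))
    = (\<Sum>j\<in>UNIV. \<Sum>k\<in>UNIV. G j k * (\<Sum>i\<in>UNIV. \<Sum>l\<in>UNIV. G i l * (B l i \<bullet> B j k - B l j \<bullet> B i k)))"
proof -
  define W where "W b j = (\<Sum>c\<in>UNIV. T c j *\<^sub>R B b c)" for b j
  have B'W: "B' l j = (\<Sum>b\<in>UNIV. T b l *\<^sub>R W b j)" for l j
    by (simp add: B' W_def scaleR_sum_right)
  have inner: "(\<Sum>i\<in>UNIV. \<Sum>l\<in>UNIV. G' i l * (B' l i \<bullet> B' j k - B' l j \<bullet> B' i k))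
    = (\<Sum>c\<in>UNIV. \<Sum>d\<in>UNIV. T c j * T d k * (\<Sum>a\<in>UNIV. \<Sum>b\<in>UNIV. G a b * (B b a \<bullet> B c d - B b c \<bullet> B a d)))" for j k
  proof -
    have 1: "B' l i \<bullet> B' j k - B' l j \<bullet> B' i k
       = (\<Sum>a\<in>UNIV. \<Sum>b\<in>UNIV. T a i * T b l * (B b a \<bullet> B' j k - W b j \<bullet> W a k))" for i l
    proof -
      have "B' l i \<bullet> B' j k = (\<Sum>b\<in>UNIV. \<Sum>a\<in>UNIV. T a i * T b l * (B b a \<bullet> B' j k))"
        unfolding B'[of l i] by (simp add: inner_sum_left mult_ac)
      also have "\<dots> = (\<Sum>a\<in>UNIV. \<Sum>b\<in>UNIV. T a i * T b l * (B b a \<bullet> B' j k))" by (rule sum.swap)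
      finally have "B' l i \<bullet> B' j k = \<dots>" .
      moreover have "B' l j \<bullet> B' i k = (\<Sum>a\<in>UNIV. \<Sum>b\<in>UNIV. T a i * T b l * (W b j \<bullet> W a k))"
        unfolding B'W by (simp add: inner_sum_left inner_sum_right sum_distrib_left mult_ac)
      ultimately show ?thesis by (simp add: right_diff_distrib sum_subtractf)
    qed
    have 2: "B b a \<bullet> B' j k - W b j \<bullet> W a k = (\<Sum>c\<in>UNIV. \<Sum>d\<in>UNIV. T c j * T d k * (B b a \<bullet> B c d - B b c \<bullet> B a d))" for a b
    proof -
      have "B b a \<bullet> B' j k = (\<Sum>c\<in>UNIV. \<Sum>d\<in>UNIV. T c j * T d k * (B b a \<bullet> B c d))"
        unfolding B'[of j k] by (simp add: inner_sum_right mult_ac)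
      moreover have "W b j \<bullet> W a k = (\<Sum>c\<in>UNIV. \<Sum>d\<in>UNIV. T c j * T d k * (B b c \<bullet> B a d))"
        unfolding W_def
        by (simp add: inner_sum_left inner_sum_right sum_distrib_left) (subst sum.swap, simp add: mult_ac)
      ultimately show ?thesis by (simp add: right_diff_distrib sum_subtractf)
    qed
    have "(\<Sum>i\<in>UNIV. \<Sum>l\<in>UNIV. G' i l * (B' l i \<bullet> B' j k - B' l j \<bullet> B' i k))
      = (\<Sum>a\<in>UNIV. \<Sum>b\<in>UNIV. G a b * (B b a \<bullet> B' j k - W b j \<bullet> W a k))"
      unfolding 1 by (rule contraction[OF G])
    also have "\<dots> = (\<Sum>a\<in>UNIV. \<Sum>b\<in>UNIV. \<Sum>c\<in>UNIV. \<Sum>d\<in>UNIV. T c j * T d k * (G a b * (B b a \<bullet> B c d - B b c \<bullet> B a d)))"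
      unfolding 2 by (simp add: sum_distrib_left mult_ac)
    also have "\<dots> = (\<Sum>c\<in>UNIV. \<Sum>d\<in>UNIV. \<Sum>a\<in>UNIV. \<Sum>b\<in>UNIV. T c j * T d k * (G a b * (B b a \<bullet> B c d - B b c \<bullet> B a d)))"
      by (rule sum_sum_swap)
    finally show ?thesis by (simp add: sum_distrib_left)
  qed
  show ?thesis unfolding inner by (rule contraction[OF G])
qed

lemma local_parametrization_immersion: "local_parametrization M V \<psi> \<Longrightarrow> immersion V \<psi>"
  by (simp add: local_parametrization_def immersion_def)

context immersion
begin

lemma tangential_orthogonal_eq_0:
  assumes "z \<in> span (range (\<lambda>i. tangent i x))" "\<And>i. z \<bullet> tangent i x = 0"
  shows "z = 0"
  using orthogonal_to_span[OF assms(1), of z] assms(2) by (auto simp: orthogonal_def)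

lemma tangent_in_span: "tangent i x \<in> span (range (\<lambda>i. tangent i x))"
  by (rule span_base) simp

end

text \<open>\<open>conformal_laplacian\<close> is evaluated in a chart picked by
  \<open>SOME\<close>, whereas integrals over \<open>M\<close> are computed in a given chart. It
  suffices that \<open>tangent\<close>, \<open>sff\<close> and \<open>ginv\<close> transform as
  tensors; the two contraction lemmas do the rest.\<close>

lemma coord_conformal_laplacian_chart_independent:
  fixes M :: "(real^('n::finite option)) set"
  assumes lp: "local_parametrization M V \<psi>" "local_parametrization M W \<phi>"
    and xy: "x \<in> V" "y \<in> W" "\<psi> x = \<phi> y" and U: "smooth_on UNIV U"
  shows "coord_conformal_laplacian (induced_metric \<psi>) (\<lambda>z. U (\<psi> z)) x =
    coord_conformal_laplacian (induced_metric \<phi>) (\<lambda>z. U (\<phi> z)) y"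
proof -
  interpret P: immersion V \<psi> using lp(1) by (rule local_parametrization_immersion)
  interpret F: immersion W \<phi> using lp(2) by (rule local_parametrization_immersion)
  obtain \<phi>' where hom: "homeomorphism W (\<phi> ` W) \<phi> \<phi>'"
    using lp(2) unfolding local_parametrization_def by blast
  have "openin (top_of_set M) (\<phi> ` W)" using lp(2) by (simp add: local_parametrization_def)
  then obtain O' where O': "open O'" "\<phi> ` W = M \<inter> O'" unfolding openin_open by blast
  have VM: "\<psi> ` V \<subseteq> M" using lp(1) openin_imp_subset unfolding local_parametrization_def by blast
  define V0 where "V0 = V \<inter> \<psi> -` O'"
  have V0: "open V0"
    unfolding V0_def
    using continuous_on_open_vimage[OF P.open_V] smooth_on_continuous[OF P.smooth] O'(1)
    by (metis Int_commute)
  have xV0: "x \<in> V0" using xy O' by (auto simp: V0_def)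
  have V0V: "V0 \<subseteq> V" by (auto simp: V0_def)
  have V0W: "\<psi> z \<in> \<phi> ` W" if "z \<in> V0" for z using that VM O'(2) by (auto simp: V0_def)
  define \<tau> where "\<tau> z = \<phi>' (\<psi> z)" for z
  have \<tau>W: "\<tau> z \<in> W" "\<phi> (\<tau> z) = \<psi> z" if "z \<in> V0" for z
    using hom V0W[OF that] by (auto simp: \<tau>_def homeomorphism_def)
  have \<tau>x: "\<tau> x = y" using hom xy by (simp add: \<tau>_def homeomorphism_apply1)
  have "continuous_on V0 \<tau>"
    unfolding \<tau>_def
    by (rule continuous_on_compose2[of "\<phi> ` W" \<phi>'])
       (use hom V0W smooth_on_continuous[OF smooth_on_subset[OF P.smooth V0V]] in \<open>auto simp: homeomorphism_def\<close>)
  then have cont: "isCont \<tau> z" if "z \<in> V0" for z using that V0 continuous_on_eq_continuous_at by blast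
  have d\<tau>: "\<tau> differentiable (at z)" if "z \<in> V0" for z
  proof (rule differentiable_lift_through_immersion[of \<phi> \<tau> z \<psi> V0])
    show "\<phi> differentiable (at (\<tau> z))" using F.differentiable[OF F.smooth] \<tau>W(1)[OF that] by blast
    show "inj (frechet_derivative \<phi> (at (\<tau> z)))" using F.inj \<tau>W(1)[OF that] by blast
    show "\<psi> differentiable (at z)" using P.differentiable[OF P.smooth] V0V that by blast
  qed (use that cont V0 \<tau>W in auto)
  define T where "T a i z = pderivative i \<tau> z $ a" for a i z
  have pushforward: "pderivative i (\<lambda>z. f (\<tau> z)) z = (\<Sum>a\<in>UNIV. T a i z *\<^sub>R pderivative a f (\<tau> z))"
    if "z \<in> V0" "f differentiable (at (\<tau> z))" for f :: "real^'n \<Rightarrow> real^('n option)" and i z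
    using pderivative_compose[OF that(2) d\<tau>[OF that(1)]] frechet_derivative_eq_sum_pderivative[OF that(2)]
    by (simp add: T_def)
  have tan: "P.tangent i z = (\<Sum>a\<in>UNIV. T a i z *\<^sub>R F.tangent a (\<tau> z))" if "z \<in> V0" for i z
  proof -
    have "P.tangent i z = pderivative i (\<lambda>z. \<phi> (\<tau> z)) z"
      unfolding P.tangent_def by (rule pderivative_cong[OF V0 that]) (simp add: \<tau>W)
    then show ?thesis
      using pushforward[OF that F.differentiable[OF F.smooth \<tau>W(1)[OF that]]] by (simp add: F.tangent_def)
  qed
  \<comment> \<open>So far \<open>\<tau>\<close> is only known to be differentiable once. This
    formula expresses its Jacobian through smooth functions and \<open>\<tau>\<close> itself, so
    that the Jacobian is differentiable as well.\<close>
  have Teq: "T a i z = F.dual a (\<tau> z) \<bullet> P.tangent i z" if "z \<in> V0" for a i z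
    unfolding tan[OF that]
    by (simp add: inner_sum_right F.dual_tangent[OF \<tau>W(1)[OF that]] sum_delta_mult)
  have dF: "(\<lambda>z. f (\<tau> z)) differentiable (at x)" if "f differentiable (at y)" for f :: "real^'n \<Rightarrow> real^('n option)"
    using differentiable_chain_at[OF d\<tau>[OF xV0], of f] that \<tau>x by (simp add: o_def)
  have dT: "T a i differentiable (at x)" for a i
  proof -
    have "(\<lambda>z. F.dual a (\<tau> z) \<bullet> P.tangent i z) differentiable (at x)"
      by (intro differentiable_inner dF F.differentiable[OF F.smooth_dual xy(2)] P.differentiable[OF P.smooth_tangent xy(1)])
    then obtain D where "((\<lambda>z. F.dual a (\<tau> z) \<bullet> P.tangent i z) has_derivative D) (at x)"
      by (auto simp: differentiable_def)
    then have "(T a i has_derivative D) (at x)"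
      by (rule has_derivative_transform_within_open[OF _ V0 xV0]) (simp add: Teq)
    then show ?thesis by (rule differentiableI)
  qed
  have sec: "P.second i j x = (\<Sum>a\<in>UNIV. pderivative j (T a i) x *\<^sub>R F.tangent a y)
     + (\<Sum>a\<in>UNIV. \<Sum>b\<in>UNIV. (T a i x * T b j x) *\<^sub>R F.second a b y)" for i j
  proof -
    have D: "(\<lambda>z. F.tangent a (\<tau> z)) differentiable (at x)" for a
      by (intro dF F.differentiable[OF F.smooth_tangent xy(2)])
    have D2: "(\<lambda>z. T a i z *\<^sub>R F.tangent a (\<tau> z)) differentiable (at x)" for a
      by (intro differentiable_scaleR dT D)
    have "P.second i j x = pderivative j (\<lambda>z. \<Sum>a\<in>UNIV. T a i z *\<^sub>R F.tangent a (\<tau> z)) x"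
      unfolding P.second_def by (rule pderivative_cong[OF V0 xV0]) (rule tan)
    also have "\<dots> = (\<Sum>a\<in>UNIV. pderivative j (T a i) x *\<^sub>R F.tangent a y + T a i x *\<^sub>R (\<Sum>b\<in>UNIV. T b j x *\<^sub>R F.second a b y))"
      unfolding pderivative_sum[OF D2] pderivative_scaleR[OF dT D]
      using pushforward[OF xV0, of "F.tangent _"] F.differentiable[OF F.smooth_tangent xy(2)] \<tau>x
      by (simp add: F.second_def)
    finally show ?thesis by (simp add: sum.distrib scaleR_sum_right)
  qed
  have tanx: "P.tangent i x = (\<Sum>a\<in>UNIV. T a i x *\<^sub>R F.tangent a y)" for i
    using tan[OF xV0] \<tau>x by simp
  define TM where "TM = (\<chi> a i. T a i x)"
  have "inj ((*v) TM)"
  proof -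
    have "v = 0" if "TM *v v = 0" for v
    proof (rule P.tangent_independent[OF xy(1)])
      have "(\<Sum>i\<in>UNIV. v $ i *\<^sub>R P.tangent i x) = (\<Sum>a\<in>UNIV. (\<Sum>i\<in>UNIV. TM $ a $ i * v $ i) *\<^sub>R F.tangent a y)"
        unfolding tanx scaleR_sum_right scaleR_sum_left by (subst sum.swap) (simp add: TM_def mult.commute)
      also have "\<dots> = (\<Sum>a\<in>UNIV. (TM *v v) $ a *\<^sub>R F.tangent a y)" by (simp add: matrix_vector_mult_def)
      finally show "(\<Sum>i\<in>UNIV. v $ i *\<^sub>R P.tangent i x) = 0" by (simp add: that)
    qed
    then show ?thesis by (simp add: linear_injective_0[OF matrix_vector_mul_linear])
  qed
  then have "det TM \<noteq> 0"
    using invertible_det_nz invertible_left_inverse matrix_left_invertible_injective by metis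
  note TR = matrix_inv_mult(2)[OF this]
  define R where "R i b = matrix_inv TM $ i $ b" for i b
  have TR: "(\<Sum>i\<in>UNIV. T a i x * R i b) = (if a = b then 1 else 0)" for a b
    using TR[of a b] by (simp add: TM_def R_def)
  have tanF: "F.tangent b y = (\<Sum>i\<in>UNIV. R i b *\<^sub>R P.tangent i x)" for b
  proof -
    have "(\<Sum>i\<in>UNIV. R i b *\<^sub>R P.tangent i x) = (\<Sum>a\<in>UNIV. (\<Sum>i\<in>UNIV. T a i x * R i b) *\<^sub>R F.tangent a y)"
      unfolding tanx scaleR_sum_right scaleR_sum_left by (subst sum.swap) (simp add: mult.commute)
    then show ?thesis by (simp add: TR sum_delta_scaleR)
  qed
  let ?S = "span (range (\<lambda>a. F.tangent a y))"
  have PS: "P.tangent i x \<in> ?S" for i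
    unfolding tanx by (intro span_sum span_scale F.tangent_in_span)
  have sff: "P.sff i j x = (\<Sum>a\<in>UNIV. \<Sum>b\<in>UNIV. (T a i x * T b j x) *\<^sub>R F.sff a b y)" for i j
  proof -
    \<comment> \<open>\<open>second\<close> transforms with an extra term, but that term is
      tangential. Hence \<open>Z\<close> is both tangential and normal, and vanishes.\<close>
    define Z where "Z = P.sff i j x - (\<Sum>a\<in>UNIV. \<Sum>b\<in>UNIV. (T a i x * T b j x) *\<^sub>R F.sff a b y)"
    have "Z \<bullet> F.tangent c y = 0" for c
      unfolding Z_def inner_diff_left
      by (subst tanF) (simp add: inner_sum_left inner_sum_right P.sff_tangent[OF xy(1)] F.sff_tangent[OF xy(2)])
    moreover have "Z \<in> ?S"
    proof -
      have "Z = (\<Sum>a\<in>UNIV. pderivative j (T a i) x *\<^sub>R F.tangent a y) - (\<Sum>k\<in>UNIV. P.chr k i j x *\<^sub>R P.tangent k x)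
        + (\<Sum>a\<in>UNIV. \<Sum>b\<in>UNIV. (T a i x * T b j x) *\<^sub>R (\<Sum>k\<in>UNIV. F.chr k a b y *\<^sub>R F.tangent k y))"
        unfolding Z_def P.sff_def sec F.sff_def
        by (simp add: scaleR_diff_right sum_subtractf)
      then show ?thesis
        by (simp only:) (intro span_add span_diff span_sum span_scale F.tangent_in_span PS)
    qed
    ultimately have "Z = 0" by (intro F.tangential_orthogonal_eq_0)
    then show ?thesis by (simp add: Z_def)
  qed
  have dual: "F.dual a y = (\<Sum>i\<in>UNIV. T a i x *\<^sub>R P.dual i x)" for a
  proof -
    define Z where "Z = F.dual a y - (\<Sum>i\<in>UNIV. T a i x *\<^sub>R P.dual i x)"
    have "Z \<in> ?S"
      unfolding Z_def F.dual_def P.dual_def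
      by (intro span_diff span_sum span_scale F.tangent_in_span PS)
    moreover have "Z \<bullet> F.tangent b y = 0" for b
    proof -
      have "(\<Sum>i\<in>UNIV. T a i x *\<^sub>R P.dual i x) \<bullet> P.tangent j x = T a j x" for j
        by (simp add: inner_sum_left P.dual_tangent[OF xy(1)] sum_delta_mult)
      then have "(\<Sum>i\<in>UNIV. T a i x *\<^sub>R P.dual i x) \<bullet> F.tangent b y = (if a = b then 1 else 0)"
        unfolding tanF inner_sum_right inner_scaleR_right using TR[of a b] by (simp only: mult.commute)
      then show ?thesis by (simp add: Z_def inner_diff_left F.dual_tangent[OF xy(2)])
    qed
    ultimately have "Z = 0" by (intro F.tangential_orthogonal_eq_0)
    then show ?thesis by (simp add: Z_def)
  qed
  have G: "(\<Sum>i\<in>UNIV. \<Sum>j\<in>UNIV. T a i x * T b j x * P.ginv x $ i $ j) = F.ginv y $ a $ b" for a b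
    unfolding F.dual_dual[OF xy(2), symmetric] P.dual_dual[OF xy(1), symmetric] dual
    by (simp add: inner_sum_left inner_sum_right sum_distrib_left mult_ac) (rule sum.swap)
  have lin: "linear (frechet_derivative U (at (\<phi> y)))"
    by (rule linear_frechet_derivative[OF smooth_on_differentiable[OF U]]) simp
  have "ambient_hessian U (\<psi> x) (P.tangent i x) (P.tangent j x) + frechet_derivative U (at (\<psi> x)) (P.sff i j x)
    = (\<Sum>a\<in>UNIV. \<Sum>b\<in>UNIV. T a i x * T b j x *
       (ambient_hessian U (\<phi> y) (F.tangent a y) (F.tangent b y) + frechet_derivative U (at (\<phi> y)) (F.sff a b y)))" for i j
    unfolding tanx sff xy(3) linear_sum[OF lin] linear_scale[OF lin]
      ambient_hessian_sum[OF open_UNIV UNIV_I U]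
    by (simp add: distrib_left sum.distrib)
  then show ?thesis
    unfolding P.coord_conformal_laplacian_ambient[OF xy(1) open_UNIV subset_UNIV U]
      F.coord_conformal_laplacian_ambient[OF xy(2) open_UNIV subset_UNIV U]
    by (simp only: contraction[where T="\<lambda>a i. T a i x" and G'="\<lambda>i j. P.ginv x $ i $ j", OF G]
      gauss_contraction[where T="\<lambda>a i. T a i x" and G'="\<lambda>i j. P.ginv x $ i $ j" and B'="\<lambda>i j. P.sff i j x", OF G sff] xy(3))
qed

section \<open>From the distributional to the pointwise equation\<close>

context immersion
begin

definition flux :: "'n \<Rightarrow> (real^'n \<Rightarrow> real) \<Rightarrow> real^'n \<Rightarrow> real" where
  "flux i u y = sqrt (det (induced_metric \<psi> y)) * (\<Sum>j\<in>UNIV. ginv y $ i $ j * pderivative j u y)"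

lemma smooth_flux [smooth_intros]: "smooth_on V u \<Longrightarrow> smooth_on V (flux i u)"
  unfolding flux_def[abs_def] by (intro smooth_intros open_V)

lemma laplace_beltrami_flux:
  "x \<in> V \<Longrightarrow> sqrt (det (induced_metric \<psi> x)) * laplace_beltrami (induced_metric \<psi>) u x =
    (\<Sum>i\<in>UNIV. pderivative i (flux i u) x)"
  using det_metric_pos[of x] unfolding laplace_beltrami_def flux_def[abs_def] ginv_def by simp

lemma smooth_scalar_curvature [smooth_intros]: "smooth_on V (scalar_curvature (induced_metric \<psi>))"
  by (subst smooth_on_cong[OF open_V gauss_equation], assumption) (intro smooth_intros open_V)

lemma smooth_coord_conformal_laplacian [smooth_intros]:
  assumes u: "smooth_on V u"
  shows "smooth_on V (coord_conformal_laplacian (induced_metric \<psi>) u)"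
proof -
  have "smooth_on V (laplace_beltrami (induced_metric \<psi>) u)"
    by (subst smooth_on_cong[OF open_V laplace_beltrami_eq[OF _ u]], assumption) (intro smooth_intros open_V u)
  then show ?thesis
    unfolding coord_conformal_laplacian_def[abs_def] by (intro smooth_intros open_V u)
qed

text \<open>The curvature terms cancel, and so do the products of first derivatives because
  \<open>ginv\<close> is symmetric; a coordinate divergence is left.\<close>

lemma green_identity:
  assumes x: "x \<in> V" and v: "smooth_on V v" and w: "smooth_on V w"
  shows "sqrt (det (induced_metric \<psi> x)) * (v x * coord_conformal_laplacian (induced_metric \<psi>) w x
      - w x * coord_conformal_laplacian (induced_metric \<psi>) v x)
    = - (\<Sum>i\<in>UNIV. pderivative i (\<lambda>y. v y * flux i w y - w y * flux i v y) x)"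
proof -
  let ?q = "sqrt (det (induced_metric \<psi> x))"
  have D: "v differentiable (at x)" "w differentiable (at x)" "flux i v differentiable (at x)" "flux i w differentiable (at x)"
    "(\<lambda>y. v y * flux i w y) differentiable (at x)" "(\<lambda>y. w y * flux i v y) differentiable (at x)" for i
    by (intro differentiable[OF _ x] smooth_intros open_V v w)+
  have 1: "(\<Sum>i\<in>UNIV. pderivative i v x * flux i w x) = (\<Sum>i\<in>UNIV. pderivative i w x * flux i v x)"
  proof -
    have "(\<Sum>i\<in>UNIV. pderivative i v x * flux i w x) = (\<Sum>i\<in>UNIV. \<Sum>j\<in>UNIV. ?q * (pderivative i v x * ginv x $ i $ j * pderivative j w x))"
      by (simp add: flux_def sum_distrib_left mult_ac)
    also have "\<dots> = (\<Sum>j\<in>UNIV. \<Sum>i\<in>UNIV. ?q * (pderivative i v x * ginv x $ i $ j * pderivative j w x))" by (rule sum.swap)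
    also have "\<dots> = (\<Sum>j\<in>UNIV. \<Sum>i\<in>UNIV. pderivative j w x * (?q * (ginv x $ j $ i * pderivative i v x)))"
      by (intro sum.cong refl) (simp add: ginv_sym[OF x] mult_ac)
    also have "\<dots> = (\<Sum>i\<in>UNIV. pderivative i w x * flux i v x)"
      by (simp add: flux_def sum_distrib_left)
    finally show ?thesis .
  qed
  have 2: "?q * coord_conformal_laplacian (induced_metric \<psi>) u x = - (\<Sum>i\<in>UNIV. pderivative i (flux i u) x)
    + ?q * ((real CARD('n) - 2) / (4 * (real CARD('n) - 1)) * scalar_curvature (induced_metric \<psi>) x) * u x" for u
    unfolding coord_conformal_laplacian_def laplace_beltrami_flux[OF x, symmetric] by (simp add: algebra_simps)
  have "?q * (v x * coord_conformal_laplacian (induced_metric \<psi>) w x - w x * coord_conformal_laplacian (induced_metric \<psi>) v x)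
    = v x * (?q * coord_conformal_laplacian (induced_metric \<psi>) w x) - w x * (?q * coord_conformal_laplacian (induced_metric \<psi>) v x)"
    by (simp add: algebra_simps)
  also have "\<dots> = - (\<Sum>i\<in>UNIV. v x * pderivative i (flux i w) x) + (\<Sum>i\<in>UNIV. w x * pderivative i (flux i v) x)"
    unfolding 2 by (simp add: algebra_simps sum_distrib_left)
  also have "\<dots> = - (\<Sum>i\<in>UNIV. pderivative i (\<lambda>y. v y * flux i w y - w y * flux i v y) x)"
    unfolding pderivative_diff[OF D(5,6)] pderivative_mult[OF D(1,4)] pderivative_mult[OF D(2,3)]
    using 1 by (simp add: sum.distrib sum_subtractf)
  finally show ?thesis .
qed

lemma integral_green_identity:
  assumes v: "smooth_on V v" and w: "smooth_on V w" and K: "compact K" "K \<subseteq> V"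
    and supp: "\<And>x. x \<in> V - K \<Longrightarrow> w x = 0"
  shows "(\<integral>x. indicator V x * (sqrt (det (induced_metric \<psi> x)) * (v x * coord_conformal_laplacian (induced_metric \<psi>) w x)) \<partial>lborel)
    = (\<integral>x. indicator V x * (sqrt (det (induced_metric \<psi> x)) * (w x * coord_conformal_laplacian (induced_metric \<psi>) v x)) \<partial>lborel)"
    (is "?lhs = ?rhs")
proof -
  let ?q = "\<lambda>x. sqrt (det (induced_metric \<psi> x))"
  let ?P = "coord_conformal_laplacian (induced_metric \<psi>)"
  define F where "F i y = v y * flux i w y - w y * flux i v y" for i y
  have sF: "smooth_on V (F i)" for i unfolding F_def[abs_def] by (intro smooth_intros open_V v w)
  have oK: "open (V - K)" using open_V K(1) by (simp add: compact_imp_closed open_Diff)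
  have dw: "pderivative j w x = 0" if "x \<in> V - K" for j x
    using pderivative_cong[OF oK that, of w "\<lambda>x. 0"] supp by (simp add: pderivative_const)
  have F0: "F i x = 0" if "x \<in> V - K" for i x
    using supp[OF that] dw[OF that] by (simp add: F_def flux_def)
  have dF0: "pderivative i (F i) x = 0" if "x \<in> V - K" for i x
    using pderivative_cong[OF oK that, of "F i" "\<lambda>x. 0"] F0 by (simp add: pderivative_const)
  have intF: "integrable lborel (\<lambda>x. indicator V x * pderivative i (F i) x)" for i
    by (rule integrable_compact_support[OF open_V K]) (auto intro!: smooth_on_continuous smooth_intros sF dF0)
  have intw: "integrable lborel (\<lambda>x. indicator V x * (?q x * (w x * ?P v x)))"
    by (rule integrable_compact_support[OF open_V K])
       (auto intro!: smooth_on_continuous smooth_intros v w open_V simp: supp)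
  have "?lhs = (\<integral>x. indicator V x * (?q x * (w x * ?P v x)) - (\<Sum>i\<in>UNIV. indicator V x * pderivative i (F i) x) \<partial>lborel)"
  proof (rule Bochner_Integration.integral_cong[OF refl])
    fix x
    show "indicator V x * (?q x * (v x * ?P w x)) = indicator V x * (?q x * (w x * ?P v x)) - (\<Sum>i\<in>UNIV. indicator V x * pderivative i (F i) x)"
    proof (cases "x \<in> V")
      case True
      then show ?thesis using green_identity[OF True v w] by (simp add: F_def[abs_def] algebra_simps)
    qed simp
  qed
  also have "\<dots> = ?rhs - (\<Sum>i\<in>UNIV. \<integral>x. indicator V x * pderivative i (F i) x \<partial>lborel)"
    by (subst Bochner_Integration.integral_diff[OF intw])
       (simp_all only: Bochner_Integration.integral_sum[OF intF] Bochner_Integration.integrable_sum[OF intF])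
  also have "\<dots> = ?rhs"
  proof -
    have "(\<integral>x. indicator V x * pderivative i (F i) x \<partial>lborel) = 0" for i
      by (rule integral_pderivative_compact_support[OF open_V K sF]) (rule F0)
    then show ?thesis by simp
  qed
  finally show ?thesis .
qed

end

section \<open>Localization and the choice of test functions\<close>

lemma coord_conformal_laplacian_locally_zero:
  assumes "open S" "x \<in> S" "\<And>y. y \<in> S \<Longrightarrow> u y = 0"
  shows "coord_conformal_laplacian g u x = 0"
proof -
  have 1: "pderivative j u y = 0" if "y \<in> S" for j y
    using pderivative_cong[OF assms(1) that, of u "\<lambda>x. 0"] assms(3) by (simp add: pderivative_const)
  have "pderivative i (\<lambda>y. sqrt (det (g y)) * (\<Sum>j\<in>UNIV. matrix_inv (g y) $ i $ j * pderivative j u y)) x = 0" for i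
    using pderivative_cong[OF assms(1,2), of "\<lambda>y. sqrt (det (g y)) * (\<Sum>j\<in>UNIV. matrix_inv (g y) $ i $ j * pderivative j u y)" "\<lambda>x. 0"] 1
    by (simp add: pderivative_const)
  then show ?thesis
    using assms(2,3) by (simp add: coord_conformal_laplacian_def laplace_beltrami_def)
qed

lemma parametrization_at_works:
  assumes "closed_embedded_hypersurface M" "p \<in> M"
  obtains V \<psi> where "parametrization_at M p = (V, \<psi>)" "local_parametrization M V \<psi>" "p \<in> \<psi> ` V"
proof -
  have "\<exists>z. case z of (V, \<psi>) \<Rightarrow> local_parametrization M V \<psi> \<and> p \<in> \<psi> ` V"
    using assms by (auto simp: closed_embedded_hypersurface_def)
  from someI_ex[OF this] show ?thesis
    using that unfolding parametrization_at_def[symmetric] by (auto split: prod.splits)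
qed

lemma conformal_laplacian_locally_zero:
  assumes M: "closed_embedded_hypersurface M" "p \<in> M" and N: "open N" "p \<in> N" "\<And>q. q \<in> N \<Longrightarrow> u q = 0"
  shows "conformal_laplacian M u p = 0"
proof -
  obtain V \<psi> where V: "parametrization_at M p = (V, \<psi>)" "local_parametrization M V \<psi>" "p \<in> \<psi> ` V"
    by (rule parametrization_at_works[OF M])
  have x: "inv_into V \<psi> p \<in> V" "\<psi> (inv_into V \<psi> p) = p"
    using V(3) by (auto intro: inv_into_into f_inv_into_f)
  have "open (V \<inter> \<psi> -` N)"
    using V(2) N(1) by (intro continuous_open_preimage smooth_on_continuous) (simp_all add: local_parametrization_def)
  then have "coord_conformal_laplacian (induced_metric \<psi>) (u \<circ> \<psi>) (inv_into V \<psi> p) = 0"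
    by (rule coord_conformal_laplacian_locally_zero) (use x N in auto)
  then show ?thesis by (simp add: conformal_laplacian_def V(1))
qed

lemma conformal_laplacian_chart:
  fixes M :: "(real^('n::finite option)) set"
  assumes M: "closed_embedded_hypersurface M" and lp: "local_parametrization M V \<psi>" and x: "x \<in> V"
    and U: "smooth_on UNIV U"
  shows "conformal_laplacian M U (\<psi> x) = coord_conformal_laplacian (induced_metric \<psi>) (\<lambda>y. U (\<psi> y)) x"
proof -
  have "\<psi> x \<in> M" using lp x openin_imp_subset unfolding local_parametrization_def by blast
  then obtain W \<phi> where W: "parametrization_at M (\<psi> x) = (W, \<phi>)" "local_parametrization M W \<phi>" "\<psi> x \<in> \<phi> ` W"
    by (rule parametrization_at_works[OF M])
  have y: "inv_into W \<phi> (\<psi> x) \<in> W" "\<phi> (inv_into W \<phi> (\<psi> x)) = \<psi> x"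
    using W(3) by (auto intro: inv_into_into f_inv_into_f)
  show ?thesis
    using coord_conformal_laplacian_chart_independent[OF W(2) lp y(1) x y(2) U]
    by (simp add: conformal_laplacian_def W(1) o_def)
qed

lemma smooth_on_hypersurface_ambient:
  assumes "smooth_on UNIV U"
  shows "smooth_on_hypersurface M U"
  unfolding smooth_on_hypersurface_def local_parametrization_def o_def
  by (intro allI impI smooth_on_compose[OF _ open_UNIV assms]) auto

lemma AE_lborel_continuous_zero:
  fixes h :: "'a::euclidean_space \<Rightarrow> real"
  assumes ae: "AE x in lborel. indicator V x * h x = 0" and V: "open V" "x \<in> V" and h: "continuous_on V h"
  shows "h x = 0"
proof (rule ccontr)
  assume "h x \<noteq> 0"
  define B where "B = V \<inter> h -` (- {0})"
  have B: "open B" "x \<in> B"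
    unfolding B_def using continuous_open_preimage[OF h V(1)] V(2) \<open>h x \<noteq> 0\<close> by (auto simp: open_Compl)
  obtain N where N: "N \<in> null_sets lborel" "{x. \<not> indicator V x * h x = 0} \<subseteq> N"
    using AE_E[OF ae] by (metis (no_types, lifting) Collect_cong UNIV_I null_setsI space_borel space_lborel)
  have "negligible N" using N(1) by (simp add: negligible_iff_null_sets null_sets_completionI)
  moreover have "B \<subseteq> N"
  proof
    show "z \<in> N" if "z \<in> B" for z
      using that by (intro N(2)[THEN subsetD]) (simp add: B_def)
  qed
  ultimately show False using open_not_negligible B negligible_subset by blast
qed

text \<open>If the value at \<open>x1\<close> were not zero, a nonnegative bump near
  \<open>\<psi> x1\<close> would turn the distributional equation, after integration by parts in the
  chart, into a vanishing integral of a function of fixed sign that does not vanish at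
  \<open>x1\<close>. The bump is the restriction of an ambient one, so that it is smooth on all of
  \<open>M\<close> and not only in the chart.\<close>

lemma conformal_green_function_pointwise:
  fixes M :: "(real^('n::finite option)) set"
  assumes M: "closed_embedded_hypersurface M" and vol: "riemannian_volume M dV" and Q: "Q \<in> M"
    and green: "conformal_green_function M dV Q G"
    and lp: "local_parametrization M V \<psi>" and QV: "Q \<notin> \<psi> ` V"
    and T: "open T" "\<psi> ` V \<subseteq> T" and U: "smooth_on T U" and GU: "\<And>P. P \<in> \<psi> ` V \<Longrightarrow> G P = U P"
    and x1: "x1 \<in> V"
  shows "coord_conformal_laplacian (induced_metric \<psi>) (\<lambda>y. U (\<psi> y)) x1 = 0"
proof (rule ccontr)
  interpret immersion V \<psi> using lp by (rule local_parametrization_immersion)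
  let ?q = "\<lambda>x. sqrt (det (induced_metric \<psi> x))"
  let ?P = "coord_conformal_laplacian (induced_metric \<psi>)"
  define v where "v y = U (\<psi> y)" for y
  assume "\<not> ?thesis"
  then have nz: "?P v x1 \<noteq> 0" by (simp add: v_def[abs_def])
  define s where "s = sgn (?P v x1)"
  have sv: "smooth_on V v" unfolding v_def by (rule smooth_ambient[OF T U])
  have contP: "continuous_on V (\<lambda>x. s * ?P v x)"
    by (intro smooth_on_continuous smooth_intros open_V sv)
  define B where "B = V \<inter> (\<lambda>x. s * ?P v x) -` {0<..}"
  have "open B" unfolding B_def by (intro continuous_open_preimage contP open_V open_greaterThan)
  have "x1 \<in> B"
    using x1 nz by (simp add: B_def s_def sgn_if)
  obtain r where r: "r > 0" "cball x1 r \<subseteq> B"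
    using open_contains_cball \<open>open B\<close> \<open>x1 \<in> B\<close> by blast
  have BV: "B \<subseteq> V" by (simp add: B_def)
  have BP: "s * ?P v x > 0" if "x \<in> B" for x using that by (simp add: B_def)
  have ballV: "ball x1 r \<subseteq> V" and cballV: "cball x1 r \<subseteq> V" using r(2) BV ball_subset_cball by blast+
  obtain \<psi>' where hom: "homeomorphism V (\<psi> ` V) \<psi> \<psi>'" using lp unfolding local_parametrization_def by blast
  have opM: "openin (top_of_set M) (\<psi> ` V)" using lp by (simp add: local_parametrization_def)
  have "openin (top_of_set V) (ball x1 r)"
    using ballV by (simp add: openin_open_eq open_V)
  then have "openin (top_of_set (\<psi> ` V)) (\<psi> ` ball x1 r)"
    by (rule homeomorphism_imp_open_map[OF hom])
  then have "openin (top_of_set M) (\<psi> ` ball x1 r)"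
    using opM openin_trans by blast
  \<comment> \<open>As \<open>M\<close> is embedded, no other sheet of it enters \<open>O'\<close>:
    near \<open>\<psi> x1\<close> it consists of the image of the small ball alone.\<close>
  then obtain O' where O': "open O'" "\<psi> ` ball x1 r = M \<inter> O'" unfolding openin_open by blast
  have "\<psi> x1 \<in> O'" using O'(2) r(1) by (metis IntD2 centre_in_ball imageI)
  then obtain \<rho> where \<rho>: "\<rho> > 0" "ball (\<psi> x1) \<rho> \<subseteq> O'" using O'(1) open_contains_ball by blast
  \<comment> \<open>The radius is \<open>\<rho> / 2\<close> rather than \<open>\<rho>\<close> so
    that \<open>u\<close> vanishes on a whole neighbourhood of every point of \<open>M\<close>
    outside the chart, which makes its conformal Laplacian vanish there too.\<close>
  obtain u :: "real^('n option) \<Rightarrow> real" where u: "smooth_on UNIV u" "\<And>P. u P \<ge> 0" "u (\<psi> x1) > 0"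
    "\<And>P. dist P (\<psi> x1) \<ge> \<rho> / 2 \<Longrightarrow> u P = 0"
    by (rule smooth_bump_exists[of "\<rho> / 2" "\<psi> x1"]) (use \<rho>(1) in simp_all)
  define w where "w y = u (\<psi> y)" for y
  have sw: "smooth_on V w" unfolding w_def by (rule smooth_ambient[OF open_UNIV subset_UNIV u(1)])
  have VM: "\<psi> ` V \<subseteq> M" using opM openin_imp_subset by blast
  have far: "dist P (\<psi> x1) \<ge> \<rho>" if "P \<in> M" "P \<notin> \<psi> ` ball x1 r" for P
  proof (rule ccontr)
    assume "\<not> ?thesis"
    then have "P \<in> O'" using \<rho>(2) by (auto simp: dist_commute subset_iff)
    then show False using O'(2) that by blast
  qed
  have w0: "w x = 0" if "x \<in> V - cball x1 r" for x
  proof -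
    have "\<psi> x \<notin> \<psi> ` ball x1 r"
    proof
      assume "\<psi> x \<in> \<psi> ` ball x1 r"
      then obtain z where z: "z \<in> ball x1 r" "\<psi> x = \<psi> z" by blast
      then have "x = z" using that ballV hom by (metis DiffD1 homeomorphism_apply1 subsetD)
      then show False using that z ball_subset_cball by blast
    qed
    then have "dist (\<psi> x) (\<psi> x1) \<ge> \<rho>" using far VM that by blast
    then show ?thesis using u(4) \<rho>(1) by (simp add: w_def)
  qed
  define F where "F P = U P * conformal_laplacian M u P" for P
  have F\<psi>: "F (\<psi> x) = v x * ?P w x" if "x \<in> V" for x
    unfolding F_def v_def w_def[abs_def] conformal_laplacian_chart[OF M lp that u(1)] ..
  have spdV: "space dV = M"
    using vol sets_eq_imp_space_eq[of dV "restrict_space borel M"] by (simp add: riemannian_volume_def space_restrict_space)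
  have "u Q = 0" using far[OF Q] QV ballV u(4)[of Q] \<rho>(1) by fastforce
  then have "0 = (\<integral>P. G P * conformal_laplacian M u P \<partial>dV)"
    using green smooth_on_hypersurface_ambient[OF u(1)] by (simp add: conformal_green_function_def)
  also have "\<dots> = (\<integral>P. indicator (\<psi> ` V) P * F P \<partial>dV)"
  proof (rule Bochner_Integration.integral_cong[OF refl])
    fix P assume "P \<in> space dV"
    then have P: "P \<in> M" by (simp add: spdV)
    show "G P * conformal_laplacian M u P = indicator (\<psi> ` V) P * F P"
    proof (cases "P \<in> \<psi> ` V")
      case True
      then show ?thesis by (simp add: F_def GU)
    next
      case False
      then have "dist P (\<psi> x1) \<ge> \<rho>" using far[OF P] ballV by blast
      have "conformal_laplacian M u P = 0"
        by (rule conformal_laplacian_locally_zero[OF M P, of "- cball (\<psi> x1) (\<rho> / 2)"])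
           (use \<open>dist P (\<psi> x1) \<ge> \<rho>\<close> \<rho>(1) u(4) in \<open>auto simp: dist_commute open_Compl\<close>)
      then show ?thesis using False by simp
    qed
  qed
  also have "\<dots> = (\<integral>x. indicator V x * (?q x * F (\<psi> x)) \<partial>lborel)"
  proof (rule integral_riemannian_volume[OF vol lp])
    show "continuous_on V ?q" by (intro smooth_on_continuous smooth_intros)
    show "det (induced_metric \<psi> x) \<ge> 0" if "x \<in> V" for x using det_metric_pos[OF that] by simp
    have "continuous_on V (\<lambda>x. v x * ?P w x)"
      by (intro smooth_on_continuous smooth_intros open_V sv sw)
    then show "continuous_on V (\<lambda>x. F (\<psi> x))" by (rule continuous_on_eq) (simp add: F\<psi>)
  qed
  also have "\<dots> = (\<integral>x. indicator V x * (?q x * (v x * ?P w x)) \<partial>lborel)"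
    by (intro Bochner_Integration.integral_cong refl) (simp add: indicator_def F\<psi>)
  also have "\<dots> = (\<integral>x. indicator V x * (?q x * (w x * ?P v x)) \<partial>lborel)"
    by (rule integral_green_identity[OF sv sw compact_cball cballV]) (rule w0)
  finally have zero: "(\<integral>x. indicator V x * (?q x * (w x * ?P v x)) \<partial>lborel) = 0" by simp
  define h where "h x = ?q x * (w x * (s * ?P v x))" for x
  have ch: "continuous_on V h"
    unfolding h_def[abs_def] by (intro smooth_on_continuous smooth_intros open_V sv sw)
  have h0: "h x = 0" if "x \<in> V - cball x1 r" for x using w0[OF that] by (simp add: h_def)
  have hpos: "h x \<ge> 0" if "x \<in> V" for x
  proof (cases "x \<in> cball x1 r")
    case True
    then have "s * ?P v x > 0" using r(2) BP by blast
    moreover have "?q x > 0" using det_metric_pos[OF that] by simp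
    ultimately show ?thesis using u(2) by (simp add: h_def w_def)
  next
    case False
    then show ?thesis using h0 that by simp
  qed
  have "integrable lborel (\<lambda>x. indicator V x * h x)"
    by (rule integrable_compact_support[OF open_V compact_cball cballV ch]) (rule h0)
  moreover have "(\<integral>x. indicator V x * h x \<partial>lborel) = 0"
  proof -
    have "(\<integral>x. indicator V x * h x \<partial>lborel) = (\<integral>x. s * (indicator V x * (?q x * (w x * ?P v x))) \<partial>lborel)"
      by (simp add: h_def mult_ac)
    then show ?thesis using zero by simp
  qed
  moreover have "AE x in lborel. 0 \<le> indicator V x * h x" using hpos by (simp add: indicator_def)
  ultimately have "AE x in lborel. indicator V x * h x = 0"
    using integral_nonneg_eq_0_iff_AE by blast
  then have "h x1 = 0" by (rule AE_lborel_continuous_zero[OF _ open_V x1 ch])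
  moreover have "h x1 > 0"
    using u(3) det_metric_pos[OF x1] BP[OF \<open>x1 \<in> B\<close>] by (simp add: h_def w_def)
  ultimately show False by simp
qed

section \<open>The equation satisfied by the Riesz kernel\<close>

lemma powr_norm_derivative:
  fixes p Q :: "'a::euclidean_space"
  assumes "p \<noteq> Q"
  shows "((\<lambda>q. c * ((q - Q) \<bullet> (q - Q)) powr a) has_derivative
     (\<lambda>w. c * (2 * a * ((p - Q) \<bullet> (p - Q)) powr (a - 1) * ((p - Q) \<bullet> w)))) (at p)"
proof -
  have pos: "(p - Q) \<bullet> (p - Q) > 0" using assms by simp
  have 1: "((\<lambda>q. (q - Q) \<bullet> (q - Q)) has_derivative (\<lambda>w. 2 * ((p - Q) \<bullet> w))) (at p)"
    by (rule derivative_eq_intros refl)+ (simp add: fun_eq_iff inner_commute)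
  have 2: "((\<lambda>r. c * r powr a) has_derivative (\<lambda>v. v * (c * (a * ((p - Q) \<bullet> (p - Q)) powr (a - 1))))) (at ((p - Q) \<bullet> (p - Q)))"
    using DERIV_cmult[OF has_real_derivative_powr[OF pos, of a], of c]
    by (rule has_derivative_eq_rhs[OF has_field_derivative_imp_has_derivative]) (simp add: fun_eq_iff)
  show ?thesis
    by (rule has_derivative_eq_rhs[OF has_derivative_compose[OF 1 2]]) (simp add: fun_eq_iff)
qed

lemma smooth_powr_norm: "smooth_on (- {Q}) (\<lambda>q. c * ((q - Q) \<bullet> (q - Q)) powr a)" for Q :: "'a::euclidean_space"
  by (intro smooth_intros open_Compl closed_singleton) auto

lemma ambient_hessian_powr_norm:
  fixes p Q :: "'a::euclidean_space"
  assumes p: "p \<noteq> Q"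
  shows "ambient_hessian (\<lambda>q. c * ((q - Q) \<bullet> (q - Q)) powr a) p v w =
    c * (4 * a * (a - 1) * ((p - Q) \<bullet> (p - Q)) powr (a - 2) * ((p - Q) \<bullet> v) * ((p - Q) \<bullet> w)
      + 2 * a * ((p - Q) \<bullet> (p - Q)) powr (a - 1) * (v \<bullet> w))"
proof -
  let ?U = "\<lambda>q. c * ((q - Q) \<bullet> (q - Q)) powr a"
  let ?r = "(p - Q) \<bullet> (p - Q)"
  have D: "frechet_derivative (\<lambda>q. frechet_derivative ?U (at q) b) (at p) w =
     c * (4 * a * (a - 1) * ?r powr (a - 2) * ((p - Q) \<bullet> w) * ((p - Q) \<bullet> b) + 2 * a * ?r powr (a - 1) * (w \<bullet> b))" for b
  proof -
    have "((\<lambda>q. (c * 2 * a) * ((q - Q) \<bullet> (q - Q)) powr (a - 1)) has_derivative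
     (\<lambda>w. (c * 2 * a) * (2 * (a - 1) * ?r powr (a - 1 - 1) * ((p - Q) \<bullet> w)))) (at p)"
      by (rule powr_norm_derivative[OF p])
    moreover have "((\<lambda>q. (q - Q) \<bullet> b) has_derivative (\<lambda>w. w \<bullet> b)) (at p)"
      by (rule derivative_eq_intros refl)+ (simp add: fun_eq_iff)
    ultimately have "((\<lambda>q. (c * 2 * a) * ((q - Q) \<bullet> (q - Q)) powr (a - 1) * ((q - Q) \<bullet> b)) has_derivative
      (\<lambda>w. (c * 2 * a) * ?r powr (a - 1) * (w \<bullet> b) +
        (c * 2 * a) * (2 * (a - 1) * ?r powr (a - 1 - 1) * ((p - Q) \<bullet> w)) * ((p - Q) \<bullet> b))) (at p)"
      by (rule has_derivative_mult)
    then have "((\<lambda>q. frechet_derivative ?U (at q) b) has_derivative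
      (\<lambda>w. (c * 2 * a) * ?r powr (a - 1) * (w \<bullet> b) +
        (c * 2 * a) * (2 * (a - 1) * ?r powr (a - 1 - 1) * ((p - Q) \<bullet> w)) * ((p - Q) \<bullet> b))) (at p)"
      by (rule has_derivative_transform_within_open[of _ _ _ _ "- {Q}"])
         (use p in \<open>simp_all add: frechet_derivative_eqI[OF powr_norm_derivative] open_Compl\<close>)
    then show ?thesis by (simp add: frechet_derivative_eqI algebra_simps)
  qed
  have "ambient_hessian ?U p v w = (\<Sum>b\<in>Basis. (c * 4 * a * (a - 1) * ?r powr (a - 2) * ((p - Q) \<bullet> w)) * ((v \<bullet> b) * ((p - Q) \<bullet> b))
      + (c * 2 * a * ?r powr (a - 1)) * ((v \<bullet> b) * (w \<bullet> b)))"
    unfolding ambient_hessian_def D by (intro sum.cong refl) (simp add: algebra_simps)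
  also have "\<dots> = (c * 4 * a * (a - 1) * ?r powr (a - 2) * ((p - Q) \<bullet> w)) * (v \<bullet> (p - Q)) + (c * 2 * a * ?r powr (a - 1)) * (v \<bullet> w)"
    unfolding sum.distrib sum_distrib_left[symmetric] euclidean_inner[symmetric] ..
  finally show ?thesis by (simp add: algebra_simps inner_commute)
qed

context immersion
begin

text \<open>The mean curvature vector, normalized as the full trace and not divided by the
  dimension.\<close>

definition mean :: "real^'n \<Rightarrow> real^('n option)" where
  "mean x = (\<Sum>i\<in>UNIV. \<Sum>j\<in>UNIV. ginv x $ i $ j *\<^sub>R sff i j x)"

text \<open>The scalar curvature, in the extrinsic form given by
  \<open>gauss_equation\<close>.\<close>

definition scal :: "real^'n \<Rightarrow> real" where
  "scal x = (\<Sum>j\<in>UNIV. \<Sum>k\<in>UNIV. ginv x $ j $ k * (\<Sum>i\<in>UNIV. \<Sum>l\<in>UNIV. ginv x $ i $ l *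
      (sff l i x \<bullet> sff j k x - sff l j x \<bullet> sff i k x)))"

definition perp :: "real^'n \<Rightarrow> real^('n option) \<Rightarrow> real^('n option)" where
  "perp x Y = Y - (\<Sum>k\<in>UNIV. (dual k x \<bullet> Y) *\<^sub>R tangent k x)"

lemma smooth_mean [smooth_intros]: "smooth_on V mean"
  unfolding mean_def[abs_def] by (intro smooth_intros open_V)

lemma smooth_scal [smooth_intros]: "smooth_on V scal"
  unfolding scal_def[abs_def] by (intro smooth_intros open_V)

lemma sff_perp: "sff i j x = perp x (second i j x)"
  by (simp add: sff_def perp_def chr_def)

lemma linear_perp: "linear (perp x)"
  by (intro linearI) (simp_all add: perp_def inner_add_right scaleR_add_left sum.distrib scaleR_diff_right
      scaleR_sum_right)

lemma perp_tangent:
  assumes "x \<in> V"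
  shows "perp x (tangent j x) = 0"
  by (simp add: perp_def dual_tangent[OF assms] sum_delta_scaleR)

lemma tangent_perp:
  assumes "x \<in> V"
  shows "perp x Y \<bullet> tangent l x = 0"
proof -
  have "tangent l x \<bullet> Y = (\<Sum>k\<in>UNIV. (tangent l x \<bullet> tangent k x) *\<^sub>R dual k x) \<bullet> Y"
    by (simp add: tangent_dual[OF assms])
  also have "\<dots> = (\<Sum>k\<in>UNIV. (dual k x \<bullet> Y) * (tangent k x \<bullet> tangent l x))"
    by (simp only: inner_sum_left inner_scaleR_left mult.commute inner_commute[of "tangent l x"])
  finally show ?thesis
    by (simp add: perp_def inner_diff_left inner_sum_left inner_commute[of Y])
qed

lemma perp_inner_self:
  assumes "x \<in> V"
  shows "perp x Y \<bullet> perp x Y = Y \<bullet> Y - (\<Sum>i\<in>UNIV. \<Sum>j\<in>UNIV. ginv x $ i $ j * (Y \<bullet> tangent i x) * (Y \<bullet> tangent j x))"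
proof -
  have "perp x Y \<bullet> perp x Y = perp x Y \<bullet> Y"
    by (subst (2) perp_def) (simp add: inner_diff_right inner_sum_right tangent_perp[OF assms])
  also have "\<dots> = Y \<bullet> Y - (\<Sum>k\<in>UNIV. (dual k x \<bullet> Y) * (tangent k x \<bullet> Y))"
    by (simp add: perp_def inner_diff_left inner_sum_left)
  also have "(\<Sum>k\<in>UNIV. (dual k x \<bullet> Y) * (tangent k x \<bullet> Y))
    = (\<Sum>i\<in>UNIV. \<Sum>j\<in>UNIV. ginv x $ i $ j * (Y \<bullet> tangent i x) * (Y \<bullet> tangent j x))"
    by (simp add: dual_def inner_sum_left sum_distrib_left sum_distrib_right inner_commute[of Y "tangent i x" for i] mult_ac)
  finally show ?thesis .
qed

lemma mean_tangent: "x \<in> V \<Longrightarrow> mean x \<bullet> tangent j x = 0"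
  by (simp add: mean_def inner_sum_left sff_tangent)

lemma ginv_metric_trace:
  assumes "x \<in> V"
  shows "(\<Sum>i\<in>UNIV. \<Sum>j\<in>UNIV. ginv x $ i $ j * (tangent i x \<bullet> tangent j x)) = real CARD('n)"
proof -
  have "(\<Sum>j\<in>UNIV. ginv x $ i $ j * (tangent i x \<bullet> tangent j x)) = dual i x \<bullet> tangent i x" for i
    by (simp add: dual_def inner_sum_left) (simp add: inner_commute)
  then show ?thesis by (simp add: dual_tangent[OF assms])
qed

text \<open>With a = 1 - n/2 one has 4 a (a - 1) = n (n - 2) and 2 a n = - n (n - 2). The two terms
  of the ambient Hessian therefore combine to the squared normal part of X, and the positive factor
  c (n - 2) |X|^(-2-n) splits off from the whole equation.\<close>

lemma riesz_kernel_equation: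
  assumes x: "x \<in> V" and Q: "Q \<notin> \<psi> ` V" and n: "CARD('n) \<ge> 3" and c: "c > 0"
    and eq: "coord_conformal_laplacian (induced_metric \<psi>)
       (\<lambda>y. c * ((\<psi> y - Q) \<bullet> (\<psi> y - Q)) powr (1 - real CARD('n) / 2)) x = 0"
  shows "real CARD('n) * (perp x (\<psi> x - Q) \<bullet> perp x (\<psi> x - Q)) + ((\<psi> x - Q) \<bullet> (\<psi> x - Q)) * ((\<psi> x - Q) \<bullet> mean x)
    + scal x * ((\<psi> x - Q) \<bullet> (\<psi> x - Q))\<^sup>2 / (4 * (real CARD('n) - 1)) = 0"
proof -
  define n where "n = real CARD('n)"
  have n3: "n \<ge> 3" using n by (simp add: n_def)
  define a where "a = 1 - n / 2"
  define X where "X = \<psi> x - Q"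
  define \<rho> where "\<rho> = X \<bullet> X"
  define \<pi> where "\<pi> = \<rho> powr (a - 2)"
  \<comment> \<open>The squared length of the tangential part of \<open>X\<close>; thus
    \<open>\<rho> - \<tau>\<close> is the squared length of the normal part.\<close>
  define \<tau> where "\<tau> = (\<Sum>i\<in>UNIV. \<Sum>j\<in>UNIV. ginv x $ i $ j * (X \<bullet> tangent i x) * (X \<bullet> tangent j x))"
  have xQ: "\<psi> x \<noteq> Q" using Q x by blast
  have \<rho>: "\<rho> > 0" using xQ by (simp add: \<rho>_def X_def)
  have \<pi>: "\<pi> > 0" using \<rho> by (simp add: \<pi>_def)
  have p1: "\<rho> powr (a - 1) = \<rho> * \<pi>" "\<rho> powr a = \<rho>\<^sup>2 * \<pi>"
    using \<rho> by (simp_all add: \<pi>_def powr_diff powr_numeral power2_eq_square field_simps)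
  have VQ: "\<psi> ` V \<subseteq> - {Q}" using Q by auto
  have expand: "ginv x $ i $ j * (ambient_hessian (\<lambda>q. c * ((q - Q) \<bullet> (q - Q)) powr a) (\<psi> x) (tangent i x) (tangent j x)
      + frechet_derivative (\<lambda>q. c * ((q - Q) \<bullet> (q - Q)) powr a) (at (\<psi> x)) (sff i j x))
    = (c * 4 * a * (a - 1) * \<pi>) * (ginv x $ i $ j * (X \<bullet> tangent i x) * (X \<bullet> tangent j x))
     + (c * 2 * a * \<rho> * \<pi>) * (ginv x $ i $ j * (tangent i x \<bullet> tangent j x))
     + (c * 2 * a * \<rho> * \<pi>) * (ginv x $ i $ j * (X \<bullet> sff i j x))" for i j
    unfolding ambient_hessian_powr_norm[OF xQ] frechet_derivative_eqI[OF powr_norm_derivative[OF xQ]]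
      X_def[symmetric] \<rho>_def[symmetric] \<pi>_def[symmetric] p1 by (simp add: algebra_simps)
  have Xm: "(\<Sum>i\<in>UNIV. \<Sum>j\<in>UNIV. ginv x $ i $ j * (X \<bullet> sff i j x)) = X \<bullet> mean x"
    by (simp add: mean_def inner_sum_right)
  have "0 = - ((c * 4 * a * (a - 1) * \<pi>) * \<tau> + (c * 2 * a * \<rho> * \<pi>) * n + (c * 2 * a * \<rho> * \<pi>) * (X \<bullet> mean x))
     + (n - 2) / (4 * (n - 1)) * scal x * (c * (\<rho>\<^sup>2 * \<pi>))"
    using eq unfolding coord_conformal_laplacian_ambient[OF x open_Compl[OF closed_singleton] VQ smooth_powr_norm]
      n_def[symmetric] a_def[symmetric] expand scal_def[symmetric] sum.distrib sum_distrib_left[symmetric]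
      ginv_metric_trace[OF x] Xm \<tau>_def[symmetric] X_def[symmetric] \<rho>_def[symmetric] p1 by simp
  also have "\<dots> = (c * \<pi> * (n - 2)) * (n * (\<rho> - \<tau>) + \<rho> * (X \<bullet> mean x) + scal x * \<rho>\<^sup>2 / (4 * (n - 1)))"
    unfolding a_def by (simp add: algebra_simps power2_eq_square add_divide_distrib diff_divide_distrib)
  finally have "n * (\<rho> - \<tau>) + \<rho> * (X \<bullet> mean x) + scal x * \<rho>\<^sup>2 / (4 * (n - 1)) = 0"
    using c \<pi> n3 by simp
  then show ?thesis
    unfolding perp_inner_self[OF x] X_def[symmetric] \<rho>_def[symmetric] n_def[symmetric] \<tau>_def[symmetric] .
qed

text \<open>Along a ray issuing from the pole, \<open>X - t X' = - t\<^sup>2 X'' / 2 + o(t\<^sup>2)\<close>, and this vector has the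
  same normal part as \<open>X\<close>.\<close>

lemma second_order_remainder_along_ray:
  assumes x0: "x0 \<in> V"
  shows "((\<lambda>t. (1 / t\<^sup>2) *\<^sub>R (\<psi> (x0 + t *\<^sub>R \<xi>) - \<psi> x0 - t *\<^sub>R (\<Sum>i\<in>UNIV. \<xi> $ i *\<^sub>R tangent i (x0 + t *\<^sub>R \<xi>))))
     \<longlongrightarrow> (- 1 / 2) *\<^sub>R (\<Sum>i\<in>UNIV. \<Sum>j\<in>UNIV. (\<xi> $ i * \<xi> $ j) *\<^sub>R second i j x0)) (at_right 0)"
proof -
  define c where "c t = x0 + t *\<^sub>R \<xi>" for t
  define D where "D x = (\<Sum>i\<in>UNIV. \<xi> $ i *\<^sub>R tangent i x)" for x
  define S where "S x = (\<Sum>i\<in>UNIV. \<Sum>j\<in>UNIV. (\<xi> $ i * \<xi> $ j) *\<^sub>R second i j x)" for x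
  have c0: "c 0 = x0" by (simp add: c_def)
  have sD: "smooth_on V D" unfolding D_def by (intro smooth_intros open_V)
  have sS: "smooth_on V S" unfolding S_def by (intro smooth_intros open_V)
  have dD: "frechet_derivative D (at x) \<xi> = S x" if "x \<in> V" for x
  proof -
    have "(\<lambda>x. \<xi> $ i *\<^sub>R tangent i x) differentiable (at x)" for i
      by (intro differentiable[OF _ that] smooth_intros open_V)
    then have "pderivative j D x = (\<Sum>i\<in>UNIV. pderivative j (\<lambda>x. \<xi> $ i *\<^sub>R tangent i x) x)" for j
      unfolding D_def[abs_def] by (intro pderivative_sum)
    also have "\<dots> j = (\<Sum>i\<in>UNIV. \<xi> $ i *\<^sub>R second i j x)" for j
      using pderivative_linear[OF bounded_linear_scaleR_right differentiable[OF smooth_tangent that], of j]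
      by (simp add: second_def)
    finally have p: "pderivative j D x = (\<Sum>i\<in>UNIV. \<xi> $ i *\<^sub>R second i j x)" for j .
    show ?thesis
      unfolding frechet_derivative_eq_sum_pderivative[OF differentiable[OF sD that]] p S_def
      by (simp add: scaleR_sum_right second_sym[OF that] mult.commute)
  qed
  have d\<psi>: "((\<lambda>t. \<psi> (c t)) has_vector_derivative D (c t)) (at t)" if "c t \<in> V" for t
    unfolding c_def using DERIV_along_line[of \<psi> x0 t \<xi>] differentiable[OF smooth] tangent_combination that
    by (simp add: c_def D_def)
  have dDt: "((\<lambda>t. D (c t)) has_vector_derivative S (c t)) (at t)" if "c t \<in> V" for t
    unfolding c_def using DERIV_along_line[of D x0 t \<xi>] differentiable[OF sD] dD that
    by (simp add: c_def)
  define y where "y t = \<psi> (c t) - \<psi> x0 - t *\<^sub>R D (c t)" for t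
  \<comment> \<open>The two terms \<open>D (c t)\<close> cancel, so only the second derivative
    remains, with a factor that vanishes at \<open>t = 0\<close>.\<close>
  have dy: "(y has_vector_derivative (- t) *\<^sub>R S (c t)) (at t)" if "c t \<in> V" for t
  proof -
    have "(y has_vector_derivative D (c t) - 0 - (t *\<^sub>R S (c t) + 1 *\<^sub>R D (c t))) (at t)"
      unfolding y_def[abs_def]
      by (intro has_vector_derivative_diff has_vector_derivative_scaleR d\<psi> dDt that has_vector_derivative_const DERIV_ident)
    then show ?thesis by simp
  qed
  have "((\<lambda>t. (1 / t\<^sup>2) *\<^sub>R y t) \<longlongrightarrow> (- 1 / 2) *\<^sub>R S x0) (at_right 0)"
  proof (rule tendstoI)
    fix e :: real assume e: "e > 0"
    have "isCont (\<lambda>t. S (c t)) 0"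
    proof (rule isCont_o2[where f=c])
      show "isCont c 0" unfolding c_def by (intro continuous_intros)
      show "isCont S (c 0)" using smooth_on_continuous[OF sS] open_V x0 unfolding c0 by (simp add: continuous_on_eq_continuous_at)
    qed
    then obtain d1 where d1: "d1 > 0" "\<And>t. dist t 0 < d1 \<Longrightarrow> dist (S (c t)) (S (c 0)) < e"
      using e unfolding continuous_at_eps_delta by blast
    have "isCont c 0" unfolding c_def by (intro continuous_intros)
    moreover obtain r where r: "r > 0" "ball x0 r \<subseteq> V" using open_V x0 open_contains_ball by blast
    ultimately obtain d2 where d2: "d2 > 0" "\<And>t. dist t 0 < d2 \<Longrightarrow> dist (c t) (c 0) < r"
      unfolding continuous_at_eps_delta by blast
    have inV: "c t \<in> V" if "\<bar>t\<bar> < d2" for t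
      using d2(2)[of t] r(2) that c0 by (auto simp: dist_commute subset_iff)
    have "dist ((1 / t\<^sup>2) *\<^sub>R y t) ((- 1 / 2) *\<^sub>R S x0) < e" if t: "0 < t" "t < min d1 d2" for t
    proof -
      \<comment> \<open>The difference between \<open>y\<close> and its expected quadratic part. Its
        derivative is \<open>s\<close> times the deviation of \<open>S\<close> along the ray from
        \<open>S x0\<close>, hence of norm at most \<open>e * s\<close>.\<close>
      define g where "g s = y s + (s\<^sup>2 / 2) *\<^sub>R S x0" for s
      have dg: "(g has_vector_derivative (- s) *\<^sub>R S (c s) + s *\<^sub>R S x0) (at s)" if "\<bar>s\<bar> < d2" for s
      proof -
        have "((\<lambda>s. s\<^sup>2 / 2) has_real_derivative s) (at s)" by (auto intro!: derivative_eq_intros)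
        then have "((\<lambda>s. (s\<^sup>2 / 2) *\<^sub>R S x0) has_vector_derivative ((s\<^sup>2 / 2) *\<^sub>R 0 + s *\<^sub>R S x0)) (at s)"
          by (intro has_vector_derivative_scaleR has_vector_derivative_const)
        then show ?thesis
          unfolding g_def[abs_def] using has_vector_derivative_add[OF dy[OF inV[OF that]], of "\<lambda>s. (s\<^sup>2 / 2) *\<^sub>R S x0"] by simp
      qed
      have "norm (g t - g 0) \<le> e * t\<^sup>2 / 2 - e * 0\<^sup>2 / 2"
      proof (rule differentiable_bound_general[OF t(1), of g "\<lambda>s. e * s\<^sup>2 / 2" "\<lambda>s. (- s) *\<^sub>R S (c s) + s *\<^sub>R S x0" "\<lambda>s. e * s"])
        show "continuous_on {0..t} g"
          by (intro continuous_at_imp_continuous_on ballI has_vector_derivative_continuous[OF dg]) (use t in auto)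
        show "continuous_on {0..t} (\<lambda>s. e * s\<^sup>2 / 2)" by (intro continuous_intros) simp
        show "(g has_vector_derivative (- s) *\<^sub>R S (c s) + s *\<^sub>R S x0) (at s)" if "0 < s" "s < t" for s
          using that t by (intro dg) auto
        have "((\<lambda>s. e * s\<^sup>2 / 2) has_real_derivative e * s) (at s)" for s
          by (auto intro!: derivative_eq_intros)
        then show "((\<lambda>s. e * s\<^sup>2 / 2) has_vector_derivative e * s) (at s)" for s
          by (simp add: has_real_derivative_iff_has_vector_derivative)
        show "norm ((- s) *\<^sub>R S (c s) + s *\<^sub>R S x0) \<le> e * s" if "0 < s" "s < t" for s
        proof -
          have "(- s) *\<^sub>R S (c s) + s *\<^sub>R S x0 = (- s) *\<^sub>R (S (c s) - S x0)" by (simp add: scaleR_diff_right)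
          then have "norm ((- s) *\<^sub>R S (c s) + s *\<^sub>R S x0) = s * dist (S (c s)) (S (c 0))"
            using that c0 by (simp only: norm_scaleR dist_norm)
          also have "\<dots> \<le> s * e" using d1(2)[of s] that t by (intro mult_left_mono) auto
          finally show ?thesis by (simp add: mult.commute)
        qed
      qed
      moreover have "g 0 = 0" by (simp add: g_def y_def c0)
      ultimately have "norm (g t) \<le> e * t\<^sup>2 / 2" by simp
      moreover have "(1 / t\<^sup>2) *\<^sub>R y t - (- 1 / 2) *\<^sub>R S x0 = (1 / t\<^sup>2) *\<^sub>R g t"
        using t by (simp add: g_def scaleR_add_right)
      ultimately have "dist ((1 / t\<^sup>2) *\<^sub>R y t) ((- 1 / 2) *\<^sub>R S x0) \<le> e / 2"
        using t by (simp add: dist_norm field_simps)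
      then show ?thesis using e by linarith
    qed
    then show "\<forall>\<^sub>F t in at_right 0. dist ((1 / t\<^sup>2) *\<^sub>R y t) ((- 1 / 2) *\<^sub>R S x0) < e"
      unfolding eventually_at_right_field using d1(1) d2(1) by (intro exI[of _ "min d1 d2"]) auto
  qed
  then show ?thesis by (simp add: y_def c_def D_def S_def)
qed

text \<open>At parameter \<open>t\<close> on a ray from the pole every term has order t^4:
  \<open>perp\<close> and \<open>mean\<close> see only the normal part of X, which has order t^2,
  and |X|^2 has order t^2. Dividing by t^4 and letting \<open>t\<close> tend to 0 gives an algebraic
  condition on the second derivatives at the pole.\<close>

lemma riesz_kernel_equation_at_pole:
  fixes x0 \<xi> :: "real^'n"
  defines "D \<equiv> \<Sum>i\<in>UNIV. \<xi> $ i *\<^sub>R tangent i x0"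
    and "S \<equiv> \<Sum>i\<in>UNIV. \<Sum>j\<in>UNIV. (\<xi> $ i * \<xi> $ j) *\<^sub>R second i j x0"
  assumes x0: "x0 \<in> V" and \<xi>: "\<xi> \<noteq> 0"
    and eq: "\<And>x. x \<in> V - {x0} \<Longrightarrow> n * (perp x (\<psi> x - \<psi> x0) \<bullet> perp x (\<psi> x - \<psi> x0))
      + ((\<psi> x - \<psi> x0) \<bullet> (\<psi> x - \<psi> x0)) * ((\<psi> x - \<psi> x0) \<bullet> mean x)
      + scal x * ((\<psi> x - \<psi> x0) \<bullet> (\<psi> x - \<psi> x0))\<^sup>2 / m = 0"
  shows "n * (perp x0 S \<bullet> perp x0 S) / 4 - (D \<bullet> D) * (S \<bullet> mean x0) / 2 + scal x0 * (D \<bullet> D)\<^sup>2 / m = 0"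
proof -
  define c where "c t = x0 + t *\<^sub>R \<xi>" for t
  define X where "X t = \<psi> (c t) - \<psi> x0" for t
  define y where "y t = (1 / t\<^sup>2) *\<^sub>R (X t - t *\<^sub>R (\<Sum>i\<in>UNIV. \<xi> $ i *\<^sub>R tangent i (c t)))" for t
  define z where "z t = (1 / t) *\<^sub>R X t" for t
  have c0: "c 0 = x0" by (simp add: c_def)
  have ylim: "(y \<longlongrightarrow> (- 1 / 2) *\<^sub>R S) (at_right 0)"
    using second_order_remainder_along_ray[OF x0, of \<xi>] by (simp add: y_def[abs_def] X_def c_def S_def)
  have zlim: "(z \<longlongrightarrow> D) (at_right 0)"
  proof -
    have "((\<lambda>t. \<psi> (c t)) has_vector_derivative D) (at 0)"
      using DERIV_along_line[of \<psi> x0 0 \<xi>] differentiable[OF smooth x0] tangent_combination[OF x0]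
      by (simp add: c_def D_def)
    then have "((\<lambda>t. \<psi> (c t)) has_derivative (\<lambda>t. t *\<^sub>R D)) (at 0)"
      by (simp add: has_vector_derivative_def)
    then have "((\<lambda>h. norm (X h - h *\<^sub>R D) / norm h) \<longlongrightarrow> 0) (at 0)"
      unfolding has_derivative_at by (simp add: X_def c0)
    moreover have "\<forall>\<^sub>F h in at 0. norm (X h - h *\<^sub>R D) / norm h = norm (z h - D)"
      unfolding eventually_at_filter
    proof (intro always_eventually allI impI)
      fix h :: real assume "h \<noteq> 0"
      then have "z h - D = (1 / h) *\<^sub>R (X h - h *\<^sub>R D)" by (simp add: z_def scaleR_diff_right)
      then show "norm (X h - h *\<^sub>R D) / norm h = norm (z h - D)" by simp
    qed
    ultimately have "((\<lambda>h. norm (z h - D)) \<longlongrightarrow> 0) (at 0)"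
      by (rule Lim_transform_eventually)
    then have "(z \<longlongrightarrow> D) (at 0)" by (rule LIM_zero_cancel[OF tendsto_norm_zero_cancel])
    then show ?thesis by (simp add: filterlim_at_split)
  qed
  have clim: "((\<lambda>t. f (c t)) \<longlongrightarrow> f x0) (at_right 0)" if "smooth_on V f" for f :: "real^'n \<Rightarrow> 'b::real_normed_vector"
  proof -
    have "(c \<longlongrightarrow> c 0) (at_right 0)" unfolding c_def by (intro tendsto_intros)
    moreover have "isCont f x0" using smooth_on_continuous[OF that] open_V x0 continuous_on_eq_continuous_at by blast
    ultimately show ?thesis using isCont_tendsto_compose[of x0 f c] c0 by simp
  qed
  have "\<forall>\<^sub>F t in at_right 0. c t \<in> V"
  proof -
    have "(c \<longlongrightarrow> c 0) (at_right 0)" unfolding c_def by (intro tendsto_intros)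
    then show ?thesis using topological_tendstoD[OF _ open_V] x0 c0 by simp
  qed
  moreover have "\<forall>\<^sub>F t in at_right (0::real). t > 0" by (rule eventually_at_right_less)
  ultimately have ev: "\<forall>\<^sub>F t in at_right 0. n * (perp (c t) (y t) \<bullet> perp (c t) (y t)) + (z t \<bullet> z t) * (y t \<bullet> mean (c t))
      + scal (c t) * (z t \<bullet> z t)\<^sup>2 / m = 0"
  proof eventually_elim
    case (elim t)
    define Y where "Y = X t - t *\<^sub>R (\<Sum>i\<in>UNIV. \<xi> $ i *\<^sub>R tangent i (c t))"
    have "c t \<in> V - {x0}" using elim \<xi> by (simp add: c_def)
    from eq[OF this] have 1: "n * (perp (c t) (X t) \<bullet> perp (c t) (X t)) + (X t \<bullet> X t) * (X t \<bullet> mean (c t))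
      + scal (c t) * (X t \<bullet> X t)\<^sup>2 / m = 0" by (simp add: X_def)
    have 2: "perp (c t) (X t) = perp (c t) Y"
      unfolding Y_def linear_diff[OF linear_perp] linear_scale[OF linear_perp] linear_sum[OF linear_perp]
      by (simp add: perp_tangent[OF elim(1)])
    have 3: "X t \<bullet> mean (c t) = Y \<bullet> mean (c t)"
      unfolding Y_def inner_diff_left by (simp add: inner_commute[of _ "mean (c t)"] inner_sum_right mean_tangent[OF elim(1)])
    have Yy: "Y = t\<^sup>2 *\<^sub>R y t" and Xz: "X t = t *\<^sub>R z t" using elim(2) by (simp_all add: y_def Y_def z_def)
    have "t^4 * (n * (perp (c t) (y t) \<bullet> perp (c t) (y t)) + (z t \<bullet> z t) * (y t \<bullet> mean (c t))
      + scal (c t) * (z t \<bullet> z t)\<^sup>2 / m) = n * (perp (c t) (X t) \<bullet> perp (c t) (X t)) + (X t \<bullet> X t) * (X t \<bullet> mean (c t))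
      + scal (c t) * (X t \<bullet> X t)\<^sup>2 / m"
      unfolding 2 3 unfolding Yy unfolding Xz
      by (simp add: linear_scale[OF linear_perp] algebra_simps power2_eq_square power4_eq_xxxx)
    then show ?case using 1 elim(2) by simp
  qed
  have "((\<lambda>t. n * (perp (c t) (y t) \<bullet> perp (c t) (y t)) + (z t \<bullet> z t) * (y t \<bullet> mean (c t))
      + scal (c t) * (z t \<bullet> z t)\<^sup>2 / m) \<longlongrightarrow> n * (perp x0 ((- 1 / 2) *\<^sub>R S) \<bullet> perp x0 ((- 1 / 2) *\<^sub>R S)) + (D \<bullet> D) * (((- 1 / 2) *\<^sub>R S) \<bullet> mean x0)
      + scal x0 * (D \<bullet> D)\<^sup>2 / m) (at_right 0)"
    unfolding perp_def divide_inverse[of _ m]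
    by (intro tendsto_intros ylim zlim clim smooth_mean smooth_scal smooth_dual smooth_tangent)
  then have "((\<lambda>t. 0) \<longlongrightarrow> n * (perp x0 ((- 1 / 2) *\<^sub>R S) \<bullet> perp x0 ((- 1 / 2) *\<^sub>R S)) + (D \<bullet> D) * (((- 1 / 2) *\<^sub>R S) \<bullet> mean x0)
      + scal x0 * (D \<bullet> D)\<^sup>2 / m) (at_right (0::real))"
    using ev by (rule Lim_transform_eventually)
  then have "n * (perp x0 ((- 1 / 2) *\<^sub>R S) \<bullet> perp x0 ((- 1 / 2) *\<^sub>R S)) + (D \<bullet> D) * (((- 1 / 2) *\<^sub>R S) \<bullet> mean x0)
      + scal x0 * (D \<bullet> D)\<^sup>2 / m = 0"
    by (simp add: tendsto_const_iff)
  then show ?thesis unfolding linear_scale[OF linear_perp] by simp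
qed

end

section \<open>Linear algebra\<close>

text \<open>The principal 2 by 2 minors are positive, so the square of each entry is at most the
  product of two diagonal entries. Summation gives the square of the trace, strictly because there
  is at least one off-diagonal entry.\<close>

lemma trace_square_of_positive_definite:
  fixes c :: "'n::finite \<Rightarrow> 'n \<Rightarrow> real"
  assumes sym: "\<And>i j. c i j = c j i" and n: "CARD('n) \<ge> 2"
    and pos: "\<And>\<xi>::real^'n. \<xi> \<noteq> 0 \<Longrightarrow> (\<Sum>i\<in>UNIV. \<Sum>j\<in>UNIV. \<xi> $ i * \<xi> $ j * c i j) > 0"
  shows "(\<Sum>i\<in>UNIV. \<Sum>j\<in>UNIV. (c i j)\<^sup>2) < (\<Sum>i\<in>UNIV. c i i)\<^sup>2"
proof -
  have form: "(\<Sum>k\<in>UNIV. \<Sum>l\<in>UNIV. (\<chi> k. if k = i then \<alpha> else if k = j then \<beta> else 0) $ k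
      * (\<chi> k. if k = i then \<alpha> else if k = j then \<beta> else 0) $ l * c k l)
    = \<alpha>\<^sup>2 * c i i + 2 * \<alpha> * \<beta> * c i j + \<beta>\<^sup>2 * c j j" if "i \<noteq> j" for i j \<alpha> \<beta>
  proof -
    have s: "(\<Sum>k\<in>UNIV. (if k = i then \<alpha> else if k = j then \<beta> else 0) * f k) = \<alpha> * f i + \<beta> * f j" for f :: "'n \<Rightarrow> real"
    proof -
      have "(if k = i then \<alpha> else if k = j then \<beta> else 0) * f k = (if k = i then 1 else 0) * (\<alpha> * f k) + (if k = j then 1 else 0) * (\<beta> * f k)" for k
        using that by auto
      then show ?thesis by (simp add: sum.distrib sum_delta_mult)
    qed
    have "(\<Sum>k\<in>UNIV. \<Sum>l\<in>UNIV. (\<chi> k. if k = i then \<alpha> else if k = j then \<beta> else 0) $ k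
      * (\<chi> k. if k = i then \<alpha> else if k = j then \<beta> else 0) $ l * c k l)
      = (\<Sum>k\<in>UNIV. (if k = i then \<alpha> else if k = j then \<beta> else 0) *
          (\<Sum>l\<in>UNIV. (if l = i then \<alpha> else if l = j then \<beta> else 0) * c k l))"
      by (simp only: vec_lambda_beta sum_distrib_left mult.assoc)
    also have "\<dots> = \<alpha> * (\<alpha> * c i i + \<beta> * c i j) + \<beta> * (\<alpha> * c j i + \<beta> * c j j)"
      by (simp only: s)
    finally show ?thesis
      using sym[of j i] by (simp add: power2_eq_square algebra_simps)
  qed
  have diag: "c i i > 0" for i
  proof -
    have "axis i 1 \<noteq> (0::real^'n)" by (simp add: axis_eq_0_iff)
    from pos[OF this] show ?thesis
      by (simp add: axis_def mult.assoc sum_distrib_left[symmetric] sum_delta_mult)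
  qed
  have off: "(c i j)\<^sup>2 < c i i * c j j" if "i \<noteq> j" for i j
  proof -
    \<comment> \<open>At this vector the form takes the value \<open>c j j\<close> times the
      minor.\<close>
    define \<xi> :: "real^'n" where "\<xi> = (\<chi> k. if k = i then c j j else if k = j then - c i j else 0)"
    have "\<xi> $ i \<noteq> 0" using diag[of j] by (simp add: \<xi>_def)
    then have "\<xi> \<noteq> 0" by auto
    from pos[OF this] have "(c j j)\<^sup>2 * c i i + 2 * c j j * (- c i j) * c i j + (- c i j)\<^sup>2 * c j j > 0"
      unfolding \<xi>_def form[OF that] .
    then have "c j j * (c i i * c j j - (c i j)\<^sup>2) > 0" by (simp add: power2_eq_square algebra_simps)
    then show ?thesis using diag[of j] by (simp add: zero_less_mult_iff)
  qed
  have le: "(c i j)\<^sup>2 \<le> c i i * c j j" for i j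
    using off[of i j] by (cases "i = j") (auto simp: power2_eq_square)
  obtain i0 j0 :: 'n where ij: "i0 \<noteq> j0"
  proof -
    have "\<not> card (UNIV :: 'n set) \<le> Suc 0" using n by simp
    then show ?thesis using that unfolding card_le_Suc0_iff_eq[OF finite] by blast
  qed
  have "(\<Sum>i\<in>UNIV. \<Sum>j\<in>UNIV. (c i j)\<^sup>2) < (\<Sum>i\<in>UNIV. \<Sum>j\<in>UNIV. c i i * c j j)"
  proof (rule sum_strict_mono_ex1)
    show "\<forall>i\<in>UNIV. (\<Sum>j\<in>UNIV. (c i j)\<^sup>2) \<le> (\<Sum>j\<in>UNIV. c i i * c j j)" by (simp add: sum_mono le)
    have "(\<Sum>j\<in>UNIV. (c i0 j)\<^sup>2) < (\<Sum>j\<in>UNIV. c i0 i0 * c j j)"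
      by (rule sum_strict_mono_ex1) (use le off[OF ij] in auto)
    then show "\<exists>i\<in>UNIV. (\<Sum>j\<in>UNIV. (c i j)\<^sup>2) < (\<Sum>j\<in>UNIV. c i i * c j j)" by blast
  qed simp
  then show ?thesis by (simp add: power2_eq_square sum_product)
qed

section \<open>Orthonormal frames and adapted parametrizations\<close>

lemma orthonormal_frame_normal:
  fixes E :: "'n::finite \<Rightarrow> real^('n option)"
  assumes E: "\<And>i j. E i \<bullet> E j = (if i = j then 1 else 0)"
  obtains \<nu> where "\<nu> \<bullet> \<nu> = 1" "\<And>i. \<nu> \<bullet> E i = 0" "\<And>Y. Y = (\<Sum>i\<in>UNIV. (Y \<bullet> E i) *\<^sub>R E i) + (Y \<bullet> \<nu>) *\<^sub>R \<nu>"
proof -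
  have inj: "inj E"
  proof (rule injI)
    fix i j assume "E i = E j"
    then have "E i \<bullet> E j = 1" using E[of j j] by simp
    then show "i = j" using E[of i j] by (simp split: if_splits)
  qed
  have cardE: "card (range E) = CARD('n)" by (simp add: card_image inj)
  have "dim (range E) < DIM(real^('n option))"
    using dim_le_card'[of "range E"] cardE by simp
  from orthogonal_to_subspace_exists[OF this]
  obtain y where y: "y \<noteq> 0" "\<And>z. z \<in> span (range E) \<Longrightarrow> orthogonal y z" by metis
  define \<nu> where "\<nu> = y /\<^sub>R norm y"
  have \<nu>1: "\<nu> \<bullet> \<nu> = 1" using y(1) by (simp add: \<nu>_def power2_norm_eq_inner[symmetric] power2_eq_square field_simps dot_square_norm)
  have \<nu>E: "\<nu> \<bullet> E i = 0" for i
    using y(2)[of "E i"] by (simp add: \<nu>_def orthogonal_def span_base)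
  let ?B = "insert \<nu> (range E)"
  have nin: "\<nu> \<notin> range E"
  proof
    assume "\<nu> \<in> range E"
    then obtain i where "\<nu> = E i" by blast
    then show False using \<nu>E[of i] \<nu>1 by simp
  qed
  have "pairwise orthogonal ?B"
    using E \<nu>E by (auto simp: pairwise_def orthogonal_def inner_commute)
  moreover have "0 \<notin> ?B"
  proof
    assume "0 \<in> ?B"
    then consider "\<nu> = 0" | i where "E i = 0" by auto
    then show False
    proof cases
      case 1
      then show False using \<nu>1 by simp
    next
      case (2 i)
      then show False using E[of i i] by simp
    qed
  qed
  ultimately have ind: "independent ?B" by (rule pairwise_orthogonal_independent)
  have "dim ?B = card ?B" by (rule dim_eq_card_independent[OF ind])
  also have "\<dots> = DIM(real^('n option))" using nin cardE by simp
  finally have span: "span ?B = UNIV" by (rule iffD1[OF dim_eq_full])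
  have "Y = (\<Sum>i\<in>UNIV. (Y \<bullet> E i) *\<^sub>R E i) + (Y \<bullet> \<nu>) *\<^sub>R \<nu>" for Y
  proof -
    define R where "R = Y - ((\<Sum>i\<in>UNIV. (Y \<bullet> E i) *\<^sub>R E i) + (Y \<bullet> \<nu>) *\<^sub>R \<nu>)"
    have "R \<bullet> E j = 0" for j
      by (simp add: R_def inner_diff_left inner_add_left inner_sum_left E \<nu>E sum_delta_mult)
    moreover have "R \<bullet> \<nu> = 0"
      using \<nu>E by (simp add: R_def inner_diff_left inner_add_left inner_sum_left \<nu>1 inner_commute[of "E i" \<nu> for i])
    ultimately have "orthogonal R R"
      by (intro orthogonal_to_span[of R ?B]) (auto simp: span orthogonal_def)
    then show ?thesis by (simp add: R_def orthogonal_def)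
  qed
  with \<nu>1 \<nu>E show ?thesis by (rule that)
qed

text \<open>\<open>L\<close> is a linear isometry of the domain onto the range of \<open>D\<close>,
  followed by the inverse of \<open>D\<close>.\<close>

lemma isometric_reparametrization_exists:
  fixes D :: "real^'n \<Rightarrow> 'b::euclidean_space"
  assumes "linear D" "inj D"
  obtains L L' :: "real^'n \<Rightarrow> real^'n" where "linear L" "linear L'" "\<And>v. L' (L v) = v" "\<And>v. L (L' v) = v"
    "\<And>v w. D (L v) \<bullet> D (L w) = v \<bullet> w"
proof -
  have "dim (UNIV :: (real^'n) set) = dim (range D)"
    using dim_image_eq[OF assms(1), of UNIV] assms(2) by (simp add: inj_on_subset)
  then obtain f g where f: "linear f" "f ` (UNIV :: (real^'n) set) = range D" "\<And>x. x \<in> UNIV \<Longrightarrow> norm (f x) = norm x"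
    by (rule isometries_subspaces[OF subspace_UNIV linear_subspace_image[OF assms(1) subspace_UNIV]]) metis
  obtain D' where D': "linear D'" "D' \<circ> D = id" using linear_injective_left_inverse[OF assms] by blast
  define L where "L v = D' (f v)" for v
  have linL: "linear L" unfolding L_def using linear_compose[OF f(1) D'(1)] by (simp add: o_def)
  have DL: "D (L v) = f v" for v
  proof -
    have "f v \<in> range D" using f(2) by blast
    then obtain u where "f v = D u" by blast
    then show ?thesis using D'(2) by (metis L_def comp_apply id_apply)
  qed
  have "inj L"
  proof (rule injI)
    fix v w assume "L v = L w"
    then have "f v = f w" using DL by metis
    then have "norm (v - w) = 0" using f(3)[of "v - w"] linear_diff[OF f(1)] by simp
    then show "v = w" by simp
  qed
  from linear_injective_isomorphism[OF linL this]
  obtain L' where L': "linear L'" "\<forall>x. L' (L x) = x" "\<forall>x. L (L' x) = x" by blast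
  have "f v \<bullet> f w = v \<bullet> w" for v w
    using f(3)[of "v + w"] f(3)[of v] f(3)[of w] linear_add[OF f(1)] by (simp add: dot_norm)
  then have "D (L v) \<bullet> D (L w) = v \<bullet> w" for v w by (simp add: DL)
  with L' show ?thesis by (intro that[OF linL]) auto
qed

text \<open>A linear change of coordinates makes the metric the identity at one chosen point. This
  spares the computations with curvature at that point all index raising.\<close>

lemma orthonormal_parametrization:
  fixes M :: "(real^('n::finite option)) set"
  assumes lp: "local_parametrization M V \<psi>" and x0: "x0 \<in> V"
  obtains W \<phi> y0 where "local_parametrization M W \<phi>" "y0 \<in> W" "\<phi> y0 = \<psi> x0" "\<phi> ` W = \<psi> ` V"
    "\<And>i j. pderivative i \<phi> y0 \<bullet> pderivative j \<phi> y0 = (if i = j then 1 else 0)"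
proof -
  interpret immersion V \<psi> using lp by (rule local_parametrization_immersion)
  define D where "D x = frechet_derivative \<psi> (at x)" for x
  have linD: "linear (D x)" if "x \<in> V" for x
    unfolding D_def by (intro linear_frechet_derivative differentiable[OF smooth that])
  obtain L L' :: "real^'n \<Rightarrow> real^'n" where L: "linear L" "linear L'" "\<And>v. L' (L v) = v" "\<And>v. L (L' v) = v"
    "\<And>v w. D x0 (L v) \<bullet> D x0 (L w) = v \<bullet> w"
    by (rule isometric_reparametrization_exists[OF linD[OF x0] inj[OF x0, folded D_def]]) blast
  define \<phi> where "\<phi> y = \<psi> (L y)" for y
  define W where "W = L -` V"
  have bL: "bounded_linear L" "bounded_linear L'" using L(1,2) by (simp_all add: linear_conv_bounded_linear)
  have contL: "continuous_on S L" "continuous_on T L'" for S T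
    using bL by (simp_all add: linear_continuous_on)
  have W: "open W" unfolding W_def using open_vimage[OF open_V contL(1)] .
  have LW: "L ` W = V"
  proof
    show "V \<subseteq> L ` W"
    proof
      show "v \<in> L ` W" if "v \<in> V" for v
        by (rule image_eqI[of _ _ "L' v"]) (simp_all add: W_def L(4) that)
    qed
  qed (auto simp: W_def)
  have img: "\<phi> ` W = \<psi> ` V" unfolding LW[symmetric] by (simp add: \<phi>_def[abs_def] image_image)
  have d: "(\<phi> has_derivative (\<lambda>v. D (L y) (L v))) (at y)" if "y \<in> W" for y
  proof -
    have "(\<psi> has_derivative D (L y)) (at (L y))"
      using differentiable[OF smooth, of "L y"] that by (simp add: W_def D_def frechet_derivative_works)
    then show ?thesis unfolding \<phi>_def
      by (rule has_derivative_compose[OF bounded_linear_imp_has_derivative[OF bL(1)]])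
  qed
  have lpW: "local_parametrization M W \<phi>"
    unfolding local_parametrization_def
  proof (intro conjI)
    show "smooth_on W \<phi>"
      unfolding \<phi>_def[abs_def]
      by (rule smooth_on_compose[OF W open_V smooth smooth_on_linear[OF bL(1) W smooth_on_ident]]) (use LW in simp)
    show "\<forall>y\<in>W. inj (frechet_derivative \<phi> (at y))"
    proof
      fix y assume y: "y \<in> W"
      have "inj (D (L y))" unfolding D_def using y by (intro inj) (simp add: W_def)
      moreover have "inj L" using L(3) by (metis injI)
      ultimately have "inj (\<lambda>v. D (L y) (L v))" by (simp add: inj_def)
      then show "inj (frechet_derivative \<phi> (at y))" by (simp add: frechet_derivative_eqI[OF d[OF y]])
    qed
    obtain \<psi>' where hom: "homeomorphism V (\<psi> ` V) \<psi> \<psi>'" using lp unfolding local_parametrization_def by blast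
    have "homeomorphism W (\<phi> ` W) \<phi> (\<lambda>p. L' (\<psi>' p))"
      unfolding img
    proof (rule homeomorphismI)
      show "continuous_on W \<phi>"
        unfolding \<phi>_def by (rule continuous_on_compose2[OF homeomorphism_cont1[OF hom] contL(1)]) (simp add: LW)
      show "continuous_on (\<psi> ` V) (\<lambda>p. L' (\<psi>' p))"
        by (rule continuous_on_compose2[OF contL(2) homeomorphism_cont2[OF hom] subset_UNIV])
      show "\<phi> ` W \<subseteq> \<psi> ` V" using img by blast
      show "(\<lambda>p. L' (\<psi>' p)) ` (\<psi> ` V) \<subseteq> W" using homeomorphism_image2[OF hom] L(4) by (auto simp: W_def)
      show "L' (\<psi>' (\<phi> y)) = y" if "y \<in> W" for y
        using that homeomorphism_apply1[OF hom, of "L y"] L(3) by (simp add: \<phi>_def W_def)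
      show "\<phi> (L' (\<psi>' p)) = p" if "p \<in> \<psi> ` V" for p
        using that homeomorphism_apply2[OF hom, of p] L(4) by (simp add: \<phi>_def)
    qed
    then show "\<exists>\<phi>'. homeomorphism W (\<phi> ` W) \<phi> \<phi>'" by blast
    show "openin (top_of_set M) (\<phi> ` W)" unfolding img using lp by (simp add: local_parametrization_def)
  qed (rule W)
  have y0: "L' x0 \<in> W" "\<phi> (L' x0) = \<psi> x0" using x0 L(4) by (simp_all add: W_def \<phi>_def)
  have "pderivative i \<phi> (L' x0) \<bullet> pderivative j \<phi> (L' x0) = (if i = j then 1 else 0)" for i j
    using L(5)[of "axis i 1" "axis j 1"] L(4)
    by (simp add: pderivative_eqI[OF d[OF y0(1)]] inner_axis_axis)
  then show ?thesis by (rule that[OF lpW y0 img])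
qed

lemma local_parametrization_restrict:
  assumes lp: "local_parametrization M V \<psi>" and W: "open W" "W \<subseteq> V"
  shows "local_parametrization M W \<psi>"
proof -
  obtain \<psi>' where hom: "homeomorphism V (\<psi> ` V) \<psi> \<psi>'" using lp unfolding local_parametrization_def by blast
  have "open V" using lp by (simp add: local_parametrization_def)
  then have "openin (top_of_set V) W" using W by (simp add: openin_open_eq)
  then have "openin (top_of_set (\<psi> ` V)) (\<psi> ` W)" by (rule homeomorphism_imp_open_map[OF hom])
  moreover have "openin (top_of_set M) (\<psi> ` V)" using lp by (simp add: local_parametrization_def)
  ultimately have "openin (top_of_set M) (\<psi> ` W)" by (rule openin_trans)
  moreover have "homeomorphism W (\<psi> ` W) \<psi> \<psi>'" by (rule homeomorphism_of_subsets[OF hom W(2) subset_refl refl])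
  moreover have "smooth_on W \<psi>" using lp smooth_on_subset[of V \<psi> W] W(2) by (simp add: local_parametrization_def)
  moreover have "\<forall>x\<in>W. inj (frechet_derivative \<psi> (at x))"
    using lp W(2) by (auto simp: local_parametrization_def)
  ultimately show ?thesis using W(1) unfolding local_parametrization_def by blast
qed

section \<open>Local extrema and flat points\<close>

text \<open>If the second derivative along \<open>\<xi>\<close> were negative, the first derivative,
  which is zero at \<open>x0\<close>, would be negative just beyond it, and the mean value theorem
  would produce a smaller value.\<close>

lemma local_minimum_derivatives:
  fixes f :: "real^'n \<Rightarrow> real"
  assumes V: "open V" "x0 \<in> V" and f: "smooth_on V f" and min: "\<And>x. x \<in> V \<Longrightarrow> f x0 \<le> f x"
  shows "pderivative i f x0 = 0"
    "(\<Sum>i\<in>UNIV. \<Sum>j\<in>UNIV. \<xi> $ i * \<xi> $ j * pderivative j (pderivative i f) x0) \<ge> 0"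
proof -
  have Df: "f differentiable (at x)" if "x \<in> V" for x using f that by (rule smooth_on_differentiable)
  have "frechet_derivative f (at x0) = (\<lambda>v. 0)"
    by (rule differential_zero_maxmin[OF V(2,1)]) (use Df[OF V(2)] min in \<open>auto simp: frechet_derivative_works\<close>)
  then show p0: "pderivative i f x0 = 0" for i by (simp add: pderivative_def)
  define \<phi> where "\<phi> t = f (x0 + t *\<^sub>R \<xi>)" for t
  define F where "F x = (\<Sum>i\<in>UNIV. \<xi> $ i * pderivative i f x)" for x
  have sF: "smooth_on V F" unfolding F_def by (intro smooth_intros V f)
  have dF: "frechet_derivative F (at x0) \<xi> = (\<Sum>i\<in>UNIV. \<Sum>j\<in>UNIV. \<xi> $ i * \<xi> $ j * pderivative j (pderivative i f) x0)"
  proof -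
    have "(\<lambda>x. \<xi> $ i * pderivative i f x) differentiable (at x0)" "pderivative i f differentiable (at x0)" for i
      by (intro smooth_on_differentiable[OF _ V(2)] smooth_intros V f)+
    then have "pderivative j F x0 = (\<Sum>i\<in>UNIV. \<xi> $ i * pderivative j (pderivative i f) x0)" for j
      unfolding F_def[abs_def] by (simp add: pderivative_sum pderivative_linear[OF bounded_linear_mult_right])
    then have "frechet_derivative F (at x0) \<xi> = (\<Sum>j\<in>UNIV. \<Sum>i\<in>UNIV. \<xi> $ i * \<xi> $ j * pderivative j (pderivative i f) x0)"
      by (simp add: frechet_derivative_eq_sum_pderivative[OF smooth_on_differentiable[OF sF V(2)]] sum_distrib_left mult_ac)
    then show ?thesis by (simp only:) (rule sum.swap)
  qed
  show "(\<Sum>i\<in>UNIV. \<Sum>j\<in>UNIV. \<xi> $ i * \<xi> $ j * pderivative j (pderivative i f) x0) \<ge> 0"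
  proof (rule ccontr)
    assume neg: "\<not> ?thesis"
    have "isCont (\<lambda>t. x0 + t *\<^sub>R \<xi>) 0" by (intro continuous_intros)
    moreover obtain r where r: "r > 0" "ball x0 r \<subseteq> V" using V open_contains_ball by blast
    ultimately obtain d where d: "d > 0" "\<And>t. dist t 0 < d \<Longrightarrow> dist (x0 + t *\<^sub>R \<xi>) (x0 + 0 *\<^sub>R \<xi>) < r"
      unfolding continuous_at_eps_delta by blast
    have inV: "x0 + t *\<^sub>R \<xi> \<in> V" if "\<bar>t\<bar> < d" for t
      using d(2)[of t] r(2) that by (auto simp: dist_commute subset_iff)
    have d\<phi>: "(\<phi> has_real_derivative F (x0 + t *\<^sub>R \<xi>)) (at t)" if "\<bar>t\<bar> < d" for t
      unfolding \<phi>_def[abs_def] F_def has_real_derivative_iff_has_vector_derivative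
      using DERIV_along_line[OF Df[OF inV[OF that]]]
      by (simp add: frechet_derivative_eq_sum_pderivative[OF Df[OF inV[OF that]]])
    have "((\<lambda>t. F (x0 + t *\<^sub>R \<xi>)) has_real_derivative (\<Sum>i\<in>UNIV. \<Sum>j\<in>UNIV. \<xi> $ i * \<xi> $ j * pderivative j (pderivative i f) x0)) (at 0)"
      unfolding has_real_derivative_iff_has_vector_derivative
      using DERIV_along_line[of F x0 0 \<xi>] smooth_on_differentiable[OF sF V(2)] dF by simp
    from DERIV_neg_dec_right[OF this] neg obtain d' where d': "d' > 0"
      "\<And>h. 0 < h \<Longrightarrow> h < d' \<Longrightarrow> F (x0 + 0 *\<^sub>R \<xi>) > F (x0 + (0 + h) *\<^sub>R \<xi>)" by auto
    define h where "h = min d d' / 2"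
    have h: "0 < h" "h < d" "h < d'" using d(1) d'(1) by (auto simp: h_def)
    have d\<phi>': "(\<phi> has_real_derivative F (x0 + t *\<^sub>R \<xi>)) (at t)" if "0 \<le> t" "t \<le> h" for t
      using that h by (intro d\<phi>) simp
    obtain t where t: "0 < t" "t < h" "\<phi> h - \<phi> 0 = (h - 0) * F (x0 + t *\<^sub>R \<xi>)"
      using MVT2[OF h(1) d\<phi>'] by metis
    have "F (x0 + t *\<^sub>R \<xi>) < 0" using d'(2)[of t] t h by (simp add: F_def p0)
    then have "h * F (x0 + t *\<^sub>R \<xi>) < 0" using h(1) by (simp add: mult_pos_neg)
    then have "\<phi> h < \<phi> 0" using t(3) by simp
    moreover have "\<phi> 0 \<le> \<phi> h" using min[OF inV[of h]] h by (simp add: \<phi>_def)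
    ultimately show False by simp
  qed
qed

lemma flat_point_bound:
  fixes f :: "real^'n \<Rightarrow> real"
  assumes V: "open V" "x0 \<in> V" and f: "smooth_on V f" and f0: "f x0 = 0"
    and f1: "\<And>i. pderivative i f x0 = 0" and f2: "\<And>i j. pderivative j (pderivative i f) x0 = 0"
    and e: "e > 0"
  shows "\<exists>d>0. \<forall>x. norm (x - x0) < d \<longrightarrow> x \<in> V \<and> \<bar>f x\<bar> \<le> e * (norm (x - x0))\<^sup>2"
proof -
  \<comment> \<open>The bound on each partial derivative is divided by the dimension, because the
    norm of the whole derivative is estimated by their sum.\<close>
  define \<eta> where "\<eta> = e / real CARD('n)"
  have \<eta>: "\<eta> > 0" using e by (simp add: \<eta>_def)
  have "\<exists>d>0. \<forall>x. norm (x - x0) < d \<longrightarrow> \<bar>pderivative i f x\<bar> \<le> \<eta> * norm (x - x0)" for i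
  proof -
    have "pderivative i f differentiable (at x0)"
      by (intro smooth_on_differentiable[OF _ V(2)] smooth_intros f)
    from has_derivative_pderivative[OF this] have "(pderivative i f has_derivative (\<lambda>v. 0)) (at x0)"
      by (simp add: f2)
    then have "\<forall>e>0. \<exists>d>0. \<forall>y. norm (y - x0) < d \<longrightarrow> norm (pderivative i f y - pderivative i f x0 - 0) \<le> e * norm (y - x0)"
      unfolding has_derivative_at_alt by blast
    from this[rule_format, OF \<eta>] show ?thesis by (simp only: f1 diff_zero real_norm_def)
  qed
  then have "\<forall>i. \<exists>d>0. \<forall>x. norm (x - x0) < d \<longrightarrow> \<bar>pderivative i f x\<bar> \<le> \<eta> * norm (x - x0)" by blast
  from choice[OF this] obtain d where d: "\<And>i. d i > 0" "\<And>i x. norm (x - x0) < d i \<Longrightarrow> \<bar>pderivative i f x\<bar> \<le> \<eta> * norm (x - x0)"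
    by blast
  obtain r where r: "r > 0" "ball x0 r \<subseteq> V" using V open_contains_ball by blast
  define \<delta> where "\<delta> = min r (Min (range d))"
  have Md: "Min (range d) > 0" "Min (range d) \<le> d i" for i using d(1) by simp_all
  have \<delta>: "\<delta> > 0" "\<delta> \<le> r" "\<delta> \<le> d i" for i
    using Md r(1) unfolding \<delta>_def by (simp, simp, meson min.coboundedI2)
  have inV: "x \<in> V" if "norm (x - x0) < \<delta>" for x
    using that \<delta>(2) r(2) by (auto simp: dist_norm norm_minus_commute subset_iff)
  have "\<bar>f x\<bar> \<le> e * (norm (x - x0))\<^sup>2" if x: "norm (x - x0) < \<delta>" for x
  proof -
    define \<rho> where "\<rho> = norm (x - x0)"
    have "norm (f x - f x0) \<le> (e * \<rho>) * norm (x - x0)"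
    proof (rule differentiable_bound[OF convex_cball[of x0 \<rho>]])
      show "(f has_derivative (\<lambda>v. \<Sum>i\<in>UNIV. v $ i *\<^sub>R pderivative i f z)) (at z within cball x0 \<rho>)" if "z \<in> cball x0 \<rho>" for z
      proof -
        have "z \<in> V" using that x by (intro inV) (simp add: \<rho>_def dist_norm norm_minus_commute)
        then show ?thesis by (rule has_derivative_at_withinI[OF has_derivative_pderivative[OF smooth_on_differentiable[OF f]]])
      qed
      show "onorm (\<lambda>v. \<Sum>i\<in>UNIV. v $ i *\<^sub>R pderivative i f z) \<le> e * \<rho>" if "z \<in> cball x0 \<rho>" for z
      proof (rule onorm_le)
        fix v :: "real^'n"
        have z: "norm (z - x0) \<le> \<rho>" using that by (simp add: dist_norm norm_minus_commute)
        have p: "\<bar>pderivative i f z\<bar> \<le> \<eta> * \<rho>" for i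
        proof -
          have "\<bar>pderivative i f z\<bar> \<le> \<eta> * norm (z - x0)"
            using z x \<delta>(3)[of i] by (intro d(2)) (simp add: \<rho>_def)
          also have "\<dots> \<le> \<eta> * \<rho>" using z \<eta> by (intro mult_left_mono) auto
          finally show ?thesis .
        qed
        have "norm (\<Sum>i\<in>UNIV. v $ i *\<^sub>R pderivative i f z) \<le> (\<Sum>i\<in>(UNIV::'n set). norm v * (\<eta> * \<rho>))"
        proof (rule sum_norm_le)
          show "norm (v $ i *\<^sub>R pderivative i f z) \<le> norm v * (\<eta> * \<rho>)" for i
            unfolding real_scaleR_def real_norm_def abs_mult
            by (intro mult_mono component_le_norm_cart p) simp_all
        qed
        also have "\<dots> = e * \<rho> * norm v" by (simp add: \<eta>_def)
        finally show "norm (\<Sum>i\<in>UNIV. v $ i *\<^sub>R pderivative i f z) \<le> e * \<rho> * norm v" .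
      qed
      show "x \<in> cball x0 \<rho>" "x0 \<in> cball x0 \<rho>" by (simp_all add: \<rho>_def dist_norm norm_minus_commute)
    qed
    then show ?thesis by (simp add: f0 \<rho>_def power2_eq_square)
  qed
  then show ?thesis using \<delta>(1) inV by blast
qed

section \<open>The conformally covariant form of the equation\<close>

context immersion
begin

text \<open>What \<open>riesz_kernel_equation\<close> leaves of the equation for the kernel with
  pole \<open>Q\<close>. Outside the locale it is \<open>immersion.pole_equation\<close>, which
  allows the equation to be stated for all charts that avoid \<open>Q\<close> at once.\<close>

definition pole_equation :: "real^('n option) \<Rightarrow> real^'n \<Rightarrow> bool" where
  "pole_equation Q x \<longleftrightarrow> real CARD('n) * (perp x (\<psi> x - Q) \<bullet> perp x (\<psi> x - Q))
    + ((\<psi> x - Q) \<bullet> (\<psi> x - Q)) * ((\<psi> x - Q) \<bullet> mean x)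
    + scal x * ((\<psi> x - Q) \<bullet> (\<psi> x - Q))\<^sup>2 / (4 * (real CARD('n) - 1)) = 0"

text \<open>In an orthonormal tangent frame \<open>ginv\<close> is the identity, and
  \<open>second i j x \<bullet> \<nu>\<close> is the matrix of the scalar second fundamental form;
  the equation becomes one between numbers.\<close>

lemma orthonormal_frame:
  assumes x: "x \<in> V" and E: "\<And>i j. tangent i x \<bullet> tangent j x = (if i = j then 1 else 0)"
  obtains \<nu> where "\<nu> \<bullet> \<nu> = 1" "\<And>i. \<nu> \<bullet> tangent i x = 0"
    "\<And>Y. Y = (\<Sum>i\<in>UNIV. (Y \<bullet> tangent i x) *\<^sub>R tangent i x) + (Y \<bullet> \<nu>) *\<^sub>R \<nu>"
    "\<And>Y. perp x Y = (Y \<bullet> \<nu>) *\<^sub>R \<nu>"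
    "mean x = (\<Sum>i\<in>UNIV. second i i x \<bullet> \<nu>) *\<^sub>R \<nu>"
    "scal x = (\<Sum>i\<in>UNIV. second i i x \<bullet> \<nu>)\<^sup>2 - (\<Sum>i\<in>UNIV. \<Sum>j\<in>UNIV. (second i j x \<bullet> \<nu>)\<^sup>2)"
proof -
  obtain \<nu> where \<nu>: "\<nu> \<bullet> \<nu> = 1" "\<And>i. \<nu> \<bullet> tangent i x = 0"
    "\<And>Y. Y = (\<Sum>i\<in>UNIV. (Y \<bullet> tangent i x) *\<^sub>R tangent i x) + (Y \<bullet> \<nu>) *\<^sub>R \<nu>"
    by (rule orthonormal_frame_normal[of "\<lambda>i. tangent i x"]) (use E in blast)+
  have ginv: "ginv x $ i $ j = (if i = j then 1 else 0)" for i j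
    using matrix_inv_mult(1)[of "induced_metric \<psi> x" i j] det_metric_pos[OF x]
    by (simp add: metric_entry E sum_delta_mult ginv_def)
  have dual: "dual k x = tangent k x" for k
    by (simp add: dual_def ginv sum_delta_scaleR)
  have perp: "perp x Y = (Y \<bullet> \<nu>) *\<^sub>R \<nu>" for Y
    using \<nu>(3)[of Y] by (simp add: perp_def dual inner_commute[of "tangent k x" Y for k] algebra_simps)
  have sff: "sff i j x = (second i j x \<bullet> \<nu>) *\<^sub>R \<nu>" for i j by (simp add: sff_perp perp)
  have mean: "mean x = (\<Sum>i\<in>UNIV. second i i x \<bullet> \<nu>) *\<^sub>R \<nu>"
    unfolding mean_def ginv sum_delta_scaleR sff by (simp add: scaleR_sum_left)
  have "scal x = (\<Sum>j\<in>UNIV. \<Sum>i\<in>UNIV. (second i i x \<bullet> \<nu>) * (second j j x \<bullet> \<nu>) - (second i j x \<bullet> \<nu>) * (second i j x \<bullet> \<nu>))"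
    unfolding scal_def ginv sum_delta_mult sff using \<nu>(1) by (simp add: mult.commute)
  also have "\<dots> = (\<Sum>i\<in>UNIV. second i i x \<bullet> \<nu>)\<^sup>2 - (\<Sum>j\<in>UNIV. \<Sum>i\<in>UNIV. (second i j x \<bullet> \<nu>)\<^sup>2)"
    by (simp add: sum_subtractf power2_eq_square sum_product mult.commute)
  also have "(\<Sum>j\<in>UNIV. \<Sum>i\<in>UNIV. (second i j x \<bullet> \<nu>)\<^sup>2) = (\<Sum>i\<in>UNIV. \<Sum>j\<in>UNIV. (second i j x \<bullet> \<nu>)\<^sup>2)"
    by (rule sum.swap)
  finally show ?thesis using that \<nu> perp mean by blast
qed

text \<open>The equation says that the second elementary symmetric function of the second fundamental
  form, taken relative to the sphere through the pole that is tangent at the point, vanishes.\<close>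

lemma pole_equation_shifted:
  assumes eq: "pole_equation Q x" and xQ: "\<psi> x \<noteq> Q" and n: "CARD('n) \<ge> 3"
    and frame: "\<nu> \<bullet> \<nu> = 1" "\<And>Y. perp x Y = (Y \<bullet> \<nu>) *\<^sub>R \<nu>"
    "mean x = (\<Sum>i\<in>UNIV. second i i x \<bullet> \<nu>) *\<^sub>R \<nu>"
    "scal x = (\<Sum>i\<in>UNIV. second i i x \<bullet> \<nu>)\<^sup>2 - (\<Sum>i\<in>UNIV. \<Sum>j\<in>UNIV. (second i j x \<bullet> \<nu>)\<^sup>2)"
  defines "t \<equiv> 2 * ((\<psi> x - Q) \<bullet> \<nu>) / ((\<psi> x - Q) \<bullet> (\<psi> x - Q))"
  shows "(\<Sum>i\<in>UNIV. \<Sum>j\<in>UNIV. (second i j x \<bullet> \<nu> + (if i = j then t else 0))\<^sup>2)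
    = (\<Sum>i\<in>UNIV. second i i x \<bullet> \<nu> + t)\<^sup>2"
proof -
  define n where "n = real CARD('n)"
  define H where "H = (\<Sum>i\<in>UNIV. second i i x \<bullet> \<nu>)"
  define K where "K = (\<Sum>i\<in>UNIV. \<Sum>j\<in>UNIV. (second i j x \<bullet> \<nu>)\<^sup>2)"
  define s where "s = (\<psi> x - Q) \<bullet> \<nu>"
  define \<rho> where "\<rho> = (\<psi> x - Q) \<bullet> (\<psi> x - Q)"
  have n3: "n \<ge> 3" using n by (simp add: n_def)
  have \<rho>: "\<rho> > 0" using xQ by (simp add: \<rho>_def)
  \<comment> \<open>The sphere through \<open>Q\<close> that is tangent at \<open>\<psi> x\<close>
    has all principal curvatures equal to \<open>- t\<close> with respect to \<open>\<nu>\<close>.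
    This is why \<open>t\<close> is added on the diagonal.\<close>
  have t: "t * \<rho> = 2 * s" using \<rho> by (simp add: t_def s_def \<rho>_def)
  have 0: "n * s\<^sup>2 + \<rho> * (s * H) + (H\<^sup>2 - K) * \<rho>\<^sup>2 / (4 * (n - 1)) = 0"
    using eq unfolding pole_equation_def frame(2-4) n_def[symmetric] \<rho>_def[symmetric] H_def[symmetric] K_def[symmetric]
    by (simp add: s_def[symmetric] frame(1) power2_eq_square mult_ac)
  have "4 * (n - 1) * (n * s\<^sup>2 + \<rho> * (s * H) + (H\<^sup>2 - K) * \<rho>\<^sup>2 / (4 * (n - 1)))
    = 4 * (n - 1) * n * s\<^sup>2 + 4 * (n - 1) * \<rho> * s * H + (H\<^sup>2 - K) * \<rho>\<^sup>2"
    using n3 by (simp add: distrib_left)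
  then have 1: "4 * (n - 1) * n * s\<^sup>2 + 4 * (n - 1) * \<rho> * s * H + (H\<^sup>2 - K) * \<rho>\<^sup>2 = 0"
    using 0 by (metis mult_zero_right)
  \<comment> \<open>Since \<open>t * \<rho> = 2 * s\<close>, this is the left side of the equation
    \<open>1\<close>, cleared of denominators.\<close>
  have "\<rho>\<^sup>2 * ((H + n * t)\<^sup>2 - (K + 2 * t * H + n * t\<^sup>2))
    = (H\<^sup>2 - K) * \<rho>\<^sup>2 + 2 * (n - 1) * \<rho> * (t * \<rho>) * H + n * (n - 1) * (t * \<rho>)\<^sup>2"
    by (simp add: power2_eq_square algebra_simps)
  also have "\<dots> = 0" unfolding t using 1 by (simp add: power2_eq_square algebra_simps)
  finally have 2: "(H + n * t)\<^sup>2 = K + 2 * t * H + n * t\<^sup>2" using \<rho> by simp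
  have "(second i j x \<bullet> \<nu> + (if i = j then t else 0))\<^sup>2
     = (second i j x \<bullet> \<nu>)\<^sup>2 + (if i = j then 1 else 0) * (2 * t * (second i j x \<bullet> \<nu>) + t\<^sup>2)" for i j
    by (simp add: power2_eq_square algebra_simps)
  then have "(\<Sum>i\<in>UNIV. \<Sum>j\<in>UNIV. (second i j x \<bullet> \<nu> + (if i = j then t else 0))\<^sup>2) = K + 2 * t * H + n * t\<^sup>2"
    by (simp only: sum.distrib sum_delta_mult) (simp add: K_def H_def n_def sum_distrib_left)
  moreover have "(\<Sum>i\<in>UNIV. second i i x \<bullet> \<nu> + t) = H + n * t" by (simp add: H_def n_def sum.distrib)
  ultimately show ?thesis using 2 by simp
qed

text \<open>Letting the point tend to the pole in the direction \<open>\<xi>\<close> shows that the square of the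
  trace-free part of the second fundamental form is constant on unit vectors. Being trace-free, that
  form also has a zero.\<close>

lemma umbilic_at_pole:
  assumes x0: "x0 \<in> V" and n: "CARD('n) \<ge> 3"
    and eq: "\<And>x. x \<in> V - {x0} \<Longrightarrow> pole_equation (\<psi> x0) x"
    and E: "\<And>i j. tangent i x0 \<bullet> tangent j x0 = (if i = j then 1 else 0)"
    and frame: "\<nu> \<bullet> \<nu> = 1" "\<And>Y. perp x0 Y = (Y \<bullet> \<nu>) *\<^sub>R \<nu>"
    "mean x0 = (\<Sum>i\<in>UNIV. second i i x0 \<bullet> \<nu>) *\<^sub>R \<nu>"
    "scal x0 = (\<Sum>i\<in>UNIV. second i i x0 \<bullet> \<nu>)\<^sup>2 - (\<Sum>i\<in>UNIV. \<Sum>j\<in>UNIV. (second i j x0 \<bullet> \<nu>)\<^sup>2)"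
  shows "\<exists>\<kappa>. \<forall>i j. second i j x0 \<bullet> \<nu> = (if i = j then \<kappa> else 0)"
proof -
  define n where "n = real CARD('n)"
  define h where "h i j = second i j x0 \<bullet> \<nu>" for i j
  define H where "H = (\<Sum>i\<in>UNIV. h i i)"
  define K where "K = (\<Sum>i\<in>UNIV. \<Sum>j\<in>UNIV. (h i j)\<^sup>2)"
  define q where "q \<xi> = (\<Sum>i\<in>UNIV. \<Sum>j\<in>UNIV. \<xi> $ i * \<xi> $ j * h i j)" for \<xi> :: "real^'n"
  define a where "a \<xi> = q \<xi> - H / n * (\<xi> \<bullet> \<xi>)" for \<xi> :: "real^'n"
  have n3: "n \<ge> 3" using n by (simp add: n_def)
  \<comment> \<open>The limit equation in direction \<open>\<xi>\<close>, with the square completed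
    in \<open>q \<xi>\<close>.\<close>
  have key: "(a \<xi>)\<^sup>2 * (n * (n - 1)) = (K - H\<^sup>2 / n) * (\<xi> \<bullet> \<xi>)\<^sup>2" if "\<xi> \<noteq> 0" for \<xi> :: "real^'n"
  proof -
    define D where "D = (\<Sum>i\<in>UNIV. \<xi> $ i *\<^sub>R tangent i x0)"
    define S where "S = (\<Sum>i\<in>UNIV. \<Sum>j\<in>UNIV. (\<xi> $ i * \<xi> $ j) *\<^sub>R second i j x0)"
    have D: "D \<bullet> D = \<xi> \<bullet> \<xi>"
    proof -
      have "\<xi> \<bullet> \<xi> = (\<Sum>i\<in>UNIV. \<xi> $ i * \<xi> $ i)" by (simp add: inner_vec_def)
      then show ?thesis by (simp add: D_def inner_sum_left inner_sum_right E sum_delta_mult)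
    qed
    have S: "S \<bullet> \<nu> = q \<xi>" by (simp add: S_def q_def h_def inner_sum_left)
    have Sm: "S \<bullet> mean x0 = q \<xi> * H" unfolding frame(3) by (simp add: S H_def h_def)
    have PS: "perp x0 S \<bullet> perp x0 S = (q \<xi>)\<^sup>2" by (simp add: frame(1,2) S power2_eq_square)
    have sc: "scal x0 = H\<^sup>2 - K" unfolding frame(4) by (simp add: H_def K_def h_def)
    have "n * (perp x0 S \<bullet> perp x0 S) / 4 - (D \<bullet> D) * (S \<bullet> mean x0) / 2 + scal x0 * (D \<bullet> D)\<^sup>2 / (4 * (n - 1)) = 0"
      unfolding D_def S_def
      by (rule riesz_kernel_equation_at_pole[OF x0 that]) (use eq in \<open>simp add: pole_equation_def n_def\<close>)
    then have e: "n * (q \<xi>)\<^sup>2 / 4 - (\<xi> \<bullet> \<xi>) * (q \<xi> * H) / 2 + (H\<^sup>2 - K) * (\<xi> \<bullet> \<xi>)\<^sup>2 / (4 * (n - 1)) = 0"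
      unfolding PS D Sm sc .
    have "4 * (n - 1) * (n * (q \<xi>)\<^sup>2 / 4 - (\<xi> \<bullet> \<xi>) * (q \<xi> * H) / 2 + (H\<^sup>2 - K) * (\<xi> \<bullet> \<xi>)\<^sup>2 / (4 * (n - 1)))
      = (n - 1) * n * (q \<xi>)\<^sup>2 - 2 * (n - 1) * (\<xi> \<bullet> \<xi>) * (q \<xi> * H) + (H\<^sup>2 - K) * (\<xi> \<bullet> \<xi>)\<^sup>2"
    proof -
      have "4 * (n - 1) * (A / 4 - B / 2 + C / (4 * (n - 1))) = (n - 1) * A - 2 * (n - 1) * B + C" for A B C
        using n3 by (simp add: field_simps)
      then show ?thesis by (simp only: mult.assoc)
    qed
    then have "(n - 1) * n * (q \<xi>)\<^sup>2 - 2 * (n - 1) * (\<xi> \<bullet> \<xi>) * (q \<xi> * H) + (H\<^sup>2 - K) * (\<xi> \<bullet> \<xi>)\<^sup>2 = 0"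
      using e by (metis mult_zero_right)
    moreover have "(a \<xi>)\<^sup>2 * (n * (n - 1)) = (n - 1) * n * (q \<xi>)\<^sup>2 - 2 * (n - 1) * (\<xi> \<bullet> \<xi>) * (q \<xi> * H) + (n - 1) * (H\<^sup>2 / n) * (\<xi> \<bullet> \<xi>)\<^sup>2"
      unfolding a_def using n3 by (simp add: power2_diff power2_eq_square field_simps)
    moreover have "(K - H\<^sup>2 / n) * (\<xi> \<bullet> \<xi>)\<^sup>2 = (n - 1) * (H\<^sup>2 / n) * (\<xi> \<bullet> \<xi>)\<^sup>2 - (H\<^sup>2 - K) * (\<xi> \<bullet> \<xi>)\<^sup>2"
      using n3 by (simp add: field_simps)
    ultimately show ?thesis by linarith
  qed
  have sum0: "(\<Sum>i\<in>UNIV. a (axis i 1)) = 0"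
  proof -
    have "q (axis i 1) = h i i" for i
      by (simp add: q_def axis_def mult.assoc sum_distrib_left[symmetric] sum_delta_mult)
    then show ?thesis using n3 by (simp add: a_def inner_axis_axis sum_subtractf H_def[symmetric] n_def)
  qed
  have "\<exists>\<xi>. \<xi> \<noteq> 0 \<and> a \<xi> = 0"
  proof -
    obtain i where i: "a (axis i 1) \<le> 0"
      using sum0 sum_pos[of UNIV "\<lambda>i. a (axis i 1)"] by (force simp: not_le)
    obtain j where j: "a (axis j 1) \<ge> 0"
      using sum0 sum_strict_mono[of UNIV "\<lambda>i. a (axis i 1)" "\<lambda>i. 0"] by (force simp: not_le)
    \<comment> \<open>The values of \<open>a\<close> at the basis vectors add up to zero, so there
      is one of each sign. The segment joining these two vectors avoids the origin, and the
      intermediate value theorem gives a zero of \<open>a\<close> on it.\<close>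
    define c where "c \<tau> = (1 - \<tau>) *\<^sub>R axis i 1 + \<tau> *\<^sub>R axis j (1::real)" for \<tau>
    have "continuous_on {0..1} (\<lambda>\<tau>. a (c \<tau>))"
      unfolding a_def q_def c_def by (intro continuous_intros)
    moreover have "a (c 0) \<le> 0" "0 \<le> a (c 1)" using i j by (simp_all add: c_def)
    ultimately obtain \<tau> where \<tau>: "0 \<le> \<tau>" "\<tau> \<le> 1" "a (c \<tau>) = 0"
      using IVT'[of "\<lambda>\<tau>. a (c \<tau>)" 0 0 1] by auto
    have "c \<tau> \<noteq> 0"
    proof
      assume "c \<tau> = 0"
      then have "c \<tau> $ i = 0" "c \<tau> $ j = 0" by simp_all
      then show False by (cases "i = j") (simp_all add: c_def axis_def)
    qed
    then show ?thesis using \<tau>(3) by blast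
  qed
  then obtain \<xi> where "\<xi> \<noteq> 0" "a \<xi> = 0" by blast
  then have K: "K = H\<^sup>2 / n" using key[of \<xi>] by simp
  \<comment> \<open>The squared norm of the trace-free part of \<open>h\<close> is
    \<open>K - H\<^sup>2 / n\<close>, which is now zero.\<close>
  have "(h i j - (if i = j then H / n else 0))\<^sup>2 = (h i j)\<^sup>2 + (if i = j then 1 else 0) * ((H / n)\<^sup>2 - 2 * (H / n) * h i j)" for i j
    by (simp add: power2_diff)
  then have "(\<Sum>i\<in>UNIV. \<Sum>j\<in>UNIV. (h i j - (if i = j then H / n else 0))\<^sup>2) = K + n * (H / n)\<^sup>2 - 2 * (H / n) * H"
    by (simp only: sum.distrib sum_delta_mult) (simp add: K_def H_def n_def sum_distrib_left sum_subtractf)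
  also have "\<dots> = 0" unfolding K using n3 by (simp add: power2_eq_square field_simps)
  finally have "(\<Sum>i\<in>UNIV. \<Sum>j\<in>UNIV. (h i j - (if i = j then H / n else 0))\<^sup>2) = 0" .
  then have "(h i j - (if i = j then H / n else 0))\<^sup>2 = 0" for i j
    by (simp add: sum_nonneg_eq_0_iff sum_nonneg)
  then have "h i j = (if i = j then H / n else 0)" for i j
    by (simp add: eq_diff_eq[symmetric])
  then show ?thesis unfolding h_def by blast
qed

text \<open>The level sets of these functions are in general spheres and, for \<open>c = 0\<close>,
  hyperplanes; the derivatives measure the order of contact of \<open>M\<close> with them.\<close>

lemma derivatives_linear_quadratic:
  assumes x: "x \<in> V"
  shows "smooth_on V (\<lambda>y. c * ((\<psi> y - Q) \<bullet> (\<psi> y - Q)) - (\<psi> y - Q) \<bullet> e - d)"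
    "pderivative i (\<lambda>y. c * ((\<psi> y - Q) \<bullet> (\<psi> y - Q)) - (\<psi> y - Q) \<bullet> e - d) x = ((2 * c) *\<^sub>R (\<psi> x - Q) - e) \<bullet> tangent i x"
    "pderivative j (pderivative i (\<lambda>y. c * ((\<psi> y - Q) \<bullet> (\<psi> y - Q)) - (\<psi> y - Q) \<bullet> e - d)) x
      = 2 * c * (tangent j x \<bullet> tangent i x) + ((2 * c) *\<^sub>R (\<psi> x - Q) - e) \<bullet> second i j x"
proof -
  let ?f = "\<lambda>y. c * ((\<psi> y - Q) \<bullet> (\<psi> y - Q)) - (\<psi> y - Q) \<bullet> e - d"
  show sf: "smooth_on V ?f" by (intro smooth_intros open_V smooth)
  have 1: "pderivative i ?f y = ((2 * c) *\<^sub>R (\<psi> y - Q) - e) \<bullet> tangent i y" if "y \<in> V" for i y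
  proof -
    have "(\<psi> has_derivative frechet_derivative \<psi> (at y)) (at y)"
      using differentiable[OF smooth that] by (simp add: frechet_derivative_works)
    then have "(?f has_derivative (\<lambda>v. c * (2 * ((\<psi> y - Q) \<bullet> frechet_derivative \<psi> (at y) v)) - frechet_derivative \<psi> (at y) v \<bullet> e)) (at y)"
      by (auto intro!: derivative_eq_intros simp: inner_commute)
    from pderivative_eqI[OF this] show ?thesis
      unfolding tangent_def pderivative_def[of i \<psi>] by (simp add: inner_diff_left inner_commute[of e])
  qed
  show "pderivative i ?f x = ((2 * c) *\<^sub>R (\<psi> x - Q) - e) \<bullet> tangent i x" by (rule 1[OF x])
  have D: "(\<lambda>y. (2 * c) *\<^sub>R (\<psi> y - Q) - e) differentiable (at x)" "tangent i differentiable (at x)"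
    by (intro differentiable[OF _ x] smooth_intros open_V smooth)+
  have "pderivative j (\<lambda>y. (2 * c) *\<^sub>R (\<psi> y - Q) - e) x = (2 * c) *\<^sub>R tangent j x"
  proof -
    have "(\<psi> has_derivative frechet_derivative \<psi> (at x)) (at x)"
      using differentiable[OF smooth x] by (simp add: frechet_derivative_works)
    then have "((\<lambda>y. (2 * c) *\<^sub>R (\<psi> y - Q) - e) has_derivative (\<lambda>v. (2 * c) *\<^sub>R frechet_derivative \<psi> (at x) v)) (at x)"
      by (auto intro!: derivative_eq_intros)
    from pderivative_eqI[OF this] show ?thesis unfolding tangent_def pderivative_def[of j \<psi>] .
  qed
  then show "pderivative j (pderivative i ?f) x = 2 * c * (tangent j x \<bullet> tangent i x) + ((2 * c) *\<^sub>R (\<psi> x - Q) - e) \<bullet> second i j x"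
    using pderivative_cong[OF open_V x, of "pderivative i ?f" "\<lambda>y. ((2 * c) *\<^sub>R (\<psi> y - Q) - e) \<bullet> tangent i y" j, OF 1]
      pderivative_inner[OF D, where i=j]
    by (simp add: second_def)
qed

text \<open>The function C |X|^2 - X . e - \<epsilon> has its minimum, zero, at \<open>x1\<close>.
  Its ambient gradient \<open>Z\<close> there is normal, say \<open>\<mu> *\<^sub>R \<nu>\<close>,
  and \<open>\<mu> * b\<close> is the Hessian plus \<open>2 * \<epsilon> / \<rho>\<close> times the
  identity. So \<open>\<mu> * b\<close> is positive definite, which (tr b)^2 = |b|^2
  forbids.\<close>

lemma no_touching_sphere:
  assumes x1: "x1 \<in> V" and n: "CARD('n) \<ge> 3" and eq: "pole_equation Q x1" and xQ: "\<psi> x1 \<noteq> Q"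
    and E: "\<And>i j. tangent i x1 \<bullet> tangent j x1 = (if i = j then 1 else 0)"
    and eps: "\<epsilon> > 0" and touch: "C * ((\<psi> x1 - Q) \<bullet> (\<psi> x1 - Q)) = (\<psi> x1 - Q) \<bullet> e + \<epsilon>"
    and above: "\<And>x. x \<in> V \<Longrightarrow> (\<psi> x - Q) \<bullet> e + \<epsilon> \<le> C * ((\<psi> x - Q) \<bullet> (\<psi> x - Q))"
  shows False
proof -
  obtain \<nu> where frame: "\<nu> \<bullet> \<nu> = 1" "\<And>i. \<nu> \<bullet> tangent i x1 = 0"
    "\<And>Y. Y = (\<Sum>i\<in>UNIV. (Y \<bullet> tangent i x1) *\<^sub>R tangent i x1) + (Y \<bullet> \<nu>) *\<^sub>R \<nu>"
    "\<And>Y. perp x1 Y = (Y \<bullet> \<nu>) *\<^sub>R \<nu>"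
    "mean x1 = (\<Sum>i\<in>UNIV. second i i x1 \<bullet> \<nu>) *\<^sub>R \<nu>"
    "scal x1 = (\<Sum>i\<in>UNIV. second i i x1 \<bullet> \<nu>)\<^sup>2 - (\<Sum>i\<in>UNIV. \<Sum>j\<in>UNIV. (second i j x1 \<bullet> \<nu>)\<^sup>2)"
    by (rule orthonormal_frame[OF x1 E]) blast
  define X where "X = \<psi> x1 - Q"
  define \<rho> where "\<rho> = X \<bullet> X"
  define Z where "Z = (2 * C) *\<^sub>R X - e"
  define \<mu> where "\<mu> = Z \<bullet> \<nu>"
  define t where "t = 2 * (X \<bullet> \<nu>) / \<rho>"
  define b where "b i j = second i j x1 \<bullet> \<nu> + (if i = j then t else 0)" for i j
  define f where "f y = C * ((\<psi> y - Q) \<bullet> (\<psi> y - Q)) - (\<psi> y - Q) \<bullet> e - \<epsilon>" for y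
  have \<rho>: "\<rho> > 0" using xQ by (simp add: \<rho>_def X_def)
  have sf: "smooth_on V f" unfolding f_def[abs_def] by (rule derivatives_linear_quadratic(1)[OF x1])
  have min: "f x1 \<le> f x" if "x \<in> V" for x using above[OF that] touch by (simp add: f_def)
  have df: "pderivative i f x1 = Z \<bullet> tangent i x1" for i
    unfolding f_def[abs_def] Z_def X_def by (rule derivatives_linear_quadratic(2)[OF x1])
  have ddf: "pderivative j (pderivative i f) x1 = 2 * C * (if j = i then 1 else 0) + Z \<bullet> second i j x1" for i j
    unfolding f_def[abs_def] Z_def X_def using derivatives_linear_quadratic(3)[OF x1] by (simp only: E)
  have ZE: "Z \<bullet> tangent i x1 = 0" for i
    using local_minimum_derivatives(1)[OF open_V x1 sf min] df by simp
  have Z: "Z = \<mu> *\<^sub>R \<nu>" using frame(3)[of Z] by (simp add: ZE \<mu>_def)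
  \<comment> \<open>Contact at \<open>x1\<close> replaces \<open>X \<bullet> e\<close> by
    \<open>C * \<rho> - \<epsilon>\<close>. The \<open>\<epsilon>\<close> that appears here is the
    strictly positive excess of \<open>\<mu> * b\<close> over the Hessian.\<close>
  have "Z \<bullet> X = 2 * C * \<rho> - X \<bullet> e" by (simp add: Z_def inner_diff_left \<rho>_def inner_commute[of e X])
  also have "\<dots> = C * \<rho> + \<epsilon>" using touch by (simp add: X_def[symmetric] \<rho>_def[symmetric])
  finally have "\<mu> * (X \<bullet> \<nu>) = C * \<rho> + \<epsilon>" by (simp add: Z inner_commute)
  then have \<mu>t: "\<mu> * t = 2 * C + 2 * \<epsilon> / \<rho>" using \<rho> by (simp add: t_def field_simps)
  have c: "\<mu> * b i j = pderivative j (pderivative i f) x1 + (if i = j then 2 * \<epsilon> / \<rho> else 0)" for i j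
    using \<mu>t by (simp add: ddf Z b_def distrib_left inner_commute)
  have sq: "(\<Sum>i\<in>UNIV. \<Sum>j\<in>UNIV. (b i j)\<^sup>2) = (\<Sum>i\<in>UNIV. b i i)\<^sup>2"
    unfolding b_def t_def X_def \<rho>_def
    using pole_equation_shifted[OF eq xQ n frame(1,4-6)] by simp
  \<comment> \<open>The sign of \<open>\<mu>\<close> depends on the choice of \<open>\<nu>\<close>,
    so definiteness is claimed for \<open>\<mu> * b\<close>. The relation \<open>sq\<close> is
    homogeneous and passes to this multiple.\<close>
  have "(\<Sum>i\<in>UNIV. \<Sum>j\<in>UNIV. (\<mu> * b i j)\<^sup>2) < (\<Sum>i\<in>UNIV. \<mu> * b i i)\<^sup>2"
  proof (rule trace_square_of_positive_definite)
    show "\<mu> * b i j = \<mu> * b j i" for i j by (simp add: b_def second_sym[OF x1, of i j])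
    show "CARD('n) \<ge> 2" using n by simp
    fix \<xi> :: "real^'n" assume "\<xi> \<noteq> 0"
    have "\<xi> $ i * \<xi> $ j * (\<mu> * b i j) = \<xi> $ i * \<xi> $ j * pderivative j (pderivative i f) x1
        + (if i = j then 1 else 0) * (2 * \<epsilon> / \<rho> * (\<xi> $ i * \<xi> $ j))" for i j
      by (simp add: c distrib_left)
    then have "(\<Sum>i\<in>UNIV. \<Sum>j\<in>UNIV. \<xi> $ i * \<xi> $ j * (\<mu> * b i j))
      = (\<Sum>i\<in>UNIV. \<Sum>j\<in>UNIV. \<xi> $ i * \<xi> $ j * pderivative j (pderivative i f) x1) + 2 * \<epsilon> / \<rho> * (\<xi> \<bullet> \<xi>)"
      by (simp only: sum.distrib sum_delta_mult) (simp add: inner_vec_def sum_distrib_left)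
    moreover have "(\<Sum>i\<in>UNIV. \<Sum>j\<in>UNIV. \<xi> $ i * \<xi> $ j * pderivative j (pderivative i f) x1) \<ge> 0"
      by (rule local_minimum_derivatives(2)[OF open_V x1 sf min])
    moreover have "2 * \<epsilon> / \<rho> * (\<xi> \<bullet> \<xi>) > 0" using eps \<rho> \<open>\<xi> \<noteq> 0\<close> by simp
    ultimately show "(\<Sum>i\<in>UNIV. \<Sum>j\<in>UNIV. \<xi> $ i * \<xi> $ j * (\<mu> * b i j)) > 0" by linarith
  qed
  then show False
    unfolding sum_distrib_left[symmetric] power_mult_distrib by (simp add: sq)
qed

end

text \<open>Written as a power of the inner product, the kernel is smooth on the complement of
  \<open>Q\<close> in the ambient space, as the passage to the pointwise equation requires.\<close>

lemma green_pole_equation: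
  fixes M :: "(real^('n::finite option)) set"
  assumes M: "closed_embedded_hypersurface M" and vol: "riemannian_volume M dV" and Q: "Q \<in> M"
    and n: "CARD('n) \<ge> 3" and green: "conformal_green_function M dV Q G"
    and G: "\<forall>P\<in>M - {Q}. G P = green_constant CARD('n) * dist P Q powr (2 - real CARD('n))"
    and lp: "local_parametrization M V \<psi>" and QV: "Q \<notin> \<psi> ` V" and x: "x \<in> V"
  shows "immersion.pole_equation \<psi> Q x"
proof -
  interpret immersion V \<psi> using lp by (rule local_parametrization_immersion)
  define c where "c = green_constant CARD('n)"
  have c: "c > 0" using n by (simp add: c_def green_constant_def)
  define U where "U P = c * ((P - Q) \<bullet> (P - Q)) powr (1 - real CARD('n) / 2)" for P
  have GU: "G P = U P" if "P \<in> \<psi> ` V" for P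
  proof -
    have "P \<in> M - {Q}" using that QV lp openin_imp_subset unfolding local_parametrization_def by blast
    moreover have "dist P Q powr (2 - real CARD('n)) = ((P - Q) \<bullet> (P - Q)) powr (1 - real CARD('n) / 2)"
      by (simp add: dist_norm norm_eq_sqrt_inner powr_half_sqrt[symmetric] powr_powr diff_divide_distrib)
    ultimately show ?thesis using G by (simp add: U_def c_def)
  qed
  have "coord_conformal_laplacian (induced_metric \<psi>) (\<lambda>y. U (\<psi> y)) x = 0"
  proof (rule conformal_green_function_pointwise[OF M vol Q green lp QV _ _ _ GU x])
    show "open (- {Q})" by (simp add: open_Compl)
    show "\<psi> ` V \<subseteq> - {Q}" using QV by auto
    show "smooth_on (- {Q}) U" unfolding U_def[abs_def] by (rule smooth_powr_norm)
  qed
  then show ?thesis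
    unfolding pole_equation_def U_def by (rule riesz_kernel_equation[OF x QV n c])
qed

section \<open>The maximum principle\<close>

text \<open>If the bound failed at \<open>P0\<close>, \<open>near\<close> would keep the maximum of
  the perturbed quotient \<open>F\<close> away from \<open>Q\<close>, and \<open>touch\<close>
  excludes a maximum there.\<close>

lemma one_sided_bound_by_touching:
  fixes M :: "'a::euclidean_space set"
  assumes M: "compact M"
    and near: "\<And>\<eta>. \<eta> > 0 \<Longrightarrow> \<exists>\<delta>>0. \<forall>P\<in>M. dist P Q < \<delta> \<longrightarrow> (P - Q) \<bullet> e \<le> (k + \<eta>) * ((P - Q) \<bullet> (P - Q))"
    and touch: "\<And>P1 C \<epsilon> N. P1 \<in> M \<Longrightarrow> P1 \<noteq> Q \<Longrightarrow> \<epsilon> > 0 \<Longrightarrow> open N \<Longrightarrow> P1 \<in> N \<Longrightarrow>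
      C * ((P1 - Q) \<bullet> (P1 - Q)) = (P1 - Q) \<bullet> e + \<epsilon> \<Longrightarrow>
      (\<And>P. P \<in> M \<Longrightarrow> P \<in> N \<Longrightarrow> (P - Q) \<bullet> e + \<epsilon> \<le> C * ((P - Q) \<bullet> (P - Q))) \<Longrightarrow> False"
    and P0: "P0 \<in> M"
  shows "(P0 - Q) \<bullet> e \<le> k * ((P0 - Q) \<bullet> (P0 - Q))"
proof (rule ccontr)
  assume neg: "\<not> ?thesis"
  define r where "r P = (P - Q) \<bullet> (P - Q)" for P
  have r0: "r P \<ge> 0" for P by (simp add: r_def)
  have rdist: "r P = (dist P Q)\<^sup>2" for P by (simp add: r_def dist_norm power2_norm_eq_inner)
  have P0Q: "P0 \<noteq> Q" using neg by auto
  then have rP0: "r P0 > 0" by (simp add: r_def)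
  \<comment> \<open>A third of the excess over \<open>k\<close> at \<open>P0\<close>: near
    \<open>Q\<close> the quotient exceeds \<open>k\<close> by at most one \<open>\<eta>\<close>, the
    perturbation adds at most another one, and \<open>P0\<close> has three.\<close>
  define \<eta> where "\<eta> = ((P0 - Q) \<bullet> e / r P0 - k) / 3"
  have \<eta>: "\<eta> > 0" using neg rP0 by (simp add: \<eta>_def r_def[symmetric] field_simps)
  have w0: "(P0 - Q) \<bullet> e = (k + 3 * \<eta>) * r P0" using rP0 by (simp add: \<eta>_def field_simps)
  obtain \<delta> where \<delta>: "\<delta> > 0" "\<And>P. P \<in> M \<Longrightarrow> dist P Q < \<delta> \<Longrightarrow> (P - Q) \<bullet> e \<le> (k + \<eta>) * r P"
    using near[OF \<eta>] unfolding r_def by blast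
  \<comment> \<open>At most \<open>dist P0 Q\<close>, so that \<open>P0\<close> stays outside the
    excised ball; less than \<open>\<delta>\<close>, so that a maximum at distance at least
    \<open>\<delta>\<close> from \<open>Q\<close> is not on the boundary of that ball.\<close>
  define \<rho> where "\<rho> = min (\<delta> / 2) (dist P0 Q)"
  have \<rho>: "\<rho> > 0" "\<rho> < \<delta>" "\<rho> \<le> dist P0 Q" using \<delta>(1) P0Q by (auto simp: \<rho>_def)
  \<comment> \<open>With this value \<open>\<epsilon> / r P\<close> is at most \<open>\<eta>\<close>
    outside the ball of radius \<open>\<rho>\<close>.\<close>
  define \<epsilon> where "\<epsilon> = \<eta> * \<rho>\<^sup>2"
  have \<epsilon>: "\<epsilon> > 0" using \<eta> \<rho> by (simp add: \<epsilon>_def)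
  define F where "F P = ((P - Q) \<bullet> e + \<epsilon>) / r P" for P
  define S where "S = M \<inter> - ball Q \<rho>"
  have S: "P \<in> S \<longleftrightarrow> P \<in> M \<and> \<rho> \<le> dist P Q" for P by (auto simp: S_def dist_commute)
  have rS: "r P > 0" if "\<rho> \<le> dist P Q" for P
  proof -
    have "dist P Q > 0" using that \<rho>(1) by linarith
    then show ?thesis by (simp add: rdist)
  qed
  have "compact S" unfolding S_def by (intro compact_Int_closed M) (simp add: closed_def)
  moreover have "P0 \<in> S" using P0 \<rho>(3) by (simp add: S)
  moreover have "continuous_on S F"
    unfolding F_def r_def by (intro continuous_intros) (use rS S in \<open>force simp: r_def\<close>)
  ultimately obtain P1 where P1: "P1 \<in> S" "\<And>P. P \<in> S \<Longrightarrow> F P \<le> F P1"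
    using continuous_attains_sup[of S F] by blast
  have P1': "P1 \<in> M" "\<rho> \<le> dist P1 Q" "r P1 > 0" using P1(1) rS by (auto simp: S)
  have "F P0 \<ge> k + 3 * \<eta>" using rP0 \<epsilon> w0 by (simp add: F_def field_simps)
  then have F1: "F P1 \<ge> k + 3 * \<eta>" using P1(2)[OF \<open>P0 \<in> S\<close>] by linarith
  have far: "dist P1 Q \<ge> \<delta>"
  proof (rule ccontr)
    assume "\<not> ?thesis"
    then have "(P1 - Q) \<bullet> e \<le> (k + \<eta>) * r P1" using \<delta>(2) P1'(1) by simp
    moreover have "\<epsilon> \<le> \<eta> * r P1"
      using P1'(2) \<rho>(1) \<eta> unfolding \<epsilon>_def rdist by (intro mult_left_mono power_mono) auto
    ultimately have "(P1 - Q) \<bullet> e + \<epsilon> \<le> (k + 2 * \<eta>) * r P1" by (simp add: algebra_simps)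
    then have "F P1 \<le> k + 2 * \<eta>" using P1'(3) by (simp add: F_def divide_le_eq)
    then show False using F1 \<eta> by linarith
  qed
  show False
  proof (rule touch[of P1 \<epsilon> "- cball Q \<rho>" "F P1"])
    show "P1 \<in> M" "\<epsilon> > 0" by (rule P1' \<epsilon>)+
    show "P1 \<noteq> Q" using P1'(3) by (auto simp: r_def)
    show "open (- cball Q \<rho>)" by (simp add: open_Compl)
    show "P1 \<in> - cball Q \<rho>" using far \<rho>(2) by (simp add: dist_commute)
    show "F P1 * ((P1 - Q) \<bullet> (P1 - Q)) = (P1 - Q) \<bullet> e + \<epsilon>"
      using P1'(3) unfolding r_def[symmetric] by (simp add: F_def)
    show "(P - Q) \<bullet> e + \<epsilon> \<le> F P1 * ((P - Q) \<bullet> (P - Q))" if "P \<in> M" "P \<in> - cball Q \<rho>" for P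
    proof -
      have "\<rho> \<le> dist P Q" using that by (simp add: dist_commute)
      then have "F P \<le> F P1" "r P > 0" using P1(2)[of P] rS that by (simp_all add: S)
      then show ?thesis unfolding r_def[symmetric] by (simp add: F_def divide_le_eq)
    qed
  qed
qed

text \<open>At an umbilic with curvature \<open>\<kappa>\<close>, \<open>M\<close> agrees to second
  order with a sphere or a hyperplane: the function \<open>f\<close> built with
  \<open>\<kappa> / 2\<close> and the normal \<open>\<nu>\<close> has zero value, gradient and
  Hessian at the pole. Hence \<open>k\<close> is \<open>\<kappa> / 2\<close>.\<close>

lemma near_pole_expansion:
  fixes M :: "(real^('n::finite option)) set"
  assumes M: "closed_embedded_hypersurface M" and Q: "Q \<in> M" and n: "CARD('n) \<ge> 3"
    and eqs: "\<And>V \<psi> x. local_parametrization M V \<psi> \<Longrightarrow> Q \<notin> \<psi> ` V \<Longrightarrow> x \<in> V \<Longrightarrow> immersion.pole_equation \<psi> Q x"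
  obtains e k where "e \<bullet> e = 1" "\<And>\<eta>. \<eta> > 0 \<Longrightarrow> \<exists>\<delta>>0. \<forall>P\<in>M. dist P Q < \<delta> \<longrightarrow>
    \<bar>(P - Q) \<bullet> e - k * ((P - Q) \<bullet> (P - Q))\<bar> \<le> \<eta> * ((P - Q) \<bullet> (P - Q))"
proof -
  obtain V \<psi> x where "local_parametrization M V \<psi>" "x \<in> V" "\<psi> x = Q"
    using M Q unfolding closed_embedded_hypersurface_def by (metis imageE)
  from orthonormal_parametrization[OF this(1,2)] this(3)
  obtain W \<phi> y0 where lp: "local_parametrization M W \<phi>" and y0: "y0 \<in> W" "\<phi> y0 = Q"
    and orth: "\<And>i j. pderivative i \<phi> y0 \<bullet> pderivative j \<phi> y0 = (if i = j then 1 else 0)"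
    by metis
  interpret immersion W \<phi> using lp by (rule local_parametrization_immersion)
  note E = orth[folded tangent_def]
  obtain \<phi>' where hom: "homeomorphism W (\<phi> ` W) \<phi> \<phi>'" using lp unfolding local_parametrization_def by blast
  have eq: "pole_equation (\<phi> y0) x" if x: "x \<in> W - {y0}" for x
  proof -
    have lp': "local_parametrization M (W - {y0}) \<phi>"
      by (rule local_parametrization_restrict[OF lp]) (auto intro: open_V open_delete)
    have "Q \<notin> \<phi> ` (W - {y0})"
    proof
      assume "Q \<in> \<phi> ` (W - {y0})"
      then obtain z where "z \<in> W - {y0}" "Q = \<phi> z" by blast
      then have z: "z \<in> W" "z \<noteq> y0" "\<phi> z = \<phi> y0" using y0 by simp_all
      have "z = \<phi>' (\<phi> z)" "y0 = \<phi>' (\<phi> y0)" using homeomorphism_apply1[OF hom] z(1) y0(1) by auto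
      then show False using z by simp
    qed
    from eqs[OF lp' this x] show ?thesis by (simp add: y0)
  qed
  obtain \<nu> where frame: "\<nu> \<bullet> \<nu> = 1" "\<And>i. \<nu> \<bullet> tangent i y0 = 0"
    "\<And>Y. Y = (\<Sum>i\<in>UNIV. (Y \<bullet> tangent i y0) *\<^sub>R tangent i y0) + (Y \<bullet> \<nu>) *\<^sub>R \<nu>"
    "\<And>Y. perp y0 Y = (Y \<bullet> \<nu>) *\<^sub>R \<nu>"
    "mean y0 = (\<Sum>i\<in>UNIV. second i i y0 \<bullet> \<nu>) *\<^sub>R \<nu>"
    "scal y0 = (\<Sum>i\<in>UNIV. second i i y0 \<bullet> \<nu>)\<^sup>2 - (\<Sum>i\<in>UNIV. \<Sum>j\<in>UNIV. (second i j y0 \<bullet> \<nu>)\<^sup>2)"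
    by (rule orthonormal_frame[OF y0(1) E]) blast
  obtain \<kappa> where \<kappa>: "\<And>i j. second i j y0 \<bullet> \<nu> = (if i = j then \<kappa> else 0)"
    using umbilic_at_pole[OF y0(1) n eq E frame(1,4-6)] by blast
  have "\<exists>\<delta>>0. \<forall>P\<in>M. dist P Q < \<delta> \<longrightarrow>
    \<bar>(P - Q) \<bullet> \<nu> - \<kappa> / 2 * ((P - Q) \<bullet> (P - Q))\<bar> \<le> \<eta> * ((P - Q) \<bullet> (P - Q))" if \<eta>: "\<eta> > 0" for \<eta>
  proof -
    define f where "f y = \<kappa> / 2 * ((\<phi> y - Q) \<bullet> (\<phi> y - Q)) - (\<phi> y - Q) \<bullet> \<nu> - 0" for y
    note dlq = derivatives_linear_quadratic[OF y0(1), where c="\<kappa> / 2" and Q=Q and e=\<nu> and d=0]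
    have "\<exists>d>0. \<forall>y. norm (y - y0) < d \<longrightarrow> y \<in> W \<and> \<bar>f y\<bar> \<le> (\<eta> / 4) * (norm (y - y0))\<^sup>2"
    proof (rule flat_point_bound[OF open_V y0(1)])
      show "smooth_on W f" unfolding f_def[abs_def] by (rule dlq(1))
      show "f y0 = 0" by (simp add: f_def y0)
      show "pderivative i f y0 = 0" for i
        unfolding f_def[abs_def] dlq(2) by (simp add: y0 frame(2))
      show "pderivative j (pderivative i f) y0 = 0" for i j
        unfolding f_def[abs_def] dlq(3) by (simp add: y0 E \<kappa> inner_commute[of \<nu>])
      show "\<eta> / 4 > 0" using \<eta> by simp
    qed
    then obtain d1 where d1: "d1 > 0" "\<And>y. norm (y - y0) < d1 \<Longrightarrow> y \<in> W"
      "\<And>y. norm (y - y0) < d1 \<Longrightarrow> \<bar>f y\<bar> \<le> (\<eta> / 4) * (norm (y - y0))\<^sup>2" by blast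
    have "(\<phi> has_derivative frechet_derivative \<phi> (at y0)) (at y0)"
      using differentiable[OF smooth y0(1)] by (simp add: frechet_derivative_works)
    then have "\<forall>e>0. \<exists>d>0. \<forall>y. norm (y - y0) < d \<longrightarrow> norm (\<phi> y - \<phi> y0 - frechet_derivative \<phi> (at y0) (y - y0)) \<le> e * norm (y - y0)"
      unfolding has_derivative_at_alt by blast
    \<comment> \<open>The derivative at \<open>y0\<close> is an isometry, so an error of at most
      half the length gives \<open>norm (y - y0) \<le> 2 * norm (P - Q)\<close>. Squaring this
      accounts for the \<open>\<eta> / 4\<close> above.\<close>
    from this[rule_format, of "1/2"] obtain d2 where d2: "d2 > 0"
      "\<And>y. norm (y - y0) < d2 \<Longrightarrow> norm (\<phi> y - \<phi> y0 - frechet_derivative \<phi> (at y0) (y - y0)) \<le> 1/2 * norm (y - y0)" by auto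
    have iso: "norm (frechet_derivative \<phi> (at y0) v) = norm v" for v
    proof -
      have "v \<bullet> v = (\<Sum>i\<in>UNIV. v $ i * v $ i)" by (simp add: inner_vec_def)
      then have "frechet_derivative \<phi> (at y0) v \<bullet> frechet_derivative \<phi> (at y0) v = v \<bullet> v"
        by (simp add: tangent_combination[OF y0(1)] inner_sum_left inner_sum_right E sum_delta_mult)
      then show ?thesis by (simp add: norm_eq_sqrt_inner)
    qed
    define B where "B = ball y0 (min d1 d2)"
    have BW: "B \<subseteq> W" using d1(2) by (auto simp: B_def dist_norm norm_minus_commute)
    have "openin (top_of_set W) B" using BW by (simp add: openin_open_eq open_V B_def)
    then have "openin (top_of_set (\<phi> ` W)) (\<phi> ` B)" by (rule homeomorphism_imp_open_map[OF hom])
    moreover have "openin (top_of_set M) (\<phi> ` W)" using lp by (simp add: local_parametrization_def)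
    ultimately have "openin (top_of_set M) (\<phi> ` B)" by (rule openin_trans)
    \<comment> \<open>As \<open>M\<close> is embedded, all its points close to \<open>Q\<close> lie
      in this piece of the chart, so the estimate in coordinates covers them.\<close>
    then obtain T where T: "open T" "\<phi> ` B = M \<inter> T" unfolding openin_open by blast
    have "y0 \<in> B" using d1(1) d2(1) by (simp add: B_def)
    then have "Q \<in> T" using T(2) y0(2) by blast
    then obtain \<delta> where \<delta>: "\<delta> > 0" "ball Q \<delta> \<subseteq> T" using T(1) open_contains_ball by blast
    have "\<bar>(P - Q) \<bullet> \<nu> - \<kappa> / 2 * ((P - Q) \<bullet> (P - Q))\<bar> \<le> \<eta> * ((P - Q) \<bullet> (P - Q))" if P: "P \<in> M" "dist P Q < \<delta>" for P
    proof -
      have "P \<in> \<phi> ` B" using T(2) \<delta>(2) P by (auto simp: dist_commute subset_iff)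
      then obtain y where y: "y \<in> B" "P = \<phi> y" by blast
      have ny: "norm (y - y0) < d1" "norm (y - y0) < d2" using y(1) by (simp_all add: B_def dist_norm norm_minus_commute)
      define v where "v = y - y0"
      have "norm v \<le> norm (P - Q) + norm (frechet_derivative \<phi> (at y0) v - (P - Q))"
        using norm_triangle_sub[of "frechet_derivative \<phi> (at y0) v" "P - Q"] by (simp add: iso)
      moreover have "norm (frechet_derivative \<phi> (at y0) v - (P - Q)) \<le> 1/2 * norm v"
        using d2(2)[OF ny(2)] by (simp add: v_def y y0 norm_minus_commute)
      ultimately have "norm v \<le> 2 * norm (P - Q)" by simp
      then have "(norm v)\<^sup>2 \<le> (2 * norm (P - Q))\<^sup>2" by (intro power_mono) auto
      then have "(norm v)\<^sup>2 \<le> 4 * ((P - Q) \<bullet> (P - Q))" by (simp add: power_mult_distrib power2_norm_eq_inner)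
      then have "(\<eta> / 4) * (norm v)\<^sup>2 \<le> (\<eta> / 4) * (4 * ((P - Q) \<bullet> (P - Q)))" using \<eta> by (intro mult_left_mono) auto
      moreover have "\<bar>f y\<bar> \<le> (\<eta> / 4) * (norm v)\<^sup>2" using d1(3)[OF ny(1)] by (simp add: v_def)
      ultimately show ?thesis by (simp add: f_def y(2) abs_minus_commute)
    qed
    then show ?thesis using \<delta>(1) by blast
  qed
  with frame(1) show ?thesis by (rule that)
qed

text \<open>A chart around \<open>P1\<close> is cut down to \<open>N\<close> without
  \<open>Q\<close>, so that both the pole equation and \<open>above\<close> are available on all of
  it, and is then made orthonormal at the touching point.\<close>

lemma touching_contradiction:
  fixes M :: "(real^('n::finite option)) set"
  assumes M: "closed_embedded_hypersurface M" and n: "CARD('n) \<ge> 3"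
    and eqs: "\<And>V \<psi> x. local_parametrization M V \<psi> \<Longrightarrow> Q \<notin> \<psi> ` V \<Longrightarrow> x \<in> V \<Longrightarrow> immersion.pole_equation \<psi> Q x"
    and P1: "P1 \<in> M" "P1 \<noteq> Q" and eps: "\<epsilon> > 0" and N: "open N" "P1 \<in> N"
    and touch: "C * ((P1 - Q) \<bullet> (P1 - Q)) = (P1 - Q) \<bullet> e + \<epsilon>"
    and above: "\<And>P. P \<in> M \<Longrightarrow> P \<in> N \<Longrightarrow> (P - Q) \<bullet> e + \<epsilon> \<le> C * ((P - Q) \<bullet> (P - Q))"
  shows False
proof -
  obtain V \<psi> x where V: "local_parametrization M V \<psi>" "x \<in> V" "\<psi> x = P1"
    using M P1 unfolding closed_embedded_hypersurface_def by (metis imageE)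
  define V' where "V' = V \<inter> \<psi> -` (N - {Q})"
  have "open V'"
    unfolding V'_def using V(1) N(1)
    by (intro continuous_open_preimage smooth_on_continuous open_delete) (simp_all add: local_parametrization_def)
  then have lp': "local_parametrization M V' \<psi>"
    by (rule local_parametrization_restrict[OF V(1)]) (auto simp: V'_def)
  have "x \<in> V'" using V P1 N by (simp add: V'_def)
  from orthonormal_parametrization[OF lp' this] V(3)
  obtain W \<phi> y0 where lp: "local_parametrization M W \<phi>" and y0: "y0 \<in> W" "\<phi> y0 = P1" and im: "\<phi> ` W = \<psi> ` V'"
    and orth: "\<And>i j. pderivative i \<phi> y0 \<bullet> pderivative j \<phi> y0 = (if i = j then 1 else 0)"
    by metis
  interpret immersion W \<phi> using lp by (rule local_parametrization_immersion)
  have imN: "\<phi> ` W \<subseteq> N" "Q \<notin> \<phi> ` W" unfolding im by (auto simp: V'_def)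
  have imM: "\<phi> ` W \<subseteq> M" using lp openin_imp_subset unfolding local_parametrization_def by blast
  show False
  proof (rule no_touching_sphere[OF y0(1) n eqs[OF lp imN(2) y0(1)] _ orth[folded tangent_def] eps])
    show "\<phi> y0 \<noteq> Q" using y0 P1 by simp
    show "C * ((\<phi> y0 - Q) \<bullet> (\<phi> y0 - Q)) = (\<phi> y0 - Q) \<bullet> e + \<epsilon>" using touch y0 by simp
    show "(\<phi> y - Q) \<bullet> e + \<epsilon> \<le> C * ((\<phi> y - Q) \<bullet> (\<phi> y - Q))" if "y \<in> W" for y
      using that imN(1) imM by (intro above) auto
  qed
qed

section \<open>Hypersurfaces contained in spheres and hyperplanes\<close>

text \<open>As a compact set \<open>M\<close> is closed in the sphere, and by invariance of domain
  it is open in it; the sphere is connected.\<close>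

lemma hypersurface_in_sphere:
  fixes M :: "(real^('n::finite option)) set"
  assumes M: "closed_embedded_hypersurface M" "M \<noteq> {}" and r: "r > 0" and sub: "M \<subseteq> sphere a r"
  shows "M = sphere a r"
proof -
  have "openin (top_of_set (sphere a r)) M"
    unfolding openin_subopen[of _ M]
  proof
    fix p assume "p \<in> M"
    then obtain V \<psi> where V: "local_parametrization M V \<psi>" "p \<in> \<psi> ` V"
      using M(1) unfolding closed_embedded_hypersurface_def by blast
    obtain \<psi>' where hom: "homeomorphism V (\<psi> ` V) \<psi> \<psi>'" using V(1) unfolding local_parametrization_def by blast
    have imM: "\<psi> ` V \<subseteq> M" using V(1) openin_imp_subset unfolding local_parametrization_def by blast
    have onS: "norm (\<psi> x - a) = r" if "x \<in> V" for x
      using imM sub that by (force simp: dist_norm norm_minus_commute)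
    \<comment> \<open>The cone over the chart with vertex \<open>a\<close>. The radial variable
      supplies the dimension that invariance of domain needs in the ambient space, and the cone
      meets the sphere only at parameter 1, that is, in points of \<open>M\<close>.\<close>
    define F where "F z = a + snd z *\<^sub>R (\<psi> (fst z) - a)" for z :: "(real^'n) \<times> real"
    have "open (F ` (V \<times> {0<..}))"
    proof (rule invariance_of_domain_gen)
      show "open (V \<times> {0<..} :: ((real^'n) \<times> real) set)"
        using V(1) by (intro open_Times) (simp_all add: local_parametrization_def)
      have "continuous_on (V \<times> {0<..}) (\<lambda>z :: (real^'n) \<times> real. \<psi> (fst z))"
        by (rule continuous_on_compose2[OF homeomorphism_cont1[OF hom] continuous_on_fst[OF continuous_on_id]]) auto
      then show "continuous_on (V \<times> {0<..}) F"
        unfolding F_def by (intro continuous_intros)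
      show "inj_on F (V \<times> {0<..})"
      proof (rule inj_onI)
        fix z w :: "(real^'n) \<times> real"
        assume z: "z \<in> V \<times> {0<..}" and w: "w \<in> V \<times> {0<..}" and "F z = F w"
        then have eq: "snd z *\<^sub>R (\<psi> (fst z) - a) = snd w *\<^sub>R (\<psi> (fst w) - a)" by (simp add: F_def)
        then have "norm (snd z *\<^sub>R (\<psi> (fst z) - a)) = norm (snd w *\<^sub>R (\<psi> (fst w) - a))" by simp
        then have s: "snd z = snd w" using z w onS r by auto
        then have "\<psi> (fst z) = \<psi> (fst w)" using eq w by auto
        then have "fst z = fst w" using homeomorphism_apply1[OF hom] z w by (metis mem_Times_iff)
        then show "z = w" using s by (simp add: prod_eq_iff)
      qed
      show "DIM(real^('n option)) \<le> DIM((real^'n) \<times> real)" by simp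
    qed
    moreover have "sphere a r \<inter> F ` (V \<times> {0<..}) \<subseteq> M"
    proof
      fix q assume "q \<in> sphere a r \<inter> F ` (V \<times> {0<..})"
      then obtain x t where q: "x \<in> V" "t > 0" "q = F (x, t)" "norm (q - a) = r"
        by (auto simp: dist_norm norm_minus_commute)
      have "norm (q - a) = t * r" using q(1-3) onS by (simp add: F_def)
      then have "t = 1" using q(4) r by simp
      then show "q \<in> M" using q(1,3) imM by (auto simp: F_def)
    qed
    moreover have "p \<in> F ` (V \<times> {0<..})"
    proof -
      obtain x where "x \<in> V" "p = \<psi> x" using V(2) by blast
      then show ?thesis by (intro image_eqI[of _ _ "(x, 1)"]) (simp_all add: F_def)
    qed
    ultimately show "\<exists>T. openin (top_of_set (sphere a r)) T \<and> p \<in> T \<and> T \<subseteq> M"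
      using sub \<open>p \<in> M\<close> openin_open_Int by (metis IntI subsetD)
  qed
  moreover have "closedin (top_of_set (sphere a r)) M"
    using M(1) sub by (intro closed_subset compact_imp_closed) (simp_all add: closed_embedded_hypersurface_def)
  moreover have "connected (sphere a r)"
    by (intro connected_sphere) simp
  ultimately show ?thesis using M(2) unfolding connected_clopen by blast
qed

text \<open>At the point of \<open>M\<close> farthest from \<open>Q\<close> the position vector is normal.\<close>

lemma hypersurface_not_in_hyperplane:
  fixes M :: "(real^('n::finite option)) set"
  assumes M: "closed_embedded_hypersurface M" and Q: "Q \<in> M" and e: "e \<noteq> 0"
  shows "\<exists>P\<in>M. (P - Q) \<bullet> e \<noteq> 0"
proof (rule ccontr)
  assume "\<not> ?thesis"
  then have flat: "(P - Q) \<bullet> e = 0" if "P \<in> M" for P using that by blast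
  have "compact M" using M by (simp add: closed_embedded_hypersurface_def)
  then obtain P1 where P1: "P1 \<in> M" "\<And>P. P \<in> M \<Longrightarrow> dist P Q \<le> dist P1 Q"
    using continuous_attains_sup[of M "\<lambda>P. dist P Q"] Q continuous_on_dist[OF continuous_on_id continuous_on_const] by blast
  obtain V \<psi> x where V: "local_parametrization M V \<psi>" "x \<in> V" "\<psi> x = P1"
    using M P1(1) unfolding closed_embedded_hypersurface_def by (metis imageE)
  from orthonormal_parametrization[OF V(1,2)] V(3)
  obtain W \<phi> y0 where lp: "local_parametrization M W \<phi>" and y0: "y0 \<in> W" "\<phi> y0 = P1"
    and orth: "\<And>i j. pderivative i \<phi> y0 \<bullet> pderivative j \<phi> y0 = (if i = j then 1 else 0)"
    by metis
  interpret immersion W \<phi> using lp by (rule local_parametrization_immersion)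
  have imM: "\<phi> ` W \<subseteq> M" using lp openin_imp_subset unfolding local_parametrization_def by blast
  obtain \<nu> where \<nu>: "\<nu> \<bullet> \<nu> = 1"
    "\<And>Y. Y = (\<Sum>i\<in>UNIV. (Y \<bullet> tangent i y0) *\<^sub>R tangent i y0) + (Y \<bullet> \<nu>) *\<^sub>R \<nu>"
    by (rule orthonormal_frame[OF y0(1) orth[folded tangent_def]]) blast
  define X where "X = P1 - Q"
  have "e \<bullet> tangent i y0 = 0" for i
  proof -
    define f where "f y = 0 * ((\<phi> y - Q) \<bullet> (\<phi> y - Q)) - (\<phi> y - Q) \<bullet> e - 0" for y
    have "pderivative i f y0 = pderivative i (\<lambda>y. 0) y0"
      by (rule pderivative_cong[OF open_V y0(1)]) (use flat imM in \<open>auto simp: f_def\<close>)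
    moreover have "pderivative i f y0 = ((2 * 0) *\<^sub>R (\<phi> y0 - Q) - e) \<bullet> tangent i y0"
      unfolding f_def[abs_def] by (rule derivatives_linear_quadratic(2)[OF y0(1)])
    ultimately show ?thesis by (simp add: pderivative_const)
  qed
  then have e\<nu>: "e = (e \<bullet> \<nu>) *\<^sub>R \<nu>" using \<nu>(2)[of e] by simp
  have "X \<bullet> tangent i y0 = 0" for i
  proof -
    define f where "f y = (- 1) * ((\<phi> y - Q) \<bullet> (\<phi> y - Q)) - (\<phi> y - Q) \<bullet> 0 - 0" for y
    have sf: "smooth_on W f" unfolding f_def[abs_def] by (rule derivatives_linear_quadratic(1)[OF y0(1)])
    have "f y0 \<le> f y" if "y \<in> W" for y
    proof -
      have "norm (\<phi> y - Q) \<le> norm (\<phi> y0 - Q)" using P1(2) imM that y0 by (auto simp: dist_norm)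
      then have "(norm (\<phi> y - Q))\<^sup>2 \<le> (norm (\<phi> y0 - Q))\<^sup>2" by (intro power_mono) auto
      then show ?thesis by (simp add: f_def power2_norm_eq_inner)
    qed
    then have "pderivative i f y0 = 0" by (rule local_minimum_derivatives(1)[OF open_V y0(1) sf])
    moreover have "pderivative i f y0 = ((2 * (- 1)) *\<^sub>R (\<phi> y0 - Q) - 0) \<bullet> tangent i y0"
      unfolding f_def[abs_def] by (rule derivatives_linear_quadratic(2)[OF y0(1)])
    ultimately show ?thesis by (simp add: X_def y0)
  qed
  then have X\<nu>: "X = (X \<bullet> \<nu>) *\<^sub>R \<nu>" using \<nu>(2)[of X] by simp
  \<comment> \<open>\<open>X\<close> and \<open>e\<close> are multiples of the same unit normal and
    orthogonal to each other. As \<open>e\<close> is not zero, \<open>X\<close> vanishes, and since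
    \<open>P1\<close> is farthest from \<open>Q\<close>, \<open>M\<close> shrinks to a
    point.\<close>
  have "0 = X \<bullet> e" using flat[OF P1(1)] by (simp add: X_def)
  also have "X \<bullet> e = (X \<bullet> \<nu>) * (e \<bullet> \<nu>)" by (subst e\<nu>) (simp add: mult.commute)
  finally have "X \<bullet> \<nu> = 0" using e\<nu> e by auto
  then have "P1 = Q" using X\<nu> by (simp add: X_def)
  then have MQ: "P = Q" if "P \<in> M" for P using P1(2)[OF that] by simp
  have "\<phi> y = Q" if "y \<in> W" for y using MQ imM that by blast
  \<comment> \<open>A constant parametrization cannot have unit tangent vectors;
    \<open>undefined\<close> below is just some index.\<close>
  then have "pderivative i \<phi> y0 = pderivative i (\<lambda>y. Q) y0" for i
    by (intro pderivative_cong[OF open_V y0(1)])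
  then show False using orth[of undefined undefined] by (simp add: pderivative_const)
qed

theorem theorem4:
  fixes M :: "(real ^ ('n::finite option)) set"
    and dV :: "(real ^ ('n option)) measure"
    and Q :: "real ^ ('n option)"
    and G :: "real ^ ('n option) \<Rightarrow> real"
  assumes "CARD('n) \<in> {3, 4, 5}"
    and "closed_embedded_hypersurface M"
    and "riemannian_volume M dV"
    and "Q \<in> M"
    and "conformal_green_function M dV Q G"
    and "\<forall>P\<in>M - {Q}. G P = green_constant CARD('n) * dist P Q powr (2 - real CARD('n))"
  shows "round_sphere M"
proof -
  have n: "CARD('n) \<ge> 3" using assms(1) by auto
  have eqs: "immersion.pole_equation \<psi> Q x"
    if "local_parametrization M V \<psi>" "Q \<notin> \<psi> ` V" "x \<in> V" for V \<psi> x
    by (rule green_pole_equation[OF assms(2-4) n assms(5,6) that])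
  have cM: "compact M" using assms(2) by (simp add: closed_embedded_hypersurface_def)
  obtain e k where e: "e \<bullet> e = 1" and near: "\<And>\<eta>. \<eta> > 0 \<Longrightarrow> \<exists>\<delta>>0. \<forall>P\<in>M. dist P Q < \<delta> \<longrightarrow>
    \<bar>(P - Q) \<bullet> e - k * ((P - Q) \<bullet> (P - Q))\<bar> \<le> \<eta> * ((P - Q) \<bullet> (P - Q))"
    by (rule near_pole_expansion[OF assms(2,4) n]) (blast intro: eqs)+
  \<comment> \<open>Stated for any direction \<open>d\<close>, to be used for \<open>e\<close> with
    \<open>k\<close> and for \<open>- e\<close> with \<open>- k\<close>.\<close>
  have bound: "(P - Q) \<bullet> d \<le> c * ((P - Q) \<bullet> (P - Q))"
    if "P \<in> M" and "\<And>\<eta>. \<eta> > 0 \<Longrightarrow> \<exists>\<delta>>0. \<forall>P\<in>M. dist P Q < \<delta> \<longrightarrow> (P - Q) \<bullet> d \<le> (c + \<eta>) * ((P - Q) \<bullet> (P - Q))"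
    for P d c
  proof (rule one_sided_bound_by_touching[OF cM that(2) _ that(1)])
    show False if "P1 \<in> M" "P1 \<noteq> Q" "\<epsilon> > 0" "open N" "P1 \<in> N"
      "C * ((P1 - Q) \<bullet> (P1 - Q)) = (P1 - Q) \<bullet> d + \<epsilon>"
      "\<And>P. P \<in> M \<Longrightarrow> P \<in> N \<Longrightarrow> (P - Q) \<bullet> d + \<epsilon> \<le> C * ((P - Q) \<bullet> (P - Q))" for P1 C \<epsilon> N
      by (rule touching_contradiction[OF assms(2) n _ that]) (rule eqs)
  qed
  have upper: "(P - Q) \<bullet> e \<le> k * ((P - Q) \<bullet> (P - Q))" if "P \<in> M" for P
  proof (rule bound[OF that])
    show "\<exists>\<delta>>0. \<forall>P\<in>M. dist P Q < \<delta> \<longrightarrow> (P - Q) \<bullet> e \<le> (k + \<eta>) * ((P - Q) \<bullet> (P - Q))" if \<eta>: "\<eta> > 0" for \<eta>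
    proof -
      obtain \<delta> where \<delta>: "\<delta> > 0" "\<And>P. P \<in> M \<Longrightarrow> dist P Q < \<delta> \<Longrightarrow>
        \<bar>(P - Q) \<bullet> e - k * ((P - Q) \<bullet> (P - Q))\<bar> \<le> \<eta> * ((P - Q) \<bullet> (P - Q))"
        using near[OF \<eta>] by blast
      have "(P - Q) \<bullet> e \<le> (k + \<eta>) * ((P - Q) \<bullet> (P - Q))" if "P \<in> M" "dist P Q < \<delta>" for P
        unfolding distrib_right using \<delta>(2)[OF that] by linarith
      then show ?thesis using \<delta>(1) by blast
    qed
  qed
  have lower: "(P - Q) \<bullet> (- e) \<le> (- k) * ((P - Q) \<bullet> (P - Q))" if "P \<in> M" for P
  proof (rule bound[OF that])
    show "\<exists>\<delta>>0. \<forall>P\<in>M. dist P Q < \<delta> \<longrightarrow> (P - Q) \<bullet> (- e) \<le> (- k + \<eta>) * ((P - Q) \<bullet> (P - Q))" if \<eta>: "\<eta> > 0" for \<eta>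
    proof -
      obtain \<delta> where \<delta>: "\<delta> > 0" "\<And>P. P \<in> M \<Longrightarrow> dist P Q < \<delta> \<Longrightarrow>
        \<bar>(P - Q) \<bullet> e - k * ((P - Q) \<bullet> (P - Q))\<bar> \<le> \<eta> * ((P - Q) \<bullet> (P - Q))"
        using near[OF \<eta>] by blast
      have "(P - Q) \<bullet> (- e) \<le> (- k + \<eta>) * ((P - Q) \<bullet> (P - Q))" if "P \<in> M" "dist P Q < \<delta>" for P
        unfolding inner_minus_right distrib_right using \<delta>(2)[OF that] by linarith
      then show ?thesis using \<delta>(1) by blast
    qed
  qed
  have eq: "(P - Q) \<bullet> e = k * ((P - Q) \<bullet> (P - Q))" if "P \<in> M" for P
    using upper[OF that] lower[OF that] by simp
  have "e \<noteq> 0" using e by auto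
  \<comment> \<open>For \<open>k = 0\<close> the identity \<open>eq\<close> would place
    \<open>M\<close> in a hyperplane.\<close>
  from hypersurface_not_in_hyperplane[OF assms(2,4) this] have k: "k \<noteq> 0" using eq by force
  \<comment> \<open>Centre and radius result from completing the square in \<open>eq\<close>. The
    absolute value is needed because the sign of \<open>k\<close> depends on the choice of
    \<open>e\<close>.\<close>
  define r where "r = 1 / (2 * \<bar>k\<bar>)"
  define a where "a = Q + (1 / (2 * k)) *\<^sub>R e"
  have r: "r > 0" using k by (simp add: r_def)
  have "M \<subseteq> sphere a r"
  proof
    fix P assume P: "P \<in> M"
    have "(P - a) \<bullet> (P - a) = (P - Q) \<bullet> (P - Q) - (1 / k) * ((P - Q) \<bullet> e) + (1 / (2 * k))\<^sup>2"
      by (simp add: a_def algebra_simps inner_commute e power2_eq_square)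
    also have "\<dots> = r\<^sup>2" using k by (simp add: eq[OF P] r_def power2_eq_square)
    finally have "(norm (P - a))\<^sup>2 = r\<^sup>2" by (simp add: power2_norm_eq_inner)
    then have "norm (P - a) = r" using r by (simp add: power2_eq_iff_nonneg)
    then show "P \<in> sphere a r" by (simp add: dist_norm norm_minus_commute)
  qed
  then have "M = sphere a r"
    using hypersurface_in_sphere[OF assms(2) _ r] assms(4) by blast
  then show ?thesis using r unfolding round_sphere_def by blast
qed

end
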